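(* Suppose $F$ is a nonempty finite set of primes and $q$ is a prime which does not belong to $F$. Then there are a multi-index $\mathbf{K}=(K_p)\in\mathbb{N}^F$ and $d\in\mathbb{N}$ such that $$o_{\mathbf{K}+\mathbf{l}}(q)=d\Bigl(\prod_{p\in F}p^{l_p}\Bigr)\quad\text{for every } \mathbf{l}=(l_p)\in\mathbb{N}^F,$$ and $C(\mathcal{U}(\mathbb{Z}_F))\rtimes_\sigma\mathbb{Z}$ is the direct sum of $\bigl(\prod_{p\in F}(p-1)p^{K_p-1}\bigr)/d$ copies of a Bunce-Deddens algebra with supernatural number $d\bigl(\prod_{p\in F}p^\infty\bigr)$.
   Context: $\mathbb{N}=\{0,1,2,\dots\}$. $\mathbb{Z}_p$ is the ring of $p$-adic integers, $\mathbb{Z}_F:=\prod_{p\in F}\mathbb{Z}_p$, and $\mathcal{U}(R)$ is the group of units of a ring $R$. For $\mathbf{l}=(l_p)\in\mathbb{N}^F$, $o_{\mathbf{l}}(q)$ is the order of (the image of) $q$ in $\prod_{p\in F}\mathcal{U}(\mathbb{Z}/p^{l_p}\mathbb{Z})$. The action $\sigma$ of $\mathbb{Z}$ on $C(\mathcal{U}(\mathbb{Z}_F))$ is $\sigma_m(f)(x)=f(q^{-m}x)$ ($q$ is a unit in $\mathbb{Z}_F$). Let $(n_k)_{k\ge0}$ be integers with $n_k\ge2$ and $X=\prod_{k\ge0}\{0,1,\dots,n_k-1\}$. Addition of $1$ with carry over is a homeomorphism of $X$ called the odometer; with $\tau$ the induced action of $\mathbb{Z}$ on $C(X)$, the crossed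 product $C(X)\rtimes_\tau\mathbb{Z}$ is called a Bunce-Deddens algebra with supernatural number $\prod_{k\ge0}n_k$ (a formal product, regarded as a supernatural number, i.e. as a formal product of prime powers with exponents in $\{0,1,2,\dots,\infty\}$). *)

theory Defs
  imports
    "HOL-Analysis.Analysis"
    "HOL-Algebra.Product_Groups"
    "HOL-Algebra.Multiplicative_Group"
    "HOL-Algebra.IntRing"
    "HOL-Computational_Algebra.Primes"
    "HOL-Library.Extended_Nat"
begin

section \<open>The rings \<open>\<int>\<^sub>p\<close> and \<open>\<int>\<^sub>F\<close>\<close>

definition product_ring :: "'i set \<Rightarrow> ('i \<Rightarrow> ('a, 'm) ring_scheme) \<Rightarrow> ('i \<Rightarrow> 'a) ring" where
  "product_ring I R =
    \<lparr>carrier = (\<Pi>\<^sub>E i\<in>I. carrier (R i)),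
     monoid.mult = (\<lambda>x y. \<lambda>i\<in>I. x i \<otimes>\<^bsub>R i\<^esub> y i),
     one = (\<lambda>i\<in>I. \<one>\<^bsub>R i\<^esub>),
     zero = (\<lambda>i\<in>I. \<zero>\<^bsub>R i\<^esub>),
     add = (\<lambda>x y. \<lambda>i\<in>I. x i \<oplus>\<^bsub>R i\<^esub> y i)\<rparr>"

text \<open>The inverse limit of the rings \<open>\<int>/p\<^sup>n\<int>\<close>. Elements of \<^term>\<open>ZFact k\<close> are cosets, and the
  transition map sends a coset of \<open>p\<^sup>n\<^sup>+\<^sup>1\<int>\<close> to the coset of \<open>p\<^sup>n\<int>\<close> containing it.\<close>

definition padic_ring :: "nat \<Rightarrow> (nat \<Rightarrow> int set) ring" where
  "padic_ring p = (product_ring UNIV (\<lambda>n. ZFact (int p ^ n)))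
     \<lparr>carrier := {x. (\<forall>n. x n \<in> carrier (ZFact (int p ^ n))) \<and> (\<forall>n. x (Suc n) \<subseteq> x n)}\<rparr>"

definition padic_topology :: "nat \<Rightarrow> (nat \<Rightarrow> int set) topology" where
  "padic_topology p =
     subtopology (product_topology (\<lambda>n. discrete_topology (carrier (ZFact (int p ^ n)))) UNIV)
       (carrier (padic_ring p))"

definition ZF_ring :: "nat set \<Rightarrow> (nat \<Rightarrow> nat \<Rightarrow> int set) ring" where
  "ZF_ring F = product_ring F padic_ring"

definition ZF_units_topology :: "nat set \<Rightarrow> (nat \<Rightarrow> nat \<Rightarrow> int set) topology" where
  "ZF_units_topology F = subtopology (product_topology padic_topology F) (Units (ZF_ring F))"

text \<open>The image of a natural number in a ring.\<close>

definition nat_image :: "('a, 'm) ring_scheme \<Rightarrow> nat \<Rightarrow> 'a" where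
  "nat_image R q = [q] \<cdot>\<^bsub>R\<^esub> \<one>\<^bsub>R\<^esub>"

definition unit_order :: "nat set \<Rightarrow> (nat \<Rightarrow> nat) \<Rightarrow> nat \<Rightarrow> nat" where
  "unit_order F l q =
     group.ord (product_group F (\<lambda>p. units_of (ZFact (int p ^ l p))))
       (\<lambda>p\<in>F. nat_image (ZFact (int p ^ l p)) q)"


section \<open>C*-algebras\<close>

record 'a star_algebra = "(complex, 'a) module" +
  adj :: "'a \<Rightarrow> 'a"

record 'a cstar_algebra = "'a star_algebra" +
  cnorm :: "'a \<Rightarrow> real"

definition cstar_isomorphic :: "('a, 'm) cstar_algebra_scheme \<Rightarrow> ('b, 'n) cstar_algebra_scheme \<Rightarrow> bool" where
  "cstar_isomorphic A B \<longleftrightarrow> (\<exists>\<phi>\<in>ring_iso A B. \<forall>x\<in>carrier A.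
     (\<forall>c. \<phi> (c \<odot>\<^bsub>A\<^esub> x) = c \<odot>\<^bsub>B\<^esub> \<phi> x) \<and>
     \<phi> (adj A x) = adj B (\<phi> x) \<and>
     cnorm B (\<phi> x) = cnorm A x)"

text \<open>The direct sum of \<open>N\<close> copies of \<open>A\<close>, with the maximum norm. The inserted \<open>0\<close> only matters for \<open>N = 0\<close>.\<close>

definition direct_sum_copies :: "nat \<Rightarrow> ('a, 'm) cstar_algebra_scheme \<Rightarrow> (nat \<Rightarrow> 'a) cstar_algebra" where
  "direct_sum_copies N A =
    \<lparr>carrier = (\<Pi>\<^sub>E i\<in>{..<N}. carrier A),
     monoid.mult = (\<lambda>x y. \<lambda>i\<in>{..<N}. x i \<otimes>\<^bsub>A\<^esub> y i),
     one = (\<lambda>i\<in>{..<N}. \<one>\<^bsub>A\<^esub>),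
     zero = (\<lambda>i\<in>{..<N}. \<zero>\<^bsub>A\<^esub>),
     add = (\<lambda>x y. \<lambda>i\<in>{..<N}. x i \<oplus>\<^bsub>A\<^esub> y i),
     smult = (\<lambda>c x. \<lambda>i\<in>{..<N}. c \<odot>\<^bsub>A\<^esub> x i),
     adj = (\<lambda>x. \<lambda>i\<in>{..<N}. adj A (x i)),
     cnorm = (\<lambda>x. Max (insert 0 ((\<lambda>i. cnorm A (x i)) ` {..<N})))\<rparr>"

text \<open>\<open>C(X)\<close> for a compact Hausdorff space \<open>X\<close>.\<close>

definition cont_algebra :: "'x topology \<Rightarrow> ('x \<Rightarrow> complex) cstar_algebra" where
  "cont_algebra X =
    \<lparr>carrier = {f \<in> extensional (topspace X). continuous_map X euclidean f},
     monoid.mult = (\<lambda>f g. \<lambda>x\<in>topspace X. f x * g x),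
     one = (\<lambda>x\<in>topspace X. 1),
     zero = (\<lambda>x\<in>topspace X. 0),
     add = (\<lambda>f g. \<lambda>x\<in>topspace X. f x + g x),
     smult = (\<lambda>c f. \<lambda>x\<in>topspace X. c * f x),
     adj = (\<lambda>f. \<lambda>x\<in>topspace X. cnj (f x)),
     cnorm = (\<lambda>f. Sup (insert 0 ((\<lambda>x. cmod (f x)) ` topspace X)))\<rparr>"

text \<open>The action \<open>\<alpha>\<close> on \<open>C(X)\<close> with \<open>\<alpha>\<^sub>m(f)(x) = f(h\<^sub>-\<^sub>m(x))\<close> induced by an action \<open>h\<close> of \<open>\<int>\<close>
  on \<open>X\<close>.\<close>

definition induced_action :: "'x topology \<Rightarrow> (int \<Rightarrow> 'x \<Rightarrow> 'x) \<Rightarrow> int \<Rightarrow> ('x \<Rightarrow> complex) \<Rightarrow> 'x \<Rightarrow> complex" where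
  "induced_action X h m f = (\<lambda>x\<in>topspace X. f (h (- m) x))"


section \<open>Crossed products by \<open>\<int>\<close>\<close>

text \<open>The algebra of finitely supported functions \<open>\<int> \<rightarrow> A\<close>, where \<open>f\<close> stands for the formal sum
  of the \<open>f(n) u\<^sup>n\<close> with \<open>u\<close> unitary and \<open>u a u\<^sup>* = \<alpha>\<^sub>1(a)\<close> for \<open>a \<in> A\<close>.\<close>

definition conv_algebra ::
  "('a, 'm) star_algebra_scheme \<Rightarrow> (int \<Rightarrow> 'a \<Rightarrow> 'a) \<Rightarrow> (int \<Rightarrow> 'a) star_algebra" where
  "conv_algebra A \<alpha> =
    \<lparr>carrier = {f. (\<forall>n. f n \<in> carrier A) \<and> finite {n. f n \<noteq> \<zero>\<^bsub>A\<^esub>}},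
     monoid.mult = (\<lambda>f g n. \<Oplus>\<^bsub>A\<^esub>m\<in>{m. f m \<noteq> \<zero>\<^bsub>A\<^esub>}. f m \<otimes>\<^bsub>A\<^esub> \<alpha> m (g (n - m))),
     one = (\<lambda>n. if n = 0 then \<one>\<^bsub>A\<^esub> else \<zero>\<^bsub>A\<^esub>),
     zero = (\<lambda>n. \<zero>\<^bsub>A\<^esub>),
     add = (\<lambda>f g n. f n \<oplus>\<^bsub>A\<^esub> g n),
     smult = (\<lambda>c f n. c \<odot>\<^bsub>A\<^esub> f n),
     adj = (\<lambda>f n. \<alpha> n (adj A (f (- n))))\<rparr>"

definition cstar_seminorm :: "('a, 'm) star_algebra_scheme \<Rightarrow> ('a \<Rightarrow> real) \<Rightarrow> bool" where
  "cstar_seminorm B \<nu> \<longleftrightarrow>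
     (\<forall>x\<in>carrier B. 0 \<le> \<nu> x \<and> \<nu> (adj B x \<otimes>\<^bsub>B\<^esub> x) = (\<nu> x)\<^sup>2 \<and> (\<forall>c. \<nu> (c \<odot>\<^bsub>B\<^esub> x) = cmod c * \<nu> x)) \<and>
     (\<forall>x\<in>carrier B. \<forall>y\<in>carrier B. \<nu> (x \<oplus>\<^bsub>B\<^esub> y) \<le> \<nu> x + \<nu> y \<and> \<nu> (x \<otimes>\<^bsub>B\<^esub> y) \<le> \<nu> x * \<nu> y)"

text \<open>The C*-seminorms on \<open>B\<close> are exactly the functions \<open>x \<mapsto> \<parallel>\<pi>(x)\<parallel>\<close> for *-homomorphisms \<open>\<pi>\<close> from
  \<open>B\<close> to C*-algebras (for \<open>B\<close> as in \<^term>\<open>conv_algebra A \<alpha>\<close> with \<open>A\<close> unital, these are the integrated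
  forms of covariant representations). Using seminorms avoids quantifying over the types of the
  target algebras.\<close>

definition universal_norm :: "('a, 'm) star_algebra_scheme \<Rightarrow> 'a \<Rightarrow> real" where
  "universal_norm B x = (SUP \<nu>\<in>{\<nu>. cstar_seminorm B \<nu>}. \<nu> x)"

definition cauchy_sequences :: "('a, 'm) star_algebra_scheme \<Rightarrow> (nat \<Rightarrow> 'a) set" where
  "cauchy_sequences B = {s. (\<forall>i. s i \<in> carrier B) \<and>
     (\<forall>e>0. \<exists>M. \<forall>i\<ge>M. \<forall>j\<ge>M. universal_norm B (s i \<ominus>\<^bsub>B\<^esub> s j) < e)}"

definition null_difference :: "('a, 'm) star_algebra_scheme \<Rightarrow> ((nat \<Rightarrow> 'a) \<times> (nat \<Rightarrow> 'a)) set" where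
  "null_difference B = {(s, t). s \<in> cauchy_sequences B \<and> t \<in> cauchy_sequences B \<and>
     (\<lambda>i. universal_norm B (s i \<ominus>\<^bsub>B\<^esub> t i)) \<longlonglongrightarrow> 0}"

text \<open>The Hausdorff completion in the universal norm, as a quotient of the set of Cauchy sequences
  with operations defined on representatives.\<close>

definition enveloping_cstar_algebra ::
  "('a, 'm) star_algebra_scheme \<Rightarrow> (nat \<Rightarrow> 'a) set cstar_algebra" where
  "enveloping_cstar_algebra B =
    \<lparr>carrier = cauchy_sequences B // null_difference B,
     monoid.mult = (\<lambda>x y. \<Union>s\<in>x. \<Union>t\<in>y. null_difference B `` {\<lambda>i. s i \<otimes>\<^bsub>B\<^esub> t i}),
     one = null_difference B `` {\<lambda>i. \<one>\<^bsub>B\<^esub>},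
     zero = null_difference B `` {\<lambda>i. \<zero>\<^bsub>B\<^esub>},
     add = (\<lambda>x y. \<Union>s\<in>x. \<Union>t\<in>y. null_difference B `` {\<lambda>i. s i \<oplus>\<^bsub>B\<^esub> t i}),
     smult = (\<lambda>c x. \<Union>s\<in>x. null_difference B `` {\<lambda>i. c \<odot>\<^bsub>B\<^esub> s i}),
     adj = (\<lambda>x. \<Union>s\<in>x. null_difference B `` {\<lambda>i. adj B (s i)}),
     cnorm = (\<lambda>x. THE r. \<forall>s\<in>x. (\<lambda>i. universal_norm B (s i)) \<longlonglongrightarrow> r)\<rparr>"

definition crossed_product ::
  "('a, 'm) star_algebra_scheme \<Rightarrow> (int \<Rightarrow> 'a \<Rightarrow> 'a) \<Rightarrow> (nat \<Rightarrow> int \<Rightarrow> 'a) set cstar_algebra" where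
  "crossed_product A \<alpha> = enveloping_cstar_algebra (conv_algebra A \<alpha>)"


section \<open>The action \<open>\<sigma>\<close> and Bunce-Deddens algebras\<close>

definition sigma_action ::
  "nat set \<Rightarrow> nat \<Rightarrow> int \<Rightarrow> ((nat \<Rightarrow> nat \<Rightarrow> int set) \<Rightarrow> complex) \<Rightarrow> (nat \<Rightarrow> nat \<Rightarrow> int set) \<Rightarrow> complex" where
  "sigma_action F q = induced_action (ZF_units_topology F)
     (\<lambda>m x. (nat_image (ZF_ring F) q [^]\<^bsub>units_of (ZF_ring F)\<^esub> m) \<otimes>\<^bsub>ZF_ring F\<^esub> x)"

definition odometer_space :: "(nat \<Rightarrow> nat) \<Rightarrow> (nat \<Rightarrow> nat) topology" where
  "odometer_space n = product_topology (\<lambda>k. discrete_topology {0..<n k}) UNIV"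

text \<open>The carry reaches position \<open>k\<close> iff all earlier digits are maximal.\<close>

definition odometer :: "(nat \<Rightarrow> nat) \<Rightarrow> (nat \<Rightarrow> nat) \<Rightarrow> nat \<Rightarrow> nat" where
  "odometer n x k = (if \<forall>j<k. x j = n j - 1 then (x k + 1) mod n k else x k)"

definition homeo_power :: "'x topology \<Rightarrow> ('x \<Rightarrow> 'x) \<Rightarrow> int \<Rightarrow> 'x \<Rightarrow> 'x" where
  "homeo_power X S m =
     (if m \<ge> 0 then S ^^ nat m else inv_into (topspace X) S ^^ nat (- m))"

definition odometer_algebra :: "(nat \<Rightarrow> nat) \<Rightarrow> (nat \<Rightarrow> int \<Rightarrow> (nat \<Rightarrow> nat) \<Rightarrow> complex) set cstar_algebra" where
  "odometer_algebra n = crossed_product (cont_algebra (odometer_space n))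
     (induced_action (odometer_space n) (homeo_power (odometer_space n) (odometer n)))"

text \<open>A supernatural number is given by its exponents, which are \<open>0\<close> off the primes. Multiplication
  is addition of exponents.\<close>

type_synonym supernatural = "nat \<Rightarrow> enat"

definition supernatural_of_nat :: "nat \<Rightarrow> supernatural" where
  "supernatural_of_nat d p = (if Factorial_Ring.prime p then enat (multiplicity p d) else 0)"

definition supernatural_mult :: "supernatural \<Rightarrow> supernatural \<Rightarrow> supernatural" where
  "supernatural_mult s t p = s p + t p"

definition supernatural_prod :: "(nat \<Rightarrow> nat) \<Rightarrow> supernatural" where
  "supernatural_prod n p = (SUP M. \<Sum>k<M. supernatural_of_nat (n k) p)"

definition primes_to_infinity :: "nat set \<Rightarrow> supernatural" where
  "primes_to_infinity F p = (if p \<in> F then \<infinity> else 0)"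

definition bunce_deddens_algebra ::
  "supernatural \<Rightarrow> (nat \<Rightarrow> int \<Rightarrow> (nat \<Rightarrow> nat) \<Rightarrow> complex) set cstar_algebra \<Rightarrow> bool" where
  "bunce_deddens_algebra s D \<longleftrightarrow>
     (\<exists>n. (\<forall>k. n k \<ge> 2) \<and> supernatural_prod n = s \<and> D = odometer_algebra n)"

end

theory Submission
  imports Defs "HOL-Number_Theory.Number_Theory"
begin

text \<open>
  The dynamical system \<open>(\<U>(\<int>\<^sub>F), q)\<close> splits into finitely many copies of an odometer, and the crossed
  product turns this disjoint union into a direct sum.

  \<^bold>\<open>Arithmetic.\<close> Choose \<open>m > 0\<close> such that every \<open>p \<in> F\<close> divides \<open>q ^ m - 1\<close> at least twice, and let \<open>K p\<close>
  be the exact multiplicity of \<open>p\<close> in \<open>q ^ m - 1\<close>. From this level on, raising to the power \<open>p\<close> increases the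
  multiplicity of \<open>p\<close> by exactly one, also for \<open>p = 2\<close>. So if \<open>d\<close> is the order of \<open>q\<close> modulo
  \<open>\<Prod> p ^ K p\<close>, then its order modulo \<open>\<Prod> p ^ (K p + l p)\<close> is \<open>d \<Prod> p ^ l p\<close> (\<open>stable_order\<close>). The unit
  group grows by the same factor, so the number \<open>N\<close> of cosets of the group generated by \<open>q\<close> is the same at all
  levels, and representatives at the lowest level remain representatives (\<open>lift_representatives\<close>).

  \<^bold>\<open>Dynamics.\<close> Let \<open>P = \<Prod> F\<close> and let \<open>r 0, \<dots>, r (N - 1)\<close> be such representatives. A digit sequence \<open>x\<close> for the
  bases \<open>d P, P, P, \<dots>\<close> has partial values that converge in the inverse limit of the \<open>\<int> / d P ^ k\<close>, so
  \<open>H i x = r i q ^ x\<close> makes sense in \<open>\<int>\<^sub>F\<close>. Comparing residues at each level shows that the \<open>H i\<close> are jointly a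
  continuous bijection onto \<open>\<U>(\<int>\<^sub>F)\<close> (\<open>H_inj\<close>, \<open>H_surj\<close>), and adding \<open>1\<close> to \<open>x\<close> multiplies \<open>H i x\<close> by \<open>q\<close>.
  Compactness does the rest of the topology.

  \<^bold>\<open>Operator algebras.\<close> Restriction along the \<open>H i\<close> identifies the convolution algebra of \<open>\<U>(\<int>\<^sub>F)\<close> with the direct
  sum of \<open>N\<close> copies of that of the odometer. It remains to see that the universal C*-norm of a direct sum is the
  maximum of the norms of the components (\<open>universal_norm_decomposition\<close>). A C*-seminorm is bounded by the sum over
  the components, and applying this bound to iterates of \<open>x \<mapsto> x\<^sup>* x\<close> improves the sum to the maximum. The
  suprema that define universal norms are finite because a C*-seminorm on \<open>C(X)\<close> is dominated by the supremum norm,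
  as real functions bounded by \<open>1\<close> are means of two unitaries.
\<close>

section \<open>Star algebras and their universal norm\<close>

text \<open>These axioms say that all operations are compatible with differences. Together with the inequalities
  of a C*-seminorm, this is what lets the operations pass to the completion.\<close>

locale star_alg = abelian_group B for B :: "('a, 'm) star_algebra_scheme" (structure) +
  assumes mult_closed: "\<lbrakk>x \<in> carrier B; y \<in> carrier B\<rbrakk> \<Longrightarrow> x \<otimes> y \<in> carrier B"
    and one_closed: "\<one> \<in> carrier B"
    and left_distrib: "\<lbrakk>x \<in> carrier B; y \<in> carrier B; z \<in> carrier B\<rbrakk> \<Longrightarrow> (x \<oplus> y) \<otimes> z = x \<otimes> z \<oplus> y \<otimes> z"
    and right_distrib: "\<lbrakk>x \<in> carrier B; y \<in> carrier B; z \<in> carrier B\<rbrakk> \<Longrightarrow> z \<otimes> (x \<oplus> y) = z \<otimes> x \<oplus> z \<otimes> y"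
    and adj_closed: "x \<in> carrier B \<Longrightarrow> adj B x \<in> carrier B"
    and adj_add: "\<lbrakk>x \<in> carrier B; y \<in> carrier B\<rbrakk> \<Longrightarrow> adj B (x \<oplus> y) = adj B x \<oplus> adj B y"
    and adj_adj: "x \<in> carrier B \<Longrightarrow> adj B (adj B x) = x"
    and smult_closed: "x \<in> carrier B \<Longrightarrow> c \<odot> x \<in> carrier B"
    and smult_add: "\<lbrakk>x \<in> carrier B; y \<in> carrier B\<rbrakk> \<Longrightarrow> c \<odot> (x \<oplus> y) = c \<odot> x \<oplus> c \<odot> y"
    and smult_minus_one: "x \<in> carrier B \<Longrightarrow> (- 1) \<odot> x = \<ominus> x"
begin

lemma minus_eqI:
  assumes "x = a \<oplus> y" "a \<in> carrier B" "y \<in> carrier B"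
  shows "x \<ominus> y = a"
  using assms by (simp add: minus_eq a_assoc r_neg)

lemma minus_add_cancel:
  "\<lbrakk>x \<in> carrier B; y \<in> carrier B\<rbrakk> \<Longrightarrow> (x \<ominus> y) \<oplus> y = x"
  by (simp add: minus_eq a_assoc l_neg)

lemma minus_add_minus:
  assumes "x \<in> carrier B" "y \<in> carrier B" "z \<in> carrier B"
  shows "x \<ominus> z = (x \<ominus> y) \<oplus> (y \<ominus> z)"
  by (rule minus_eqI) (use assms in \<open>simp_all add: a_assoc minus_add_cancel\<close>)

lemma minus_swap:
  assumes "x \<in> carrier B" "y \<in> carrier B"
  shows "\<ominus> (x \<ominus> y) = y \<ominus> x"
  using assms by (simp add: minus_eq minus_add a_comm)

lemma add_minus_add:
  assumes "x \<in> carrier B" "y \<in> carrier B" "x' \<in> carrier B" "y' \<in> carrier B"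
  shows "(x \<oplus> y) \<ominus> (x' \<oplus> y') = (x \<ominus> x') \<oplus> (y \<ominus> y')"
  using assms by (simp add: minus_eq minus_add a_ac)

lemma mult_minus_mult:
  assumes "x \<in> carrier B" "y \<in> carrier B" "x' \<in> carrier B" "y' \<in> carrier B"
  shows "x \<otimes> y \<ominus> x' \<otimes> y' = x \<otimes> (y \<ominus> y') \<oplus> (x \<ominus> x') \<otimes> y'"
proof (rule minus_eqI)
  have "x \<otimes> y = x \<otimes> (y \<ominus> y') \<oplus> x \<otimes> y'"
    using right_distrib[of "y \<ominus> y'" y' x] assms by (simp add: minus_add_cancel)
  moreover have "x \<otimes> y' = (x \<ominus> x') \<otimes> y' \<oplus> x' \<otimes> y'"
    using left_distrib[of "x \<ominus> x'" x' y'] assms by (simp add: minus_add_cancel)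
  ultimately show "x \<otimes> y = x \<otimes> (y \<ominus> y') \<oplus> (x \<ominus> x') \<otimes> y' \<oplus> x' \<otimes> y'"
    using assms by (simp add: a_assoc mult_closed)
qed (use assms in \<open>simp_all add: mult_closed\<close>)

lemma smult_minus:
  assumes "x \<in> carrier B" "y \<in> carrier B"
  shows "c \<odot> x \<ominus> c \<odot> y = c \<odot> (x \<ominus> y)"
  by (rule minus_eqI) (use assms in \<open>simp_all add: smult_closed minus_add_cancel flip: smult_add\<close>)

lemma adj_minus:
  assumes "x \<in> carrier B" "y \<in> carrier B"
  shows "adj B x \<ominus> adj B y = adj B (x \<ominus> y)"
  by (rule minus_eqI) (use assms in \<open>simp_all add: adj_closed minus_add_cancel flip: adj_add\<close>)

lemma smult_zero_right: "c \<odot> \<zero> = \<zero>"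
proof -
  have "c \<odot> \<zero> = c \<odot> \<zero> \<oplus> c \<odot> \<zero>"
    using smult_add[of \<zero> \<zero> c] by simp
  then show ?thesis
    by (simp add: smult_closed)
qed

context
  fixes \<nu> assumes nu: "cstar_seminorm B \<nu>"
begin

lemma seminorm_nonneg: "x \<in> carrier B \<Longrightarrow> 0 \<le> \<nu> x"
  and seminorm_cstar: "x \<in> carrier B \<Longrightarrow> \<nu> (adj B x \<otimes> x) = (\<nu> x)\<^sup>2"
  and seminorm_smult: "x \<in> carrier B \<Longrightarrow> \<nu> (c \<odot> x) = cmod c * \<nu> x"
  and seminorm_add: "\<lbrakk>x \<in> carrier B; y \<in> carrier B\<rbrakk> \<Longrightarrow> \<nu> (x \<oplus> y) \<le> \<nu> x + \<nu> y"
  and seminorm_mult: "\<lbrakk>x \<in> carrier B; y \<in> carrier B\<rbrakk> \<Longrightarrow> \<nu> (x \<otimes> y) \<le> \<nu> x * \<nu> y"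
  using nu unfolding cstar_seminorm_def by blast+

lemma seminorm_zero: "\<nu> \<zero> = 0"
  using seminorm_smult[of \<zero> 2] by (simp add: smult_zero_right)

lemma seminorm_uminus: "x \<in> carrier B \<Longrightarrow> \<nu> (\<ominus> x) = \<nu> x"
  using seminorm_smult[of x "- 1"] by (simp add: smult_minus_one)

lemma seminorm_swap: "\<lbrakk>x \<in> carrier B; y \<in> carrier B\<rbrakk> \<Longrightarrow> \<nu> (x \<ominus> y) = \<nu> (y \<ominus> x)"
  using seminorm_uminus[of "y \<ominus> x"] minus_swap[of y x] by simp

lemma seminorm_triangle:
  "\<lbrakk>x \<in> carrier B; y \<in> carrier B; z \<in> carrier B\<rbrakk> \<Longrightarrow> \<nu> (x \<ominus> z) \<le> \<nu> (x \<ominus> y) + \<nu> (y \<ominus> z)"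
  using seminorm_add[of "x \<ominus> y" "y \<ominus> z"] minus_add_minus[of x y z] by simp

lemma seminorm_diff_le:
  assumes "x \<in> carrier B" "y \<in> carrier B"
  shows "\<bar>\<nu> x - \<nu> y\<bar> \<le> \<nu> (x \<ominus> y)"
proof -
  have "\<nu> x \<le> \<nu> (x \<ominus> y) + \<nu> y"
    using seminorm_add[of "x \<ominus> y" y] assms by (simp add: minus_add_cancel)
  moreover have "\<nu> y \<le> \<nu> (y \<ominus> x) + \<nu> x"
    using seminorm_add[of "y \<ominus> x" x] assms by (simp add: minus_add_cancel)
  ultimately show ?thesis
    using seminorm_swap[OF assms] by simp
qed

text \<open>The C*-identity and submultiplicativity give \<open>\<nu>(x)\<^sup>2 \<le> \<nu>(x\<^sup>*) \<nu>(x)\<close>, hence \<open>\<nu>(x) \<le> \<nu>(x\<^sup>*)\<close>, and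
  this applies to \<open>x\<^sup>*\<close> as well.\<close>

lemma seminorm_adj:
  assumes "x \<in> carrier B"
  shows "\<nu> (adj B x) = \<nu> x"
proof -
  have le: "\<nu> y \<le> \<nu> (adj B y)" if "y \<in> carrier B" for y
  proof (cases "\<nu> y = 0")
    case False
    have "\<nu> y * \<nu> y \<le> \<nu> (adj B y) * \<nu> y"
      using seminorm_mult[of "adj B y" y] seminorm_cstar[OF that] that
      by (simp add: adj_closed power2_eq_square)
    then show ?thesis
      using False seminorm_nonneg[OF that] by simp
  qed (use that in \<open>simp add: seminorm_nonneg adj_closed\<close>)
  show ?thesis
    using le[OF assms] le[OF adj_closed[OF assms]] assms by (simp add: adj_adj)
qed

end

lemma zero_seminorm: "cstar_seminorm B (\<lambda>_. 0)"
  by (simp add: cstar_seminorm_def)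

end

text \<open>The universal norm is a supremum of real numbers, which is meaningful only for bounded families.\<close>

locale bounded_star_alg = star_alg +
  assumes bounded: "x \<in> carrier B \<Longrightarrow> bdd_above ((\<lambda>\<nu>. \<nu> x) ` {\<nu>. cstar_seminorm B \<nu>})"
begin

lemma seminorm_le_universal:
  "\<lbrakk>cstar_seminorm B \<nu>; x \<in> carrier B\<rbrakk> \<Longrightarrow> \<nu> x \<le> universal_norm B x"
  unfolding universal_norm_def by (rule cSUP_upper) (use bounded in auto)

lemma universal_norm_le:
  assumes "\<And>\<nu>. cstar_seminorm B \<nu> \<Longrightarrow> \<nu> x \<le> C"
  shows "universal_norm B x \<le> C"
  unfolding universal_norm_def by (rule cSUP_least) (use zero_seminorm assms in auto)

lemma universal_norm_nonneg: "x \<in> carrier B \<Longrightarrow> 0 \<le> universal_norm B x"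
  using seminorm_le_universal[OF zero_seminorm] .

text \<open>The conditions on a C*-seminorm survive suprema: the C*-identity because squaring is monotone and
  continuous, the inequalities because their right-hand sides are monotone in the seminorm.\<close>

lemma universal_seminorm: "cstar_seminorm B (universal_norm B)"
  unfolding cstar_seminorm_def
proof (intro conjI ballI allI)
  let ?N = "universal_norm B"
  fix x assume x: "x \<in> carrier B"
  show "0 \<le> ?N x"
    by (rule universal_norm_nonneg[OF x])
  have xx: "adj B x \<otimes> x \<in> carrier B"
    using x by (simp add: adj_closed mult_closed)
  show "?N (adj B x \<otimes> x) = (?N x)\<^sup>2"
  proof (rule antisym)
    show "?N (adj B x \<otimes> x) \<le> (?N x)\<^sup>2"
      using x by (intro universal_norm_le) (simp add: seminorm_cstar seminorm_nonneg seminorm_le_universal power_mono)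
    have "\<nu> x \<le> sqrt (?N (adj B x \<otimes> x))" if "cstar_seminorm B \<nu>" for \<nu>
      using seminorm_le_universal[OF that xx] seminorm_cstar[OF that x] by (simp add: real_le_rsqrt)
    then have "?N x \<le> sqrt (?N (adj B x \<otimes> x))"
      by (rule universal_norm_le)
    then show "(?N x)\<^sup>2 \<le> ?N (adj B x \<otimes> x)"
      using universal_norm_nonneg[OF x] universal_norm_nonneg[OF xx] 
      by (metis power_mono real_sqrt_pow2)
  qed
  show "?N (c \<odot> x) = cmod c * ?N x" for c
  proof (rule antisym)
    show "?N (c \<odot> x) \<le> cmod c * ?N x"
      using x by (intro universal_norm_le) (simp add: seminorm_smult seminorm_le_universal mult_left_mono)
    show "cmod c * ?N x \<le> ?N (c \<odot> x)"
    proof (cases "c = 0")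
      case False
      have "\<nu> x \<le> ?N (c \<odot> x) / cmod c" if "cstar_seminorm B \<nu>" for \<nu>
        using seminorm_le_universal[OF that smult_closed[OF x, of c]] seminorm_smult[OF that x, of c] False
        by (simp add: field_simps)
      then have "?N x \<le> ?N (c \<odot> x) / cmod c"
        by (rule universal_norm_le)
      then show ?thesis
        using False by (simp add: field_simps)
    qed (simp add: x smult_closed universal_norm_nonneg)
  qed
next
  let ?N = "universal_norm B"
  fix x y assume x: "x \<in> carrier B" and y: "y \<in> carrier B"
  show "?N (x \<oplus> y) \<le> ?N x + ?N y"
  proof (rule universal_norm_le)
    fix \<nu> assume nu: "cstar_seminorm B \<nu>"
    show "\<nu> (x \<oplus> y) \<le> ?N x + ?N y"
      using seminorm_add[OF nu x y] seminorm_le_universal[OF nu x] seminorm_le_universal[OF nu y] by linarith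
  qed
  show "?N (x \<otimes> y) \<le> ?N x * ?N y"
  proof (rule universal_norm_le)
    fix \<nu> assume nu: "cstar_seminorm B \<nu>"
    have "\<nu> x * \<nu> y \<le> ?N x * ?N y"
      using seminorm_le_universal[OF nu x] seminorm_le_universal[OF nu y]
        seminorm_nonneg[OF nu x] seminorm_nonneg[OF nu y] by (simp add: mult_mono)
    then show "\<nu> (x \<otimes> y) \<le> ?N x * ?N y"
      using seminorm_mult[OF nu x y] by linarith
  qed
qed

section \<open>The enveloping C*-algebra\<close>

abbreviation unorm :: "'a \<Rightarrow> real" where "unorm \<equiv> universal_norm B"

lemmas unorm_smult = seminorm_smult[OF universal_seminorm]
  and unorm_add = seminorm_add[OF universal_seminorm]
  and unorm_mult = seminorm_mult[OF universal_seminorm]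
  and unorm_zero = seminorm_zero[OF universal_seminorm]
  and unorm_swap = seminorm_swap[OF universal_seminorm]
  and unorm_triangle = seminorm_triangle[OF universal_seminorm]
  and unorm_diff_le = seminorm_diff_le[OF universal_seminorm]
  and unorm_adj = seminorm_adj[OF universal_seminorm]

lemma cauchy_closed: "s \<in> cauchy_sequences B \<Longrightarrow> s i \<in> carrier B"
  by (simp add: cauchy_sequences_def)

lemma cauchyD:
  assumes "s \<in> cauchy_sequences B" "e > 0"
  obtains M where "\<And>i j. \<lbrakk>i \<ge> M; j \<ge> M\<rbrakk> \<Longrightarrow> unorm (s i \<ominus> s j) < e"
  using assms unfolding cauchy_sequences_def by blast

lemma const_cauchy: "x \<in> carrier B \<Longrightarrow> (\<lambda>i. x) \<in> cauchy_sequences B"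
  by (simp add: cauchy_sequences_def minus_eq r_neg unorm_zero)

text \<open>All operations are Lipschitz on bounded sets, so this covers the sums, products, multiples and adjoints of
  Cauchy sequences.\<close>

lemma cauchy_dominated:
  assumes closed: "\<And>i. u i \<in> carrier B"
    and s: "s \<in> cauchy_sequences B" and t: "t \<in> cauchy_sequences B"
    and le: "\<And>i j. unorm (u i \<ominus> u j) \<le> C * unorm (s i \<ominus> s j) + D * unorm (t i \<ominus> t j)"
  shows "u \<in> cauchy_sequences B"
  unfolding cauchy_sequences_def
proof (intro CollectI conjI allI impI closed)
  fix e :: real assume e: "e > 0"
  define \<delta> where "\<delta> = e / (1 + \<bar>C\<bar> + \<bar>D\<bar>)"
  have \<delta>: "\<delta> > 0" using e by (simp add: \<delta>_def add_pos_nonneg)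
  obtain M1 where M1: "\<And>i j. \<lbrakk>i \<ge> M1; j \<ge> M1\<rbrakk> \<Longrightarrow> unorm (s i \<ominus> s j) < \<delta>"
    using cauchyD[OF s \<delta>] by blast
  obtain M2 where M2: "\<And>i j. \<lbrakk>i \<ge> M2; j \<ge> M2\<rbrakk> \<Longrightarrow> unorm (t i \<ominus> t j) < \<delta>"
    using cauchyD[OF t \<delta>] by blast
  have "unorm (u i \<ominus> u j) < e" if "i \<ge> max M1 M2" "j \<ge> max M1 M2" for i j
  proof -
    have ns: "0 \<le> unorm (s i \<ominus> s j)" and nt: "0 \<le> unorm (t i \<ominus> t j)"
      using s t by (simp_all add: universal_norm_nonneg cauchy_closed)
    have "C * unorm (s i \<ominus> s j) + D * unorm (t i \<ominus> t j) \<le> \<bar>C\<bar> * \<delta> + \<bar>D\<bar> * \<delta>"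
      using M1[of i j] M2[of i j] that ns nt
      by (intro add_mono) (smt (verit) mult_mono mult_nonneg_nonneg abs_ge_self abs_ge_zero max.bounded_iff)+
    also have "\<dots> < (1 + \<bar>C\<bar> + \<bar>D\<bar>) * \<delta>"
      using \<delta> by (simp add: algebra_simps)
    also have "\<dots> = e"
      by (simp add: \<delta>_def field_simps add_pos_nonneg)
    finally show ?thesis
      using le[of i j] by linarith
  qed
  then show "\<exists>M. \<forall>i\<ge>M. \<forall>j\<ge>M. unorm (u i \<ominus> u j) < e"
    by blast
qed

lemma cauchy_bounded:
  assumes s: "s \<in> cauchy_sequences B"
  obtains C where "C \<ge> 0" "\<And>i. unorm (s i) \<le> C"
proof -
  obtain M where M: "\<And>i j. \<lbrakk>i \<ge> M; j \<ge> M\<rbrakk> \<Longrightarrow> unorm (s i \<ominus> s j) < 1"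
    using cauchyD[OF s, of 1] by auto
  define C where "C = Max ((\<lambda>i. unorm (s i)) ` {..M}) + 1"
  have small: "unorm (s i) \<le> C - 1" if "i \<le> M" for i
    unfolding C_def using that by simp
  have large: "unorm (s i) \<le> C" if "i \<ge> M" for i
    using M[OF that order_refl] unorm_diff_le[of "s i" "s M"] small[of M] s by (simp add: cauchy_closed)
  have "unorm (s i) \<le> C" for i
    using small[of i] large[of i] by (cases "i \<le> M") auto
  moreover have "C \<ge> 0"
    using small[of 0] universal_norm_nonneg[OF cauchy_closed[OF s], of 0] by simp
  ultimately show ?thesis
    using that by blast
qed

lemma cauchy_add:
  assumes "s \<in> cauchy_sequences B" "t \<in> cauchy_sequences B"
  shows "(\<lambda>i. s i \<oplus> t i) \<in> cauchy_sequences B"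
proof (rule cauchy_dominated[OF _ assms, where C = 1 and D = 1])
  fix i j
  have c: "s i \<in> carrier B" "s j \<in> carrier B" "t i \<in> carrier B" "t j \<in> carrier B"
    using assms by (simp_all add: cauchy_closed)
  show "s i \<oplus> t i \<in> carrier B" using c by simp
  show "unorm (s i \<oplus> t i \<ominus> (s j \<oplus> t j)) \<le> 1 * unorm (s i \<ominus> s j) + 1 * unorm (t i \<ominus> t j)"
    using c unorm_add[of "s i \<ominus> s j" "t i \<ominus> t j"] by (simp add: add_minus_add)
qed

lemma cauchy_smult:
  assumes "s \<in> cauchy_sequences B"
  shows "(\<lambda>i. c \<odot> s i) \<in> cauchy_sequences B"
  by (rule cauchy_dominated[OF _ assms assms, where C = "cmod c" and D = 0])
    (use assms in \<open>simp_all add: cauchy_closed smult_closed smult_minus unorm_smult\<close>)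

lemma cauchy_adj:
  assumes "s \<in> cauchy_sequences B"
  shows "(\<lambda>i. adj B (s i)) \<in> cauchy_sequences B"
  by (rule cauchy_dominated[OF _ assms assms, where C = 1 and D = 0])
    (use assms in \<open>simp_all add: cauchy_closed adj_closed adj_minus unorm_adj\<close>)

lemma unorm_mult_minus_mult:
  assumes "x \<in> carrier B" "y \<in> carrier B" "x' \<in> carrier B" "y' \<in> carrier B"
  shows "unorm (x \<otimes> y \<ominus> x' \<otimes> y') \<le> unorm x * unorm (y \<ominus> y') + unorm y' * unorm (x \<ominus> x')"
proof -
  have "unorm (x \<otimes> y \<ominus> x' \<otimes> y') \<le> unorm (x \<otimes> (y \<ominus> y')) + unorm ((x \<ominus> x') \<otimes> y')"
    unfolding mult_minus_mult[OF assms] using assms by (intro unorm_add) (simp_all add: mult_closed)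
  also have "\<dots> \<le> unorm x * unorm (y \<ominus> y') + unorm (x \<ominus> x') * unorm y'"
    using assms by (intro add_mono unorm_mult) simp_all
  finally show ?thesis
    by (simp add: mult.commute)
qed

lemma cauchy_mult:
  assumes s: "s \<in> cauchy_sequences B" and t: "t \<in> cauchy_sequences B"
  shows "(\<lambda>i. s i \<otimes> t i) \<in> cauchy_sequences B"
proof -
  obtain C where C: "C \<ge> 0" "\<And>i. unorm (s i) \<le> C" using cauchy_bounded[OF s] by blast
  obtain D where D: "D \<ge> 0" "\<And>i. unorm (t i) \<le> D" using cauchy_bounded[OF t] by blast
  show ?thesis
  proof (rule cauchy_dominated[OF _ t s, where C = C and D = D])
    fix i j
    have c: "s i \<in> carrier B" "s j \<in> carrier B" "t i \<in> carrier B" "t j \<in> carrier B"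
      using s t by (simp_all add: cauchy_closed)
    show "s i \<otimes> t i \<in> carrier B" using c by (simp add: mult_closed)
    have "unorm (s i) * unorm (t i \<ominus> t j) + unorm (t j) * unorm (s i \<ominus> s j)
        \<le> C * unorm (t i \<ominus> t j) + D * unorm (s i \<ominus> s j)"
      using C D c by (intro add_mono mult_right_mono) (simp_all add: universal_norm_nonneg)
    then show "unorm (s i \<otimes> t i \<ominus> s j \<otimes> t j) \<le> C * unorm (t i \<ominus> t j) + D * unorm (s i \<ominus> s j)"
      using unorm_mult_minus_mult[of "s i" "t i" "s j" "t j"] c by linarith
  qed
qed

lemma null_difference_iff:
  "(s, t) \<in> null_difference B \<longleftrightarrow> s \<in> cauchy_sequences B \<and> t \<in> cauchy_sequences B \<and>
     (\<lambda>i. unorm (s i \<ominus> t i)) \<longlonglongrightarrow> 0"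
  by (simp add: null_difference_def)

lemma null_differenceI:
  assumes "s \<in> cauchy_sequences B" "t \<in> cauchy_sequences B"
    and "\<And>i. unorm (s i \<ominus> t i) \<le> f i" "f \<longlonglongrightarrow> 0"
  shows "(s, t) \<in> null_difference B"
  unfolding null_difference_iff
proof (intro conjI assms(1,2))
  show "(\<lambda>i. unorm (s i \<ominus> t i)) \<longlonglongrightarrow> 0"
    by (rule tendsto_sandwich[OF _ _ tendsto_const assms(4)])
      (use assms in \<open>simp_all add: universal_norm_nonneg cauchy_closed\<close>)
qed

lemma equiv_null_difference: "equiv (cauchy_sequences B) (null_difference B)"
proof (rule equivI)
  show "null_difference B \<subseteq> cauchy_sequences B \<times> cauchy_sequences B"
    by (auto simp: null_difference_def)
  show "refl_on (cauchy_sequences B) (null_difference B)"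
    by (rule refl_onI) (auto simp: null_difference_def cauchy_closed minus_eq r_neg unorm_zero)
  show "sym (null_difference B)"
  proof (rule symI)
    fix s t assume st: "(s, t) \<in> null_difference B"
    then have "unorm (t i \<ominus> s i) = unorm (s i \<ominus> t i)" for i
      by (simp add: null_difference_iff unorm_swap cauchy_closed)
    then show "(t, s) \<in> null_difference B"
      using st by (simp add: null_difference_iff)
  qed
  show "trans (null_difference B)"
  proof (rule transI)
    fix s t u assume st: "(s, t) \<in> null_difference B" and tu: "(t, u) \<in> null_difference B"
    have "unorm (s i \<ominus> u i) \<le> unorm (s i \<ominus> t i) + unorm (t i \<ominus> u i)" for i
      using st tu by (simp add: null_difference_iff unorm_triangle cauchy_closed)
    moreover have "(\<lambda>i. unorm (s i \<ominus> t i) + unorm (t i \<ominus> u i)) \<longlonglongrightarrow> 0"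
      using st tu tendsto_add_zero by (fastforce simp: null_difference_iff)
    ultimately show "(s, u) \<in> null_difference B"
      using st tu by (intro null_differenceI) (auto simp: null_difference_iff)
  qed
qed

abbreviation cls :: "(nat \<Rightarrow> 'a) \<Rightarrow> (nat \<Rightarrow> 'a) set" where
  "cls s \<equiv> null_difference B `` {s}"

lemma cls_eq_iff:
  "\<lbrakk>s \<in> cauchy_sequences B; t \<in> cauchy_sequences B\<rbrakk> \<Longrightarrow>
    cls s = cls t \<longleftrightarrow> (\<lambda>i. unorm (s i \<ominus> t i)) \<longlonglongrightarrow> 0"
  by (simp add: eq_equiv_class_iff[OF equiv_null_difference] null_difference_iff)

lemma cls_eqI: "(s, t) \<in> null_difference B \<Longrightarrow> cls s = cls t"
  by (rule equiv_class_eq[OF equiv_null_difference])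

lemma carrier_enveloping: "carrier (enveloping_cstar_algebra B) = cls ` cauchy_sequences B"
  by (auto simp: enveloping_cstar_algebra_def quotient_def)

lemma enveloping_one: "\<one>\<^bsub>enveloping_cstar_algebra B\<^esub> = cls (\<lambda>i. \<one>)"
  by (simp add: enveloping_cstar_algebra_def)

lemma enveloping_add:
  assumes "s \<in> cauchy_sequences B" "t \<in> cauchy_sequences B"
  shows "cls s \<oplus>\<^bsub>enveloping_cstar_algebra B\<^esub> cls t = cls (\<lambda>i. s i \<oplus> t i)"
proof -
  have "congruent2 (null_difference B) (null_difference B) (\<lambda>s t. cls (\<lambda>i. s i \<oplus> t i))"
  proof (rule congruent2I')
    fix s s' t t' assume ss: "(s, s') \<in> null_difference B" and tt: "(t, t') \<in> null_difference B"
    have le: "unorm (s i \<oplus> t i \<ominus> (s' i \<oplus> t' i)) \<le> unorm (s i \<ominus> s' i) + unorm (t i \<ominus> t' i)" for i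
      using ss tt unorm_add[of "s i \<ominus> s' i" "t i \<ominus> t' i"]
      by (simp add: null_difference_iff cauchy_closed add_minus_add)
    have lim: "(\<lambda>i. unorm (s i \<ominus> s' i) + unorm (t i \<ominus> t' i)) \<longlonglongrightarrow> 0"
      using ss tt tendsto_add_zero by (fastforce simp: null_difference_iff)
    show "cls (\<lambda>i. s i \<oplus> t i) = cls (\<lambda>i. s' i \<oplus> t' i)"
      using ss tt by (intro cls_eqI null_differenceI[OF _ _ le lim] cauchy_add) (auto simp: null_difference_iff)
  qed
  from UN_equiv_class2[OF equiv_null_difference equiv_null_difference this assms]
  show ?thesis by (simp add: enveloping_cstar_algebra_def)
qed

lemma enveloping_mult:
  assumes "s \<in> cauchy_sequences B" "t \<in> cauchy_sequences B"
  shows "cls s \<otimes>\<^bsub>enveloping_cstar_algebra B\<^esub> cls t = cls (\<lambda>i. s i \<otimes> t i)"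
proof -
  have "congruent2 (null_difference B) (null_difference B) (\<lambda>s t. cls (\<lambda>i. s i \<otimes> t i))"
  proof (rule congruent2I')
    fix s s' t t' assume ss: "(s, s') \<in> null_difference B" and tt: "(t, t') \<in> null_difference B"
    have c: "s \<in> cauchy_sequences B" "s' \<in> cauchy_sequences B" "t \<in> cauchy_sequences B" "t' \<in> cauchy_sequences B"
      using ss tt by (auto simp: null_difference_iff)
    obtain C where C: "C \<ge> 0" "\<And>i. unorm (s i) \<le> C" using cauchy_bounded[OF c(1)] by blast
    obtain D where D: "D \<ge> 0" "\<And>i. unorm (t' i) \<le> D" using cauchy_bounded[OF c(4)] by blast
    have le: "unorm (s i \<otimes> t i \<ominus> s' i \<otimes> t' i) \<le> C * unorm (t i \<ominus> t' i) + D * unorm (s i \<ominus> s' i)" for i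
    proof -
      have "unorm (s i) * unorm (t i \<ominus> t' i) + unorm (t' i) * unorm (s i \<ominus> s' i)
          \<le> C * unorm (t i \<ominus> t' i) + D * unorm (s i \<ominus> s' i)"
        using C D c by (intro add_mono mult_right_mono) (simp_all add: universal_norm_nonneg cauchy_closed)
      then show ?thesis
        using unorm_mult_minus_mult[of "s i" "t i" "s' i" "t' i"] c by (force simp: cauchy_closed)
    qed
    have lim: "(\<lambda>i. C * unorm (t i \<ominus> t' i) + D * unorm (s i \<ominus> s' i)) \<longlonglongrightarrow> 0"
      using ss tt by (intro tendsto_add_zero tendsto_mult_right_zero) (auto simp: null_difference_iff)
    show "cls (\<lambda>i. s i \<otimes> t i) = cls (\<lambda>i. s' i \<otimes> t' i)"
      using c by (intro cls_eqI null_differenceI[OF _ _ le lim] cauchy_mult)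
  qed
  from UN_equiv_class2[OF equiv_null_difference equiv_null_difference this assms]
  show ?thesis by (simp add: enveloping_cstar_algebra_def)
qed

lemma enveloping_smult:
  assumes "s \<in> cauchy_sequences B"
  shows "c \<odot>\<^bsub>enveloping_cstar_algebra B\<^esub> cls s = cls (\<lambda>i. c \<odot> s i)"
proof -
  have "congruent (null_difference B) (\<lambda>s. cls (\<lambda>i. c \<odot> s i))"
  proof (rule congruentI)
    fix s s' assume ss: "(s, s') \<in> null_difference B"
    have le: "unorm (c \<odot> s i \<ominus> c \<odot> s' i) \<le> cmod c * unorm (s i \<ominus> s' i)" for i
      using ss by (simp add: null_difference_iff cauchy_closed smult_minus unorm_smult)
    have lim: "(\<lambda>i. cmod c * unorm (s i \<ominus> s' i)) \<longlonglongrightarrow> 0"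
      using ss by (intro tendsto_mult_right_zero) (auto simp: null_difference_iff)
    show "cls (\<lambda>i. c \<odot> s i) = cls (\<lambda>i. c \<odot> s' i)"
      using ss by (intro cls_eqI null_differenceI[OF _ _ le lim] cauchy_smult) (auto simp: null_difference_iff)
  qed
  from UN_equiv_class[OF equiv_null_difference this assms]
  show ?thesis by (simp add: enveloping_cstar_algebra_def)
qed

lemma enveloping_adj:
  assumes "s \<in> cauchy_sequences B"
  shows "adj (enveloping_cstar_algebra B) (cls s) = cls (\<lambda>i. adj B (s i))"
proof -
  have "congruent (null_difference B) (\<lambda>s. cls (\<lambda>i. adj B (s i)))"
  proof (rule congruentI)
    fix s s' assume ss: "(s, s') \<in> null_difference B"
    have le: "unorm (adj B (s i) \<ominus> adj B (s' i)) \<le> unorm (s i \<ominus> s' i)" for i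
      using ss by (simp add: null_difference_iff cauchy_closed adj_minus unorm_adj)
    show "cls (\<lambda>i. adj B (s i)) = cls (\<lambda>i. adj B (s' i))"
      using ss by (intro cls_eqI null_differenceI[OF _ _ le] cauchy_adj) (auto simp: null_difference_iff)
  qed
  from UN_equiv_class[OF equiv_null_difference this assms]
  show ?thesis by (simp add: enveloping_cstar_algebra_def)
qed

text \<open>The norms along a Cauchy sequence form a Cauchy sequence of reals, and equivalent sequences have the same
  limit; so the definite description in the norm of the completion denotes this limit.\<close>

lemma enveloping_cnorm:
  assumes s: "s \<in> cauchy_sequences B"
  shows "(\<lambda>i. unorm (s i)) \<longlonglongrightarrow> cnorm (enveloping_cstar_algebra B) (cls s)"
proof -
  have "Cauchy (\<lambda>i. unorm (s i))"
  proof (rule metric_CauchyI)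
    fix e :: real assume "e > 0"
    then obtain M where M: "\<And>i j. \<lbrakk>i \<ge> M; j \<ge> M\<rbrakk> \<Longrightarrow> unorm (s i \<ominus> s j) < e"
      using cauchyD[OF s] by blast
    have "dist (unorm (s i)) (unorm (s j)) < e" if "i \<ge> M" "j \<ge> M" for i j
      using M[OF that] unorm_diff_le[of "s i" "s j"] s by (simp add: cauchy_closed dist_real_def)
    then show "\<exists>M. \<forall>m\<ge>M. \<forall>n\<ge>M. dist (unorm (s m)) (unorm (s n)) < e"
      by blast
  qed
  then obtain r where r: "(\<lambda>i. unorm (s i)) \<longlonglongrightarrow> r"
    using convergent_eq_Cauchy by blast
  have all: "(\<lambda>i. unorm (t i)) \<longlonglongrightarrow> r" if "t \<in> cls s" for t
  proof -
    have st: "(s, t) \<in> null_difference B" using that by simp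
    have "(\<lambda>i. unorm (t i) - unorm (s i)) \<longlonglongrightarrow> 0"
    proof (rule Lim_null_comparison)
      show "\<forall>\<^sub>F i in sequentially. norm (unorm (t i) - unorm (s i)) \<le> unorm (s i \<ominus> t i)"
        using st unorm_diff_le[of "s i" "t i" for i] 
        by (intro always_eventually) (simp add: null_difference_iff cauchy_closed abs_minus_commute)
    qed (use st in \<open>simp add: null_difference_iff\<close>)
    from tendsto_add[OF this r] show ?thesis by simp
  qed
  have mem: "s \<in> cls s"
    by (rule equiv_class_self[OF equiv_null_difference s])
  have "(THE r. \<forall>t\<in>cls s. (\<lambda>i. unorm (t i)) \<longlonglongrightarrow> r) = r"
    using all mem LIMSEQ_unique by (intro the_equality) blast+
  then show ?thesis
    using r by (simp add: enveloping_cstar_algebra_def)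
qed

end

section \<open>The enveloping algebra of a finite direct sum\<close>

text \<open>Replacing \<open>x\<close> by \<open>x\<^sup>*x\<close> squares all C*-seminorms, while the number of summands on the right does
  not grow. After \<open>k\<close> steps the estimate reads \<open>\<nu>(x)\<^sup>m \<le> N M\<^sup>m\<close> with \<open>m = 2\<^sup>k\<close>,
  and \<open>N\<close> disappears in the limit of the \<open>m\<close>-th roots.\<close>

lemma (in star_alg) seminorm_le_of_le_sum:
  fixes N :: nat
  assumes nu: "cstar_seminorm B \<nu>" and mu: "\<And>i. i < N \<Longrightarrow> cstar_seminorm B (\<mu> i)"
    and le: "\<And>x. x \<in> carrier B \<Longrightarrow> \<nu> x \<le> (\<Sum>i<N. \<mu> i x)"
    and x: "x \<in> carrier B" and M: "M \<ge> 0" "\<And>i. i < N \<Longrightarrow> \<mu> i x \<le> M"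
  shows "\<nu> x \<le> M"
proof (rule ccontr)
  assume "\<not> \<nu> x \<le> M"
  then have gt: "\<nu> x > M" by simp
  define y where "y k = ((\<lambda>z. adj B z \<otimes> z) ^^ k) x" for k :: nat
  have y: "y k \<in> carrier B" for k
    by (induction k) (simp_all add: y_def x adj_closed mult_closed)
  have pow: "\<mu>' (y k) = \<mu>' x ^ (2 ^ k)" if "cstar_seminorm B \<mu>'" for \<mu>' k
  proof (induction k)
    case (Suc k)
    have "\<mu>' (y (Suc k)) = (\<mu>' (y k))\<^sup>2"
      using seminorm_cstar[OF that y[of k]] by (simp add: y_def)
    then show ?case
      by (simp add: Suc power_mult mult.commute flip: power_mult)
  qed (simp add: y_def)
  have est: "\<nu> x ^ (2 ^ k) \<le> real N * M ^ (2 ^ k)" for k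
  proof -
    have "\<nu> x ^ (2 ^ k) \<le> (\<Sum>i<N. \<mu> i x ^ (2 ^ k))"
      using le[OF y[of k]] pow[OF nu, of k] pow[OF mu, of _ k] by simp
    also have "\<dots> \<le> (\<Sum>i<N. M ^ (2 ^ k))"
      using M x seminorm_nonneg[OF mu] by (intro sum_mono power_mono) auto
    finally show ?thesis by simp
  qed
  show False
  proof (cases "M = 0")
    case True
    then show False using est[of 0] gt by simp
  next
    case False
    then have "M > 0" using M by simp
    then have "1 < \<nu> x / M" using gt by simp
    then obtain n where n: "real N < (\<nu> x / M) ^ n"
      using real_arch_pow by blast
    also have "\<dots> \<le> (\<nu> x / M) ^ (2 ^ n)"
      using \<open>1 < \<nu> x / M\<close> by (intro power_increasing) (simp_all add: less_imp_le)
    also have "\<dots> \<le> real N"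
      using est[of n] \<open>M > 0\<close> by (simp add: power_divide divide_le_eq)
    finally show False by simp
  qed
qed

text \<open>The maximum of no numbers is \<open>0\<close>, in agreement with the norm of \<^const>\<open>direct_sum_copies\<close>.\<close>

definition max_below :: "nat \<Rightarrow> (nat \<Rightarrow> real) \<Rightarrow> real" where
  "max_below N f = Max (insert 0 (f ` {..<N}))"

lemma max_below_Suc: "max_below (Suc N) f = max (f N) (max_below N f)"
proof -
  have "insert 0 (f ` {..<Suc N}) = insert (f N) (insert 0 (f ` {..<N}))"
    by (auto simp: lessThan_Suc)
  then show ?thesis by (simp add: max_below_def)
qed

lemma tendsto_max_below:
  assumes "\<And>i. i < N \<Longrightarrow> (\<lambda>k. f k i) \<longlonglongrightarrow> g i"
  shows "(\<lambda>k. max_below N (f k)) \<longlonglongrightarrow> max_below N g"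
  using assms
proof (induction N)
  case (Suc N)
  then show ?case
    unfolding max_below_Suc by (intro tendsto_max) auto
qed (simp add: max_below_def)

lemma max_below_ge: "i < N \<Longrightarrow> f i \<le> max_below N f"
  and max_below_nonneg: "0 \<le> max_below N f"
  and max_below_least: "\<lbrakk>0 \<le> C; \<And>i. i < N \<Longrightarrow> f i \<le> C\<rbrakk> \<Longrightarrow> max_below N f \<le> C"
  by (auto simp: max_below_def)

lemma direct_sum_ops:
  shows direct_sum_carrier: "carrier (direct_sum_copies N A) = (\<Pi>\<^sub>E i\<in>{..<N}. carrier A)"
    and direct_sum_mult: "x \<otimes>\<^bsub>direct_sum_copies N A\<^esub> y = (\<lambda>i\<in>{..<N}. x i \<otimes>\<^bsub>A\<^esub> y i)"
    and direct_sum_one: "\<one>\<^bsub>direct_sum_copies N A\<^esub> = (\<lambda>i\<in>{..<N}. \<one>\<^bsub>A\<^esub>)"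
    and direct_sum_add: "x \<oplus>\<^bsub>direct_sum_copies N A\<^esub> y = (\<lambda>i\<in>{..<N}. x i \<oplus>\<^bsub>A\<^esub> y i)"
    and direct_sum_smult: "c \<odot>\<^bsub>direct_sum_copies N A\<^esub> x = (\<lambda>i\<in>{..<N}. c \<odot>\<^bsub>A\<^esub> x i)"
    and direct_sum_adj: "adj (direct_sum_copies N A) x = (\<lambda>i\<in>{..<N}. adj A (x i))"
    and direct_sum_cnorm: "cnorm (direct_sum_copies N A) x = max_below N (\<lambda>i. cnorm A (x i))"
  by (simp_all add: direct_sum_copies_def max_below_def)

text \<open>The maps \<open>\<rho> i\<close> are the components of a *-isomorphism from \<open>B\<close> onto the direct sum of \<open>N\<close> copies of \<open>E\<close>.
  Boundedness of the C*-seminorms is required of \<open>E\<close> and carries over to \<open>B\<close>.\<close>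

locale star_alg_decomposition =
  B: star_alg B + E: bounded_star_alg E
  for B :: "('a, 'm) star_algebra_scheme" and E :: "('b, 'n) star_algebra_scheme" +
  fixes N :: nat and \<rho> :: "nat \<Rightarrow> 'a \<Rightarrow> 'b"
  assumes \<rho>_closed: "\<lbrakk>i < N; x \<in> carrier B\<rbrakk> \<Longrightarrow> \<rho> i x \<in> carrier E"
    and \<rho>_add: "\<lbrakk>i < N; x \<in> carrier B; y \<in> carrier B\<rbrakk> \<Longrightarrow> \<rho> i (x \<oplus>\<^bsub>B\<^esub> y) = \<rho> i x \<oplus>\<^bsub>E\<^esub> \<rho> i y"
    and \<rho>_mult: "\<lbrakk>i < N; x \<in> carrier B; y \<in> carrier B\<rbrakk> \<Longrightarrow> \<rho> i (x \<otimes>\<^bsub>B\<^esub> y) = \<rho> i x \<otimes>\<^bsub>E\<^esub> \<rho> i y"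
    and \<rho>_one: "i < N \<Longrightarrow> \<rho> i \<one>\<^bsub>B\<^esub> = \<one>\<^bsub>E\<^esub>"
    and \<rho>_smult: "\<lbrakk>i < N; x \<in> carrier B\<rbrakk> \<Longrightarrow> \<rho> i (c \<odot>\<^bsub>B\<^esub> x) = c \<odot>\<^bsub>E\<^esub> \<rho> i x"
    and \<rho>_adj: "\<lbrakk>i < N; x \<in> carrier B\<rbrakk> \<Longrightarrow> \<rho> i (adj B x) = adj E (\<rho> i x)"
    and \<rho>_inj: "\<lbrakk>x \<in> carrier B; y \<in> carrier B; \<And>i. i < N \<Longrightarrow> \<rho> i x = \<rho> i y\<rbrakk> \<Longrightarrow> x = y"
    and \<rho>_surj: "(\<And>i. i < N \<Longrightarrow> z i \<in> carrier E) \<Longrightarrow> \<exists>x\<in>carrier B. \<forall>i<N. \<rho> i x = z i"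
begin

lemma \<rho>_minus:
  assumes "i < N" "x \<in> carrier B" "y \<in> carrier B"
  shows "\<rho> i (x \<ominus>\<^bsub>B\<^esub> y) = \<rho> i x \<ominus>\<^bsub>E\<^esub> \<rho> i y"
proof (rule E.minus_eqI[symmetric])
  show "\<rho> i x = \<rho> i (x \<ominus>\<^bsub>B\<^esub> y) \<oplus>\<^bsub>E\<^esub> \<rho> i y"
    using assms by (simp add: B.minus_add_cancel flip: \<rho>_add)
qed (use assms in \<open>simp_all add: \<rho>_closed\<close>)

lemma \<rho>_zero: "i < N \<Longrightarrow> \<rho> i \<zero>\<^bsub>B\<^esub> = \<zero>\<^bsub>E\<^esub>"
  using \<rho>_minus[of i "\<zero>\<^bsub>B\<^esub>" "\<zero>\<^bsub>B\<^esub>"] \<rho>_closed[of i "\<zero>\<^bsub>B\<^esub>"]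
  by (simp add: B.minus_eq E.minus_eq B.r_neg E.r_neg)

definition glue :: "(nat \<Rightarrow> 'b) \<Rightarrow> 'a" where
  "glue z = (SOME x. x \<in> carrier B \<and> (\<forall>i<N. \<rho> i x = z i))"

lemma glue:
  assumes "\<And>i. i < N \<Longrightarrow> z i \<in> carrier E"
  shows glue_closed: "glue z \<in> carrier B" and \<rho>_glue: "i < N \<Longrightarrow> \<rho> i (glue z) = z i"
  using someI_ex[of "\<lambda>x. x \<in> carrier B \<and> (\<forall>i<N. \<rho> i x = z i)"] \<rho>_surj[of z] assms
  unfolding glue_def by blast+

definition inject :: "nat \<Rightarrow> 'b \<Rightarrow> 'a" where
  "inject i z = glue (\<lambda>j. if j = i then z else \<zero>\<^bsub>E\<^esub>)"

lemma inject_closed: "\<lbrakk>z \<in> carrier E\<rbrakk> \<Longrightarrow> inject i z \<in> carrier B"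
  and \<rho>_inject: "\<lbrakk>j < N; z \<in> carrier E\<rbrakk> \<Longrightarrow> \<rho> j (inject i z) = (if j = i then z else \<zero>\<^bsub>E\<^esub>)"
  unfolding inject_def by (auto intro!: glue_closed simp: \<rho>_glue)

lemma E_zero_ops: "\<zero>\<^bsub>E\<^esub> \<otimes>\<^bsub>E\<^esub> \<zero>\<^bsub>E\<^esub> = \<zero>\<^bsub>E\<^esub>" "adj E \<zero>\<^bsub>E\<^esub> = \<zero>\<^bsub>E\<^esub>"
proof -
  have "\<zero>\<^bsub>E\<^esub> \<otimes>\<^bsub>E\<^esub> \<zero>\<^bsub>E\<^esub> = \<zero>\<^bsub>E\<^esub> \<otimes>\<^bsub>E\<^esub> \<zero>\<^bsub>E\<^esub> \<oplus>\<^bsub>E\<^esub> \<zero>\<^bsub>E\<^esub> \<otimes>\<^bsub>E\<^esub> \<zero>\<^bsub>E\<^esub>"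
    using E.left_distrib[of "\<zero>\<^bsub>E\<^esub>" "\<zero>\<^bsub>E\<^esub>" "\<zero>\<^bsub>E\<^esub>"] by simp
  then show "\<zero>\<^bsub>E\<^esub> \<otimes>\<^bsub>E\<^esub> \<zero>\<^bsub>E\<^esub> = \<zero>\<^bsub>E\<^esub>"
    by (simp add: E.mult_closed)
  have "adj E \<zero>\<^bsub>E\<^esub> = adj E \<zero>\<^bsub>E\<^esub> \<oplus>\<^bsub>E\<^esub> adj E \<zero>\<^bsub>E\<^esub>"
    using E.adj_add[of "\<zero>\<^bsub>E\<^esub>" "\<zero>\<^bsub>E\<^esub>"] by simp
  then show "adj E \<zero>\<^bsub>E\<^esub> = \<zero>\<^bsub>E\<^esub>"
    by (simp add: E.adj_closed)
qed

lemma inject_hom: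
  assumes "z \<in> carrier E" "w \<in> carrier E"
  shows inject_add: "inject i (z \<oplus>\<^bsub>E\<^esub> w) = inject i z \<oplus>\<^bsub>B\<^esub> inject i w"
    and inject_mult: "inject i (z \<otimes>\<^bsub>E\<^esub> w) = inject i z \<otimes>\<^bsub>B\<^esub> inject i w"
    and inject_smult: "inject i (c \<odot>\<^bsub>E\<^esub> z) = c \<odot>\<^bsub>B\<^esub> inject i z"
    and inject_adj: "inject i (adj E z) = adj B (inject i z)"
  using assms
  by (auto intro!: \<rho>_inj
      simp: inject_closed \<rho>_inject E.adj_closed E.mult_closed E.smult_closed B.adj_closed B.mult_closed
        B.smult_closed \<rho>_add \<rho>_mult \<rho>_smult \<rho>_adj E_zero_ops E.smult_zero_right)

text \<open>The conditions on a C*-seminorm do not involve the unit, so it pulls back along the nonunital inclusions of the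
  summands as well as along the projections.\<close>

lemma seminorm_inject:
  assumes nu: "cstar_seminorm B \<nu>"
  shows "cstar_seminorm E (\<lambda>z. \<nu> (inject i z))"
  unfolding cstar_seminorm_def
  by (auto simp: inject_add inject_mult inject_smult inject_adj inject_closed E.adj_closed
      B.seminorm_nonneg[OF nu] B.seminorm_cstar[OF nu] B.seminorm_smult[OF nu] B.seminorm_add[OF nu]
      B.seminorm_mult[OF nu])

lemma seminorm_\<rho>:
  assumes nu: "cstar_seminorm E \<nu>" and i: "i < N"
  shows "cstar_seminorm B (\<lambda>x. \<nu> (\<rho> i x))"
  unfolding cstar_seminorm_def using i
  by (auto simp: \<rho>_add \<rho>_mult \<rho>_smult \<rho>_adj \<rho>_closed B.adj_closed
      E.seminorm_nonneg[OF nu] E.seminorm_cstar[OF nu] E.seminorm_smult[OF nu] E.seminorm_add[OF nu]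
      E.seminorm_mult[OF nu])

lemma partial_glue:
  assumes x: "x \<in> carrier B" and n: "n \<le> N" and nu: "cstar_seminorm B \<nu>"
  shows "\<nu> (glue (\<lambda>i. if i < n then \<rho> i x else \<zero>\<^bsub>E\<^esub>)) \<le> (\<Sum>i<n. \<nu> (inject i (\<rho> i x)))"
  using n
proof (induction n)
  case 0
  have "glue (\<lambda>i. \<zero>\<^bsub>E\<^esub>) = \<zero>\<^bsub>B\<^esub>"
    by (rule \<rho>_inj) (auto intro!: glue_closed simp: \<rho>_glue \<rho>_zero)
  then show ?case by (simp add: B.seminorm_zero[OF nu])
next
  case (Suc n)
  define g where "g n = glue (\<lambda>i. if i < n then \<rho> i x else \<zero>\<^bsub>E\<^esub>)" for n
  have g: "g k \<in> carrier B" "\<And>i. i < N \<Longrightarrow> \<rho> i (g k) = (if i < k then \<rho> i x else \<zero>\<^bsub>E\<^esub>)" for k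
    unfolding g_def using x by (auto intro!: glue_closed simp: \<rho>_glue \<rho>_closed)
  have nx: "\<rho> n x \<in> carrier E" using x Suc.prems by (simp add: \<rho>_closed)
  have "g (Suc n) = g n \<oplus>\<^bsub>B\<^esub> inject n (\<rho> n x)"
    by (rule \<rho>_inj) (use g nx x in \<open>auto simp: inject_closed \<rho>_add \<rho>_inject \<rho>_closed less_Suc_eq\<close>)
  then have "\<nu> (g (Suc n)) \<le> \<nu> (g n) + \<nu> (inject n (\<rho> n x))"
    using B.seminorm_add[OF nu g(1)[of n] inject_closed[OF nx, of n]] by simp
  then show ?case using Suc by (simp add: g_def)
qed

text \<open>An element is the sum of its parts in the summands.\<close>

lemma seminorm_le_sum:
  assumes x: "x \<in> carrier B" and nu: "cstar_seminorm B \<nu>"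
  shows "\<nu> x \<le> (\<Sum>i<N. \<nu> (inject i (\<rho> i x)))"
proof -
  have "glue (\<lambda>i. if i < N then \<rho> i x else \<zero>\<^bsub>E\<^esub>) = x"
    by (rule \<rho>_inj) (use x in \<open>auto intro!: glue_closed simp: \<rho>_glue \<rho>_closed\<close>)
  then show ?thesis using partial_glue[OF x order_refl nu] by simp
qed

text \<open>Each \<open>x \<mapsto> \<nu>(inject i (\<rho> i x))\<close> is a C*-seminorm on \<open>B\<close> that factors through \<open>E\<close>. Hence it is dominated
  by the universal norm of \<open>E\<close>, and a bound by the sum of these seminorms improves to one by their maximum.\<close>

lemma seminorm_le_max:
  assumes x: "x \<in> carrier B" and nu: "cstar_seminorm B \<nu>"
  shows "\<nu> x \<le> max_below N (\<lambda>i. universal_norm E (\<rho> i x))"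
proof (rule B.seminorm_le_of_le_sum[OF nu _ _ x max_below_nonneg])
  show "cstar_seminorm B (\<lambda>x. \<nu> (inject i (\<rho> i x)))" if "i < N" for i
    by (rule seminorm_\<rho>[OF seminorm_inject[OF nu] that])
  show "\<nu> y \<le> (\<Sum>i<N. \<nu> (inject i (\<rho> i y)))" if "y \<in> carrier B" for y
    by (rule seminorm_le_sum[OF that nu])
  show "\<nu> (inject i (\<rho> i x)) \<le> max_below N (\<lambda>i. universal_norm E (\<rho> i x))" if "i < N" for i
    using E.seminorm_le_universal[OF seminorm_inject[OF nu] \<rho>_closed[OF that x], of i]
      max_below_ge[OF that, of "\<lambda>i. universal_norm E (\<rho> i x)"] by linarith
qed

sublocale B: bounded_star_alg B
proof unfold_locales
  fix x assume "x \<in> carrier B"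
  then show "bdd_above ((\<lambda>\<nu>. \<nu> x) ` {\<nu>. cstar_seminorm B \<nu>})"
    by (intro bdd_aboveI2[where M = "max_below N (\<lambda>i. universal_norm E (\<rho> i x))"])
      (simp add: seminorm_le_max)
qed

lemma universal_norm_\<rho>_le:
  "\<lbrakk>i < N; x \<in> carrier B\<rbrakk> \<Longrightarrow> universal_norm E (\<rho> i x) \<le> universal_norm B x"
  by (rule B.seminorm_le_universal[OF seminorm_\<rho>[OF E.universal_seminorm]])

lemma universal_norm_decomposition:
  assumes x: "x \<in> carrier B"
  shows "universal_norm B x = max_below N (\<lambda>i. universal_norm E (\<rho> i x))"
proof (rule antisym)
  show "universal_norm B x \<le> max_below N (\<lambda>i. universal_norm E (\<rho> i x))"
    by (intro B.universal_norm_le seminorm_le_max x)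
  show "max_below N (\<lambda>i. universal_norm E (\<rho> i x)) \<le> universal_norm B x"
    by (intro max_below_least universal_norm_\<rho>_le B.universal_norm_nonneg x)
qed

lemma cauchy_\<rho>:
  assumes s: "s \<in> cauchy_sequences B" and i: "i < N"
  shows "(\<lambda>k. \<rho> i (s k)) \<in> cauchy_sequences E"
  unfolding cauchy_sequences_def
proof (intro CollectI conjI allI impI)
  show "\<rho> i (s k) \<in> carrier E" for k
    using s i by (simp add: B.cauchy_closed \<rho>_closed)
  fix e :: real assume "e > 0"
  then obtain M where M: "\<And>k l. \<lbrakk>k \<ge> M; l \<ge> M\<rbrakk> \<Longrightarrow> universal_norm B (s k \<ominus>\<^bsub>B\<^esub> s l) < e"
    using B.cauchyD[OF s] by blast
  have "universal_norm E (\<rho> i (s k) \<ominus>\<^bsub>E\<^esub> \<rho> i (s l)) < e" if "k \<ge> M" "l \<ge> M" for k l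
    using M[OF that] universal_norm_\<rho>_le[OF i, of "s k \<ominus>\<^bsub>B\<^esub> s l"] s i
    by (simp add: B.cauchy_closed \<rho>_minus)
  then show "\<exists>M. \<forall>k\<ge>M. \<forall>l\<ge>M. universal_norm E (\<rho> i (s k) \<ominus>\<^bsub>E\<^esub> \<rho> i (s l)) < e"
    by blast
qed

lemma cauchy_glue:
  assumes t: "\<And>i. i < N \<Longrightarrow> t i \<in> cauchy_sequences E"
  shows "(\<lambda>k. glue (\<lambda>i. t i k)) \<in> cauchy_sequences B"
  unfolding cauchy_sequences_def
proof (intro CollectI conjI allI impI)
  have c: "i < N \<Longrightarrow> t i k \<in> carrier E" for i k
    using t by (simp add: E.cauchy_closed)
  show g: "glue (\<lambda>i. t i k) \<in> carrier B" for k
    by (rule glue_closed) (rule c)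
  fix e :: real assume e: "e > 0"
  have "\<exists>M. \<forall>i<N. \<forall>k\<ge>M. \<forall>l\<ge>M. universal_norm E (t i k \<ominus>\<^bsub>E\<^esub> t i l) < e / 2"
  proof -
    have "\<forall>i\<in>{..<N}. \<exists>M. \<forall>k\<ge>M. \<forall>l\<ge>M. universal_norm E (t i k \<ominus>\<^bsub>E\<^esub> t i l) < e / 2"
      using E.cauchyD[OF t half_gt_zero[OF e]] by (metis lessThan_iff)
    then obtain m where m: "\<And>i k l. \<lbrakk>i < N; k \<ge> m i; l \<ge> m i\<rbrakk> \<Longrightarrow> universal_norm E (t i k \<ominus>\<^bsub>E\<^esub> t i l) < e / 2"
      unfolding bchoice_iff by auto
    have "m i \<le> Max (m ` {..<N})" if "i < N" for i
      using that by simp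
    then show ?thesis using m by (meson order_trans)
  qed
  then obtain M where M: "\<And>i k l. \<lbrakk>i < N; k \<ge> M; l \<ge> M\<rbrakk> \<Longrightarrow> universal_norm E (t i k \<ominus>\<^bsub>E\<^esub> t i l) < e / 2"
    by blast
  have "universal_norm B (glue (\<lambda>i. t i k) \<ominus>\<^bsub>B\<^esub> glue (\<lambda>i. t i l)) < e" if "k \<ge> M" "l \<ge> M" for k l
  proof -
    have "universal_norm B (glue (\<lambda>i. t i k) \<ominus>\<^bsub>B\<^esub> glue (\<lambda>i. t i l)) \<le> e / 2"
      unfolding universal_norm_decomposition[OF B.minus_closed[OF g g]]
      using M[OF _ that] e c g by (intro max_below_least) (auto simp: \<rho>_minus \<rho>_glue intro: less_imp_le)
    then show ?thesis using e by linarith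
  qed
  then show "\<exists>M. \<forall>k\<ge>M. \<forall>l\<ge>M. universal_norm B (glue (\<lambda>i. t i k) \<ominus>\<^bsub>B\<^esub> glue (\<lambda>i. t i l)) < e"
    by blast
qed

lemma cls_eq_iff_\<rho>:
  assumes s: "s \<in> cauchy_sequences B" and t: "t \<in> cauchy_sequences B"
  shows "B.cls s = B.cls t \<longleftrightarrow> (\<forall>i<N. E.cls (\<lambda>k. \<rho> i (s k)) = E.cls (\<lambda>k. \<rho> i (t k)))"
proof -
  have eq: "E.cls (\<lambda>k. \<rho> i (s k)) = E.cls (\<lambda>k. \<rho> i (t k)) \<longleftrightarrow>
      (\<lambda>k. universal_norm E (\<rho> i (s k \<ominus>\<^bsub>B\<^esub> t k))) \<longlonglongrightarrow> 0" if "i < N" for i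
    using that s t by (simp add: E.cls_eq_iff cauchy_\<rho> \<rho>_minus B.cauchy_closed)
  show ?thesis
  proof
    assume "B.cls s = B.cls t"
    then have lim: "(\<lambda>k. universal_norm B (s k \<ominus>\<^bsub>B\<^esub> t k)) \<longlonglongrightarrow> 0"
      using s t by (simp add: B.cls_eq_iff)
    have "(\<lambda>k. universal_norm E (\<rho> i (s k \<ominus>\<^bsub>B\<^esub> t k))) \<longlonglongrightarrow> 0" if "i < N" for i
      by (rule tendsto_sandwich[OF _ _ tendsto_const lim])
        (use s t that in \<open>simp_all add: universal_norm_\<rho>_le E.universal_norm_nonneg \<rho>_closed B.cauchy_closed\<close>)
    then show "\<forall>i<N. E.cls (\<lambda>k. \<rho> i (s k)) = E.cls (\<lambda>k. \<rho> i (t k))"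
      using eq by blast
  next
    assume "\<forall>i<N. E.cls (\<lambda>k. \<rho> i (s k)) = E.cls (\<lambda>k. \<rho> i (t k))"
    then have "(\<lambda>k. max_below N (\<lambda>i. universal_norm E (\<rho> i (s k \<ominus>\<^bsub>B\<^esub> t k)))) \<longlonglongrightarrow> max_below N (\<lambda>i. 0)"
      using eq by (intro tendsto_max_below) blast
    moreover have "max_below N (\<lambda>i. 0) = 0"
      using max_below_nonneg max_below_least[of 0 N "\<lambda>i. 0"] by (simp add: order_antisym)
    ultimately show "B.cls s = B.cls t"
      using s t by (simp add: B.cls_eq_iff universal_norm_decomposition B.cauchy_closed)
  qed
qed

text \<open>On Cauchy sequences the isomorphism applies all \<open>\<rho> i\<close> termwise.\<close>

theorem enveloping_iso_direct_sum:
  "cstar_isomorphic (enveloping_cstar_algebra B) (direct_sum_copies N (enveloping_cstar_algebra E))"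
proof -
  let ?EB = "enveloping_cstar_algebra B" and ?EE = "enveloping_cstar_algebra E"
  define comps where "comps s = (\<lambda>i\<in>{..<N}. E.cls (\<lambda>k. \<rho> i (s k)))" for s
  define \<Phi> where "\<Phi> X = comps (SOME s. s \<in> cauchy_sequences B \<and> X = B.cls s)" for X
  have comps_eq: "comps s = comps t \<longleftrightarrow> B.cls s = B.cls t"
    if "s \<in> cauchy_sequences B" "t \<in> cauchy_sequences B" for s t
    using cls_eq_iff_\<rho>[OF that] by (auto simp: comps_def fun_eq_iff restrict_def)
  have \<Phi>: "\<Phi> (B.cls s) = comps s" if s: "s \<in> cauchy_sequences B" for s
  proof -
    have "\<exists>t. t \<in> cauchy_sequences B \<and> B.cls s = B.cls t" using s by blast
    from someI_ex[OF this] obtain t where t: "t = (SOME t. t \<in> cauchy_sequences B \<and> B.cls s = B.cls t)"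
      "t \<in> cauchy_sequences B" "B.cls s = B.cls t" by blast
    then have "\<Phi> (B.cls s) = comps t" by (simp add: \<Phi>_def)
    also have "\<dots> = comps s" by (rule comps_eq[OF t(2) s, THEN iffD2]) (rule t(3)[symmetric])
    finally show ?thesis .
  qed
  have mem: "\<And>s i. \<lbrakk>s \<in> cauchy_sequences B; i < N\<rbrakk> \<Longrightarrow> E.cls (\<lambda>k. \<rho> i (s k)) \<in> carrier ?EE"
    by (auto simp: E.carrier_enveloping cauchy_\<rho>)
  have bij: "bij_betw \<Phi> (carrier ?EB) (carrier (direct_sum_copies N ?EE))"
    unfolding bij_betw_def
  proof (intro conjI subset_antisym subsetI)
    show "inj_on \<Phi> (carrier ?EB)"
      by (auto simp: inj_on_def B.carrier_enveloping \<Phi> comps_eq)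
    show "y \<in> carrier (direct_sum_copies N ?EE)" if "y \<in> \<Phi> ` carrier ?EB" for y
      using that mem by (auto simp: B.carrier_enveloping \<Phi> comps_def direct_sum_carrier)
    fix y assume "y \<in> carrier (direct_sum_copies N ?EE)"
    then have y: "y \<in> extensional {..<N}" "\<forall>i\<in>{..<N}. \<exists>t. t \<in> cauchy_sequences E \<and> y i = E.cls t"
      by (auto simp: direct_sum_carrier E.carrier_enveloping PiE_iff)
    then obtain t where t: "\<And>i. i < N \<Longrightarrow> t i \<in> cauchy_sequences E" "\<And>i. i < N \<Longrightarrow> y i = E.cls (t i)"
      unfolding bchoice_iff by auto
    define s where "s = (\<lambda>k. glue (\<lambda>i. t i k))"
    have s: "s \<in> cauchy_sequences B" unfolding s_def using t(1) by (rule cauchy_glue)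
    have "(\<lambda>k. \<rho> i (s k)) = t i" if "i < N" for i
      using that t(1) by (auto simp: s_def \<rho>_glue E.cauchy_closed)
    then have "comps s = y"
      using y(1) t(2) by (intro extensionalityI[of _ "{..<N}"]) (auto simp: comps_def)
    then show "y \<in> \<Phi> ` carrier ?EB"
      using s \<Phi>[OF s] unfolding B.carrier_enveloping by (metis imageI)
  qed
  have hom: "\<Phi> \<in> ring_hom ?EB (direct_sum_copies N ?EE)"
  proof (rule ring_hom_memI)
    show "\<Phi> X \<in> carrier (direct_sum_copies N ?EE)" if "X \<in> carrier ?EB" for X
      using bij that by (auto simp: bij_betw_def)
    fix X Y assume "X \<in> carrier ?EB" "Y \<in> carrier ?EB"
    then obtain s t where st: "s \<in> cauchy_sequences B" "t \<in> cauchy_sequences B"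
      and XY: "X = B.cls s" "Y = B.cls t"
      by (auto simp: B.carrier_enveloping)
    show "\<Phi> (X \<otimes>\<^bsub>?EB\<^esub> Y) = \<Phi> X \<otimes>\<^bsub>direct_sum_copies N ?EE\<^esub> \<Phi> Y"
      unfolding XY B.enveloping_mult[OF st] \<Phi>[OF B.cauchy_mult[OF st]] \<Phi>[OF st(1)] \<Phi>[OF st(2)]
        direct_sum_mult comps_def
      by (rule restrict_ext) (simp add: E.enveloping_mult cauchy_\<rho> st \<rho>_mult B.cauchy_closed)
    show "\<Phi> (X \<oplus>\<^bsub>?EB\<^esub> Y) = \<Phi> X \<oplus>\<^bsub>direct_sum_copies N ?EE\<^esub> \<Phi> Y"
      unfolding XY B.enveloping_add[OF st] \<Phi>[OF B.cauchy_add[OF st]] \<Phi>[OF st(1)] \<Phi>[OF st(2)]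
        direct_sum_add comps_def
      by (rule restrict_ext) (simp add: E.enveloping_add cauchy_\<rho> st \<rho>_add B.cauchy_closed)
  next
    show "\<Phi> \<one>\<^bsub>?EB\<^esub> = \<one>\<^bsub>direct_sum_copies N ?EE\<^esub>"
      unfolding B.enveloping_one \<Phi>[OF B.const_cauchy[OF B.one_closed]] direct_sum_one comps_def
      by (rule restrict_ext) (simp add: E.enveloping_one \<rho>_one)
  qed
  have rest: "(\<forall>c. \<Phi> (c \<odot>\<^bsub>?EB\<^esub> X) = c \<odot>\<^bsub>direct_sum_copies N ?EE\<^esub> \<Phi> X) \<and>
      \<Phi> (adj ?EB X) = adj (direct_sum_copies N ?EE) (\<Phi> X) \<and>
      cnorm (direct_sum_copies N ?EE) (\<Phi> X) = cnorm ?EB X" if X: "X \<in> carrier ?EB" for X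
  proof -
    obtain s where s: "s \<in> cauchy_sequences B" and Xs: "X = B.cls s"
      using X by (auto simp: B.carrier_enveloping)
    have "\<Phi> (c \<odot>\<^bsub>?EB\<^esub> X) = c \<odot>\<^bsub>direct_sum_copies N ?EE\<^esub> \<Phi> X" for c
      unfolding Xs B.enveloping_smult[OF s] \<Phi>[OF B.cauchy_smult[OF s]] \<Phi>[OF s]
        direct_sum_smult comps_def
      by (rule restrict_ext) (simp add: E.enveloping_smult cauchy_\<rho> s \<rho>_smult B.cauchy_closed)
    moreover have "\<Phi> (adj ?EB X) = adj (direct_sum_copies N ?EE) (\<Phi> X)"
      unfolding Xs B.enveloping_adj[OF s] \<Phi>[OF B.cauchy_adj[OF s]] \<Phi>[OF s]
        direct_sum_adj comps_def
      by (rule restrict_ext) (simp add: E.enveloping_adj cauchy_\<rho> s \<rho>_adj B.cauchy_closed)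
    moreover have "cnorm (direct_sum_copies N ?EE) (\<Phi> X) = cnorm ?EB X"
    proof (rule LIMSEQ_unique)
      have "cnorm (direct_sum_copies N ?EE) (\<Phi> X) = max_below N (\<lambda>i. cnorm ?EE (E.cls (\<lambda>k. \<rho> i (s k))))"
        unfolding direct_sum_cnorm by (simp add: Xs \<Phi>[OF s] comps_def max_below_def)
      moreover have "(\<lambda>k. max_below N (\<lambda>i. universal_norm E (\<rho> i (s k))))
          \<longlonglongrightarrow> max_below N (\<lambda>i. cnorm ?EE (E.cls (\<lambda>k. \<rho> i (s k))))"
        by (intro tendsto_max_below E.enveloping_cnorm cauchy_\<rho> s)
      ultimately show "(\<lambda>k. universal_norm B (s k)) \<longlonglongrightarrow> cnorm (direct_sum_copies N ?EE) (\<Phi> X)"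
        using s by (simp add: universal_norm_decomposition B.cauchy_closed)
      show "(\<lambda>k. universal_norm B (s k)) \<longlonglongrightarrow> cnorm ?EB X"
        unfolding Xs by (rule B.enveloping_cnorm[OF s])
    qed
    ultimately show ?thesis by blast
  qed
  show ?thesis
    unfolding cstar_isomorphic_def ring_iso_def using hom bij rest by blast
qed

end

section \<open>Convolution algebras of actions of \<open>\<int>\<close> on spaces\<close>

lemma cont_algebra_simps:
  shows cont_algebra_carrier: "carrier (cont_algebra X) = {f \<in> extensional (topspace X). continuous_map X euclidean f}"
    and cont_algebra_mult: "f \<otimes>\<^bsub>cont_algebra X\<^esub> g = (\<lambda>x\<in>topspace X. f x * g x)"
    and cont_algebra_one: "\<one>\<^bsub>cont_algebra X\<^esub> = (\<lambda>x\<in>topspace X. 1)"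
    and cont_algebra_zero: "\<zero>\<^bsub>cont_algebra X\<^esub> = (\<lambda>x\<in>topspace X. 0)"
    and cont_algebra_add: "f \<oplus>\<^bsub>cont_algebra X\<^esub> g = (\<lambda>x\<in>topspace X. f x + g x)"
    and cont_algebra_smult: "c \<odot>\<^bsub>cont_algebra X\<^esub> f = (\<lambda>x\<in>topspace X. c * f x)"
    and cont_algebra_adj: "adj (cont_algebra X) f = (\<lambda>x\<in>topspace X. cnj (f x))"
  by (simp_all add: cont_algebra_def)

lemma continuous_map_restrict:
  "continuous_map X Y (\<lambda>x\<in>topspace X. f x) \<longleftrightarrow> continuous_map X Y f"
  by (rule iffI; erule continuous_map_eq) simp_all

lemma continuous_map_complex_mult:
  fixes f g :: "'x \<Rightarrow> complex"
  shows "\<lbrakk>continuous_map X euclidean f; continuous_map X euclidean g\<rbrakk> \<Longrightarrow> continuous_map X euclidean (\<lambda>x. f x * g x)"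
  by (simp add: continuous_map_atin tendsto_mult)

lemma continuous_map_cnj:
  "continuous_map X euclidean f \<Longrightarrow> continuous_map X euclidean (\<lambda>x. cnj (f x))"
  by (simp add: continuous_map_atin tendsto_cnj)

lemma continuous_map_complex_of_real:
  fixes f :: "'x \<Rightarrow> real"
  shows "continuous_map X euclidean f \<Longrightarrow> continuous_map X euclidean (\<lambda>x. complex_of_real (f x))"
  by (simp add: continuous_map_atin tendsto_of_real)

lemma cont_algebra_restrict_closed:
  "continuous_map X euclidean f \<Longrightarrow> (\<lambda>x\<in>topspace X. f x) \<in> carrier (cont_algebra X)"
  by (simp add: cont_algebra_carrier continuous_map_restrict)

lemma cont_algebra_continuous: "f \<in> carrier (cont_algebra X) \<Longrightarrow> continuous_map X euclidean f"
  by (simp add: cont_algebra_carrier)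

lemma cont_algebra_eqI:
  assumes "f \<in> carrier (cont_algebra X)" "g \<in> carrier (cont_algebra X)"
    and "\<And>x. x \<in> topspace X \<Longrightarrow> f x = g x"
  shows "f = g"
  using assms by (intro extensionalityI[of _ "topspace X"]) (auto simp: cont_algebra_carrier)

lemma abelian_group_cont_algebra: "abelian_group (cont_algebra X)"
proof (rule abelian_groupI)
  fix f g h assume f: "f \<in> carrier (cont_algebra X)" and g: "g \<in> carrier (cont_algebra X)"
    and h: "h \<in> carrier (cont_algebra X)"
  show "f \<oplus>\<^bsub>cont_algebra X\<^esub> g \<in> carrier (cont_algebra X)"
    unfolding cont_algebra_add
    by (intro cont_algebra_restrict_closed continuous_map_add cont_algebra_continuous f g)
  show "f \<oplus>\<^bsub>cont_algebra X\<^esub> g \<oplus>\<^bsub>cont_algebra X\<^esub> h = f \<oplus>\<^bsub>cont_algebra X\<^esub> (g \<oplus>\<^bsub>cont_algebra X\<^esub> h)"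
    by (auto simp: cont_algebra_add add.assoc intro!: restrict_ext)
  show "f \<oplus>\<^bsub>cont_algebra X\<^esub> g = g \<oplus>\<^bsub>cont_algebra X\<^esub> f"
    by (auto simp: cont_algebra_add add.commute intro!: restrict_ext)
  show "\<zero>\<^bsub>cont_algebra X\<^esub> \<oplus>\<^bsub>cont_algebra X\<^esub> f = f"
    using f by (intro extensionalityI[of _ "topspace X"]) (auto simp: cont_algebra_simps)
  show "\<exists>g\<in>carrier (cont_algebra X). g \<oplus>\<^bsub>cont_algebra X\<^esub> f = \<zero>\<^bsub>cont_algebra X\<^esub>"
  proof (rule bexI)
    show "(\<lambda>x\<in>topspace X. - f x) \<in> carrier (cont_algebra X)"
      by (intro cont_algebra_restrict_closed continuous_map_minus cont_algebra_continuous f)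
    show "(\<lambda>x\<in>topspace X. - f x) \<oplus>\<^bsub>cont_algebra X\<^esub> f = \<zero>\<^bsub>cont_algebra X\<^esub>"
      by (auto simp: cont_algebra_simps intro!: restrict_ext)
  qed
next
  show "\<zero>\<^bsub>cont_algebra X\<^esub> \<in> carrier (cont_algebra X)"
    unfolding cont_algebra_zero by (intro cont_algebra_restrict_closed) simp
qed

lemma cont_algebra_finsum:
  assumes "finite S" "\<And>m. m \<in> S \<Longrightarrow> F m \<in> carrier (cont_algebra X)" "x \<in> topspace X"
  shows "(\<Oplus>\<^bsub>cont_algebra X\<^esub>m\<in>S. F m) x = (\<Sum>m\<in>S. F m x)"
proof -
  interpret abelian_group "cont_algebra X" by (rule abelian_group_cont_algebra)
  show ?thesis using assms(1,2)
  proof (induction S rule: finite_induct)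
    case (insert m S)
    then have "(\<Oplus>\<^bsub>cont_algebra X\<^esub>m\<in>insert m S. F m) = F m \<oplus>\<^bsub>cont_algebra X\<^esub> (\<Oplus>\<^bsub>cont_algebra X\<^esub>m\<in>S. F m)"
      by (intro finsum_insert) auto
    then show ?case using insert assms(3) by (simp add: cont_algebra_add)
  qed (use assms(3) in \<open>simp add: cont_algebra_zero\<close>)
qed

locale int_system =
  fixes X :: "'x topology" and h :: "int \<Rightarrow> 'x \<Rightarrow> 'x"
  assumes h_continuous: "continuous_map X X (h m)"
    and h_zero: "x \<in> topspace X \<Longrightarrow> h 0 x = x"
    and h_add: "x \<in> topspace X \<Longrightarrow> h (m + n) x = h m (h n x)"
begin

abbreviation C :: "('x \<Rightarrow> complex) cstar_algebra" where "C \<equiv> cont_algebra X"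
abbreviation A :: "(int \<Rightarrow> 'x \<Rightarrow> complex) star_algebra" where "A \<equiv> conv_algebra C (induced_action X h)"

sublocale C: abelian_group C by (rule abelian_group_cont_algebra)

lemma h_closed: "x \<in> topspace X \<Longrightarrow> h m x \<in> topspace X"
  using h_continuous[of m] by (auto simp: continuous_map_def)

lemma h_minus: "x \<in> topspace X \<Longrightarrow> h m (h (- m) x) = x" "x \<in> topspace X \<Longrightarrow> h (- m) (h m x) = x"
  using h_add[of x m "- m"] h_add[of x "- m" m] by (simp_all add: h_zero)

lemma continuous_comp_h: "continuous_map X Y f \<Longrightarrow> continuous_map X Y (\<lambda>x. f (h m x))"
  using continuous_map_compose[OF h_continuous, of Y f m] by (simp add: comp_def)

lemma action_closed: "f \<in> carrier C \<Longrightarrow> induced_action X h m f \<in> carrier C"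
  unfolding induced_action_def
  by (intro cont_algebra_restrict_closed continuous_comp_h cont_algebra_continuous)

lemma C_mult_closed: "\<lbrakk>f \<in> carrier C; g \<in> carrier C\<rbrakk> \<Longrightarrow> f \<otimes>\<^bsub>C\<^esub> g \<in> carrier C"
  unfolding cont_algebra_mult
  by (intro cont_algebra_restrict_closed continuous_map_complex_mult cont_algebra_continuous)

lemma C_smult_closed: "f \<in> carrier C \<Longrightarrow> c \<odot>\<^bsub>C\<^esub> f \<in> carrier C"
  unfolding cont_algebra_smult
  by (rule cont_algebra_restrict_closed, rule continuous_map_complex_mult)
    (simp_all add: cont_algebra_continuous)

lemma C_adj_closed: "f \<in> carrier C \<Longrightarrow> adj C f \<in> carrier C"
  unfolding cont_algebra_adj
  by (intro cont_algebra_restrict_closed continuous_map_cnj cont_algebra_continuous)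

definition supp :: "(int \<Rightarrow> 'x \<Rightarrow> complex) \<Rightarrow> int set" where
  "supp f = {n. f n \<noteq> \<zero>\<^bsub>C\<^esub>}"

lemma A_carrier: "f \<in> carrier A \<longleftrightarrow> (\<forall>n. f n \<in> carrier C) \<and> finite (supp f)"
  by (simp add: conv_algebra_def supp_def)

lemma A_coeff: "f \<in> carrier A \<Longrightarrow> f n \<in> carrier C"
  and finite_supp: "f \<in> carrier A \<Longrightarrow> finite (supp f)"
  by (simp_all add: A_carrier)

lemma A_carrierI:
  assumes "\<And>n. f n \<in> carrier C" "finite S" "\<And>n x. \<lbrakk>n \<notin> S; x \<in> topspace X\<rbrakk> \<Longrightarrow> f n x = 0"
  shows "f \<in> carrier A"
proof -
  have "f n = \<zero>\<^bsub>C\<^esub>" if "n \<notin> S" for n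
    using assms(3)[OF that] by (intro cont_algebra_eqI[OF assms(1) C.zero_closed]) (simp add: cont_algebra_zero)
  then have "supp f \<subseteq> S" by (auto simp: supp_def)
  then show ?thesis using assms(1,2) by (auto simp: A_carrier intro: finite_subset)
qed

lemma A_eqI:
  assumes "f \<in> carrier A" "g \<in> carrier A" "\<And>n x. x \<in> topspace X \<Longrightarrow> f n x = g n x"
  shows "f = g"
proof (rule ext)
  fix n show "f n = g n"
    using assms by (intro cont_algebra_eqI[of _ X]) (simp_all add: A_coeff)
qed

lemma not_in_supp: "\<lbrakk>n \<notin> supp f; x \<in> topspace X\<rbrakk> \<Longrightarrow> f n x = 0"
  by (simp add: supp_def cont_algebra_zero)

lemma A_apply:
  assumes "x \<in> topspace X"
  shows A_add: "(f \<oplus>\<^bsub>A\<^esub> g) n x = f n x + g n x"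
    and A_zero: "\<zero>\<^bsub>A\<^esub> n x = 0"
    and A_one: "\<one>\<^bsub>A\<^esub> n x = (if n = 0 then 1 else 0)"
    and A_smult: "(c \<odot>\<^bsub>A\<^esub> f) n x = c * f n x"
    and A_adj: "adj A f n x = cnj (f (- n) (h (- n) x))"
  using assms by (simp_all add: conv_algebra_def cont_algebra_simps induced_action_def h_closed)

lemma mult_term_closed:
  "\<lbrakk>f \<in> carrier A; g \<in> carrier A\<rbrakk> \<Longrightarrow> f m \<otimes>\<^bsub>C\<^esub> induced_action X h m (g (n - m)) \<in> carrier C"
  by (intro C_mult_closed action_closed A_coeff)

text \<open>The freedom in the choice of \<open>S\<close> allows products with different left factors to be compared as sums over the
  same index set.\<close>

lemma A_mult:
  assumes f: "f \<in> carrier A" and g: "g \<in> carrier A" and x: "x \<in> topspace X"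
    and S: "finite S" "supp f \<subseteq> S"
  shows "(f \<otimes>\<^bsub>A\<^esub> g) n x = (\<Sum>m\<in>S. f m x * g (n - m) (h (- m) x))"
proof -
  have "(f \<otimes>\<^bsub>A\<^esub> g) n x = (\<Sum>m\<in>supp f. (f m \<otimes>\<^bsub>C\<^esub> induced_action X h m (g (n - m))) x)"
    using cont_algebra_finsum[OF finite_supp[OF f] mult_term_closed[OF f g] x]
    by (simp add: conv_algebra_def supp_def)
  also have "\<dots> = (\<Sum>m\<in>supp f. f m x * g (n - m) (h (- m) x))"
    using x by (intro sum.cong) (simp_all add: cont_algebra_mult induced_action_def)
  also have "\<dots> = (\<Sum>m\<in>S. f m x * g (n - m) (h (- m) x))"
    using S x by (intro sum.mono_neutral_left) (auto simp: not_in_supp)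
  finally show ?thesis .
qed

lemma A_mult_closed:
  assumes f: "f \<in> carrier A" and g: "g \<in> carrier A"
  shows "f \<otimes>\<^bsub>A\<^esub> g \<in> carrier A"
proof (rule A_carrierI)
  show "(f \<otimes>\<^bsub>A\<^esub> g) n \<in> carrier C" for n
    using mult_term_closed[OF f g] by (auto simp: conv_algebra_def intro!: C.finsum_closed)
  show "finite ((\<lambda>(m, k). m + k) ` (supp f \<times> supp g))"
    using f g by (simp add: finite_supp)
  fix n x assume n: "n \<notin> (\<lambda>(m, k). m + k) ` (supp f \<times> supp g)" and x: "x \<in> topspace X"
  have "f m x * g (n - m) (h (- m) x) = 0" if "m \<in> supp f" for m
  proof -
    have "n - m \<notin> supp g"
    proof
      assume "n - m \<in> supp g"
      then have "n \<in> (\<lambda>(m, k). m + k) ` (supp f \<times> supp g)"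
        using that by (intro image_eqI[where x = "(m, n - m)"]) simp_all
      with n show False ..
    qed
    then show ?thesis using x by (simp add: not_in_supp h_closed)
  qed
  then show "(f \<otimes>\<^bsub>A\<^esub> g) n x = 0"
    unfolding A_mult[OF f g x finite_supp[OF f] order_refl] by (intro sum.neutral) blast
qed

lemma A_add_closed:
  assumes f: "f \<in> carrier A" and g: "g \<in> carrier A"
  shows "f \<oplus>\<^bsub>A\<^esub> g \<in> carrier A"
proof (rule A_carrierI)
  show "(f \<oplus>\<^bsub>A\<^esub> g) n \<in> carrier C" for n
    using f g by (simp add: conv_algebra_def)
  show "finite (supp f \<union> supp g)" using f g by (simp add: finite_supp)
qed (simp add: A_add not_in_supp)

lemma A_smult_closed:
  assumes f: "f \<in> carrier A"
  shows "c \<odot>\<^bsub>A\<^esub> f \<in> carrier A"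
proof (rule A_carrierI)
  show "(c \<odot>\<^bsub>A\<^esub> f) n \<in> carrier C" for n
    using f by (simp add: conv_algebra_def C_smult_closed)
  show "finite (supp f)" using f by (simp add: finite_supp)
qed (simp add: A_smult not_in_supp)

lemma A_adj_closed:
  assumes f: "f \<in> carrier A"
  shows "adj A f \<in> carrier A"
proof (rule A_carrierI)
  show "adj A f n \<in> carrier C" for n
    using f by (simp add: conv_algebra_def C_adj_closed action_closed)
  show "finite (uminus ` supp f)" using f by (simp add: finite_supp)
  fix n x assume "n \<notin> uminus ` supp f" "x \<in> topspace X"
  moreover from this have "- n \<notin> supp f"
    using imageI[of "- n" "supp f" uminus] by auto
  ultimately show "adj A f n x = 0" by (simp add: A_adj not_in_supp h_closed)
qed

lemma A_zero_closed: "\<zero>\<^bsub>A\<^esub> \<in> carrier A"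
proof (rule A_carrierI[where S = "{}"])
  show "\<zero>\<^bsub>A\<^esub> n \<in> carrier C" for n
    using C.zero_closed by (simp add: conv_algebra_def)
qed (simp_all add: A_zero)

lemma A_one_closed: "\<one>\<^bsub>A\<^esub> \<in> carrier A"
proof (rule A_carrierI[where S = "{0}"])
  have "\<one>\<^bsub>C\<^esub> \<in> carrier C"
    unfolding cont_algebra_one by (intro cont_algebra_restrict_closed) simp
  then show "\<one>\<^bsub>A\<^esub> n \<in> carrier C" for n
    by (simp add: conv_algebra_def)
qed (auto simp: A_one)

lemma abelian_group_A: "abelian_group A"
proof (rule abelian_groupI)
  fix f g k assume f: "f \<in> carrier A" and g: "g \<in> carrier A" and k: "k \<in> carrier A"
  show "f \<oplus>\<^bsub>A\<^esub> g \<in> carrier A" by (rule A_add_closed[OF f g])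
  show "f \<oplus>\<^bsub>A\<^esub> g \<oplus>\<^bsub>A\<^esub> k = f \<oplus>\<^bsub>A\<^esub> (g \<oplus>\<^bsub>A\<^esub> k)"
    by (rule A_eqI) (use f g k in \<open>simp_all add: A_add_closed A_add add.assoc\<close>)
  show "f \<oplus>\<^bsub>A\<^esub> g = g \<oplus>\<^bsub>A\<^esub> f"
    by (rule A_eqI) (use f g in \<open>simp_all add: A_add_closed A_add add.commute\<close>)
  show "\<zero>\<^bsub>A\<^esub> \<oplus>\<^bsub>A\<^esub> f = f"
    by (rule A_eqI) (use f in \<open>simp_all add: A_add_closed A_zero_closed A_add A_zero\<close>)
  show "\<exists>g\<in>carrier A. g \<oplus>\<^bsub>A\<^esub> f = \<zero>\<^bsub>A\<^esub>"
  proof (rule bexI)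
    show "(- 1) \<odot>\<^bsub>A\<^esub> f \<oplus>\<^bsub>A\<^esub> f = \<zero>\<^bsub>A\<^esub>"
      by (rule A_eqI) (use f in \<open>simp_all add: A_add_closed A_zero_closed A_smult_closed A_add A_zero A_smult\<close>)
  qed (rule A_smult_closed[OF f])
qed (rule A_zero_closed)

lemma star_alg_A: "star_alg A"
proof -
  interpret A: abelian_group A by (rule abelian_group_A)
  show ?thesis
  proof unfold_locales
    fix f g k :: "int \<Rightarrow> 'x \<Rightarrow> complex" and c :: complex
    assume f: "f \<in> carrier A"
    show "adj A f \<in> carrier A" "c \<odot>\<^bsub>A\<^esub> f \<in> carrier A"
      using f by (simp_all add: A_adj_closed A_smult_closed)
    show "adj A (adj A f) = f"
      by (rule A_eqI) (use f in \<open>simp_all add: A_adj_closed A_adj h_closed h_minus\<close>)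
    show "(- 1) \<odot>\<^bsub>A\<^esub> f = \<ominus>\<^bsub>A\<^esub> f"
    proof (rule A.minus_equality[symmetric])
      show "(- 1) \<odot>\<^bsub>A\<^esub> f \<oplus>\<^bsub>A\<^esub> f = \<zero>\<^bsub>A\<^esub>"
        by (rule A_eqI) (use f in \<open>simp_all add: A_smult_closed A_add A_zero A_smult\<close>)
    qed (use f in \<open>simp_all add: A_smult_closed\<close>)
    assume g: "g \<in> carrier A"
    show "f \<otimes>\<^bsub>A\<^esub> g \<in> carrier A" by (rule A_mult_closed[OF f g])
    show "adj A (f \<oplus>\<^bsub>A\<^esub> g) = adj A f \<oplus>\<^bsub>A\<^esub> adj A g"
      by (rule A_eqI) (use f g in \<open>simp_all add: A_adj_closed A_adj A_add h_closed\<close>)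
    show "c \<odot>\<^bsub>A\<^esub> (f \<oplus>\<^bsub>A\<^esub> g) = c \<odot>\<^bsub>A\<^esub> f \<oplus>\<^bsub>A\<^esub> c \<odot>\<^bsub>A\<^esub> g"
      by (rule A_eqI) (use f g in \<open>simp_all add: A_smult_closed A_smult A_add algebra_simps\<close>)
    assume k: "k \<in> carrier A"
    show "(f \<oplus>\<^bsub>A\<^esub> g) \<otimes>\<^bsub>A\<^esub> k = f \<otimes>\<^bsub>A\<^esub> k \<oplus>\<^bsub>A\<^esub> g \<otimes>\<^bsub>A\<^esub> k"
    proof (rule A_eqI)
      fix n x assume x: "x \<in> topspace X"
      let ?S = "supp f \<union> supp g \<union> supp (f \<oplus>\<^bsub>A\<^esub> g)"
      have S: "finite ?S" using f g by (simp add: finite_supp A_add_closed)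
      have sub: "supp f \<subseteq> ?S" "supp g \<subseteq> ?S" "supp (f \<oplus>\<^bsub>A\<^esub> g) \<subseteq> ?S" by auto
      note mult = A_mult[OF f k x S sub(1)] A_mult[OF g k x S sub(2)] A_mult[OF A_add_closed[OF f g] k x S sub(3)]
      show "((f \<oplus>\<^bsub>A\<^esub> g) \<otimes>\<^bsub>A\<^esub> k) n x = (f \<otimes>\<^bsub>A\<^esub> k \<oplus>\<^bsub>A\<^esub> g \<otimes>\<^bsub>A\<^esub> k) n x"
        unfolding mult A_add[OF x] by (simp add: algebra_simps flip: sum.distrib)
    qed (use f g k in \<open>simp_all add: A_mult_closed\<close>)
    show "k \<otimes>\<^bsub>A\<^esub> (f \<oplus>\<^bsub>A\<^esub> g) = k \<otimes>\<^bsub>A\<^esub> f \<oplus>\<^bsub>A\<^esub> k \<otimes>\<^bsub>A\<^esub> g"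
    proof (rule A_eqI)
      fix n x assume x: "x \<in> topspace X"
      show "(k \<otimes>\<^bsub>A\<^esub> (f \<oplus>\<^bsub>A\<^esub> g)) n x = (k \<otimes>\<^bsub>A\<^esub> f \<oplus>\<^bsub>A\<^esub> k \<otimes>\<^bsub>A\<^esub> g) n x"
        using f g k x finite_supp[OF k]
        by (simp add: A_add A_mult[where S = "supp k"] h_closed algebra_simps flip: sum.distrib)
    qed (use f g k in \<open>simp_all add: A_mult_closed\<close>)
  qed (rule A_one_closed)
qed

sublocale A: star_alg A by (rule star_alg_A)

text \<open>The element \<open>a u\<^sup>n\<close>.\<close>

definition monomial :: "int \<Rightarrow> ('x \<Rightarrow> complex) \<Rightarrow> int \<Rightarrow> 'x \<Rightarrow> complex" where
  "monomial n a k = (\<lambda>x\<in>topspace X. if k = n then a x else 0)"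

lemma monomial_closed:
  assumes "continuous_map X euclidean a"
  shows "monomial n a \<in> carrier A"
proof (rule A_carrierI[where S = "{n}"])
  show "monomial n a k \<in> carrier C" for k
    unfolding monomial_def using assms by (cases "k = n") (auto intro!: cont_algebra_restrict_closed)
qed (auto simp: monomial_def)

lemma monomial_apply: "x \<in> topspace X \<Longrightarrow> monomial n a k x = (if k = n then a x else 0)"
  by (simp add: monomial_def)

text \<open>This reduces estimates for \<open>a u\<^sup>n\<close> to estimates for nonnegative functions in degree \<open>0\<close>.\<close>

lemma monomial_adj_mult:
  assumes a: "continuous_map X euclidean a"
  shows "adj A (monomial n a) \<otimes>\<^bsub>A\<^esub> monomial n a = monomial 0 (\<lambda>x. complex_of_real ((cmod (a (h n x)))\<^sup>2))"
proof (rule A_eqI)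
  have adj: "adj A (monomial n a) \<in> carrier A" by (intro A_adj_closed monomial_closed a)
  have cont: "continuous_map X euclidean (\<lambda>x. complex_of_real ((cmod (a (h n x)))\<^sup>2))"
    unfolding complex_norm_square
    by (intro continuous_map_complex_mult continuous_map_cnj continuous_comp_h a)
  show "monomial 0 (\<lambda>x. complex_of_real ((cmod (a (h n x)))\<^sup>2)) \<in> carrier A"
    by (rule monomial_closed[OF cont])
  show "adj A (monomial n a) \<otimes>\<^bsub>A\<^esub> monomial n a \<in> carrier A"
    by (intro A_mult_closed adj monomial_closed a)
  fix k x assume x: "x \<in> topspace X"
  have supp: "supp (adj A (monomial n a)) \<subseteq> {- n}"
  proof
    fix k assume "k \<in> supp (adj A (monomial n a))"
    then have "adj A (monomial n a) k \<noteq> \<zero>\<^bsub>C\<^esub>" by (simp add: supp_def)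
    then obtain x where "x \<in> topspace X" "adj A (monomial n a) k x \<noteq> 0"
      using cont_algebra_eqI[OF A_coeff[OF adj] C.zero_closed, of k] by (auto simp: cont_algebra_zero)
    then show "k \<in> {- n}"
      by (auto simp: A_adj monomial_apply h_closed split: if_splits)
  qed
  show "(adj A (monomial n a) \<otimes>\<^bsub>A\<^esub> monomial n a) k x = monomial 0 (\<lambda>x. complex_of_real ((cmod (a (h n x)))\<^sup>2)) k x"
    using A_mult[OF adj monomial_closed[OF a, of n] x _ supp, of k] x
    by (auto simp: A_adj monomial_apply h_closed complex_norm_square mult.commute simp flip: of_real_power)
qed

lemma monomial_zero_add:
  assumes "continuous_map X euclidean a" "continuous_map X euclidean b"
  shows "monomial n a \<oplus>\<^bsub>A\<^esub> monomial n b = monomial n (\<lambda>x. a x + b x)"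
  by (rule A_eqI) (use assms in \<open>simp_all add: monomial_closed A_add_closed continuous_map_add A_add monomial_apply\<close>)

lemma monomial_smult:
  assumes "continuous_map X euclidean a"
  shows "c \<odot>\<^bsub>A\<^esub> monomial n a = monomial n (\<lambda>x. c * a x)"
  by (rule A_eqI) (use assms in \<open>simp_all add: monomial_closed A_smult_closed continuous_map_complex_mult A_smult monomial_apply\<close>)

context
  fixes \<nu> assumes nu: "cstar_seminorm A \<nu>"
begin

lemma seminorm_monomial_cstar:
  assumes "continuous_map X euclidean a"
  shows "(\<nu> (monomial n a))\<^sup>2 = \<nu> (monomial 0 (\<lambda>x. complex_of_real ((cmod (a (h n x)))\<^sup>2)))"
  using A.seminorm_cstar[OF nu monomial_closed[OF assms, of n]] monomial_adj_mult[OF assms, of n] by simp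

text \<open>A unitary \<open>u\<close> satisfies \<open>\<nu>(u)\<^sup>2 = \<nu>(1) = \<nu>(1)\<^sup>2\<close>.\<close>

lemma seminorm_unitary:
  assumes a: "continuous_map X euclidean a" and unit: "\<And>x. x \<in> topspace X \<Longrightarrow> cmod (a x) = 1"
  shows "\<nu> (monomial 0 a) \<le> 1"
proof -
  have one: "monomial 0 (\<lambda>x. complex_of_real ((cmod (b (h 0 x)))\<^sup>2)) = monomial 0 (\<lambda>x. 1)"
    if "\<And>x. x \<in> topspace X \<Longrightarrow> cmod (b x) = 1" for b
    using that by (auto simp: monomial_def fun_eq_iff h_closed)
  have "(\<nu> (monomial 0 (\<lambda>x. 1)))\<^sup>2 = \<nu> (monomial 0 (\<lambda>x. 1))"
    using seminorm_monomial_cstar[of "\<lambda>x. 1" 0] one[of "\<lambda>x. 1"] by simp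
  then have "\<nu> (monomial 0 (\<lambda>x. 1)) \<le> 1"
    by (auto simp: power2_eq_square)
  then have "(\<nu> (monomial 0 a))\<^sup>2 \<le> 1"
    using seminorm_monomial_cstar[OF a, of 0] one[of a, OF unit] by simp
  then show ?thesis
    using power_le_one_iff abs_le_square_iff[of "\<nu> (monomial 0 a)" 1] by simp
qed

text \<open>A real function \<open>a\<close> with \<open>|a| \<le> 1\<close> is the mean of the unitaries \<open>a \<plusminus> i \<surd>(1 - a\<^sup>2)\<close>.\<close>

lemma seminorm_real:
  fixes a :: "'x \<Rightarrow> real"
  assumes a: "continuous_map X euclidean a" and le: "\<And>x. x \<in> topspace X \<Longrightarrow> \<bar>a x\<bar> \<le> 1"
  shows "\<nu> (monomial 0 (\<lambda>x. complex_of_real (a x))) \<le> 1"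
proof -
  define u where "u \<epsilon> x = Complex (a x) (\<epsilon> * sqrt (1 - (a x)\<^sup>2))" for \<epsilon> x
  have u: "continuous_map X euclidean (u \<epsilon>)" for \<epsilon>
  proof -
    have "continuous_map euclidean euclidean (\<lambda>t. Complex t (\<epsilon> * sqrt (1 - t\<^sup>2)))"
      unfolding continuous_map_iff_continuous2 Complex_eq by (intro continuous_intros)
    moreover have "u \<epsilon> = (\<lambda>t. Complex t (\<epsilon> * sqrt (1 - t\<^sup>2))) \<circ> a"
      by (simp add: u_def fun_eq_iff)
    ultimately show ?thesis by (metis continuous_map_compose[OF a])
  qed
  have unit: "cmod (u \<epsilon> x) = 1" if "x \<in> topspace X" "\<epsilon> \<in> {1, -1}" for \<epsilon> x
    using le[OF that(1)] that(2) abs_square_le_1[of "a x"] by (auto simp: u_def cmod_def)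
  have "monomial 0 (\<lambda>x. complex_of_real (a x)) = (1/2) \<odot>\<^bsub>A\<^esub> (monomial 0 (u 1) \<oplus>\<^bsub>A\<^esub> monomial 0 (u (-1)))"
    unfolding monomial_zero_add[OF u u] monomial_smult[OF continuous_map_add[OF u u]]
    by (rule arg_cong[where f = "monomial 0"]) (auto simp: u_def complex_eq_iff)
  moreover have "\<nu> \<dots> \<le> 1/2 * (1 + 1)"
    using A.seminorm_smult[OF nu, of "monomial 0 (u 1) \<oplus>\<^bsub>A\<^esub> monomial 0 (u (-1))" "1/2"]
      A.seminorm_add[OF nu monomial_closed[OF u] monomial_closed[OF u], of 0 1 0 "-1"]
      seminorm_unitary[OF u, of 1] seminorm_unitary[OF u, of "-1"] unit u
    by (simp add: A_add_closed monomial_closed)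
  ultimately show ?thesis by simp
qed

lemma seminorm_monomial_le:
  assumes a: "continuous_map X euclidean a" and M: "M > 0" and le: "\<And>x. x \<in> topspace X \<Longrightarrow> cmod (a x) \<le> M"
  shows "\<nu> (monomial n a) \<le> M"
proof -
  let ?b = "\<lambda>x. (cmod (a (h n x)) / M)\<^sup>2"
  have "continuous_map X euclidean ((\<lambda>z. (cmod z / M)\<^sup>2) \<circ> (\<lambda>x. a (h n x)))"
    using M by (intro continuous_map_compose[OF continuous_comp_h[OF a]])
      (auto simp: continuous_map_iff_continuous2 intro!: continuous_intros)
  then have b: "continuous_map X euclidean ?b"
    by (simp add: comp_def)
  have "\<bar>?b x\<bar> \<le> 1" if "x \<in> topspace X" for x
    using le[OF h_closed[OF that], of n] M by (simp add: power_le_one)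
  then have "\<nu> (monomial 0 (\<lambda>x. complex_of_real (?b x))) \<le> 1"
    by (rule seminorm_real[OF b])
  moreover have "monomial 0 (\<lambda>x. complex_of_real ((cmod (a (h n x)))\<^sup>2))
      = complex_of_real (M\<^sup>2) \<odot>\<^bsub>A\<^esub> monomial 0 (\<lambda>x. complex_of_real (?b x))"
    using M continuous_map_complex_of_real[OF b] by (subst monomial_smult) (auto simp: power_divide)
  moreover have "monomial 0 (\<lambda>x. complex_of_real (?b x)) \<in> carrier A"
    by (intro monomial_closed continuous_map_complex_of_real b)
  ultimately have "(\<nu> (monomial n a))\<^sup>2 \<le> M\<^sup>2"
    using A.seminorm_smult[OF nu, of "monomial 0 (\<lambda>x. complex_of_real (?b x))" "complex_of_real (M\<^sup>2)"]
      seminorm_monomial_cstar[OF a, of n] M by (simp add: norm_power mult_left_le del: of_real_power)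
  then show ?thesis
    by (rule power2_le_imp_le) (use M in simp)
qed

end

lemma bounded_coeff:
  assumes "compact_space X" "f \<in> carrier C"
  obtains M where "M > 0" "\<And>x. x \<in> topspace X \<Longrightarrow> cmod (f x) \<le> M"
proof -
  have "compactin euclidean (f ` topspace X)"
    using assms(1) cont_algebra_continuous[OF assms(2)] unfolding compact_space_def by (rule image_compactin)
  then have "bounded (f ` topspace X)"
    by (simp add: compact_imp_bounded)
  then obtain M where "M > 0" "\<forall>y\<in>f ` topspace X. norm y \<le> M"
    using bounded_pos by blast
  then show ?thesis using that by blast
qed

text \<open>Every C*-seminorm of \<open>\<Sum> f\<^sub>n u\<^sup>n\<close> is at most the sum of the suprema of the \<open>|f\<^sub>n|\<close>, which are finite on a
  compact space.\<close>

theorem bounded_star_alg_A: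
  assumes comp: "compact_space X"
  shows "bounded_star_alg A"
proof unfold_locales
  fix f assume f: "f \<in> carrier A"
  have "\<exists>M. \<forall>n. M n > 0 \<and> (\<forall>x\<in>topspace X. cmod (f n x) \<le> M n)"
  proof (intro choice allI)
    fix n show "\<exists>M. M > 0 \<and> (\<forall>x\<in>topspace X. cmod (f n x) \<le> M)"
      by (rule bounded_coeff[OF comp A_coeff[OF f, of n]]) auto
  qed
  then obtain M where M: "\<And>n. M n > 0" "\<And>n x. x \<in> topspace X \<Longrightarrow> cmod (f n x) \<le> M n"
    by blast
  define part where "part S = (\<lambda>n. \<lambda>x\<in>topspace X. if n \<in> S then f n x else 0)" for S
  have part_apply: "part S n x = (if n \<in> S then f n x else 0)" if "x \<in> topspace X" for S n x
    using that by (simp add: part_def)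
  have part: "part S \<in> carrier A" if "finite S" for S
  proof (rule A_carrierI[OF _ that])
    show "part S n \<in> carrier C" for n
      unfolding part_def using cont_algebra_continuous[OF A_coeff[OF f, of n]]
      by (cases "n \<in> S") (auto intro!: cont_algebra_restrict_closed)
  qed (simp add: part_def)
  have bound: "\<nu> (part S) \<le> (\<Sum>n\<in>S. M n)" if nu: "cstar_seminorm A \<nu>" and "finite S" for \<nu> S
    using \<open>finite S\<close>
  proof (induction S rule: finite_induct)
    case empty
    have "part {} = \<zero>\<^bsub>A\<^esub>"
    proof (rule A_eqI)
      show "part {} n x = \<zero>\<^bsub>A\<^esub> n x" if "x \<in> topspace X" for n x
        using that by (simp add: A_zero part_def)
    qed (simp_all add: part A_zero_closed)
    then show ?case by (simp add: A.seminorm_zero[OF nu])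
  next
    case (insert n S)
    have fn: "continuous_map X euclidean (f n)" by (rule cont_algebra_continuous[OF A_coeff[OF f]])
    have "part (insert n S) = monomial n (f n) \<oplus>\<^bsub>A\<^esub> part S"
      by (rule A_eqI) (use insert in \<open>auto simp: part A_add_closed monomial_closed fn A_add monomial_apply part_apply\<close>)
    then have "\<nu> (part (insert n S)) \<le> \<nu> (monomial n (f n)) + \<nu> (part S)"
      using A.seminorm_add[OF nu monomial_closed[OF fn] part[OF insert(1)]] by simp
    moreover have "\<nu> (monomial n (f n)) \<le> M n"
      by (rule seminorm_monomial_le[OF nu fn M])
    ultimately show ?case using insert by simp
  qed
  have "part (supp f) = f"
    by (rule A_eqI) (use f not_in_supp in \<open>auto simp: part finite_supp part_apply\<close>)
  then show "bdd_above ((\<lambda>\<nu>. \<nu> f) ` {\<nu>. cstar_seminorm A \<nu>})"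
    using bound[OF _ finite_supp[OF f]] by (intro bdd_aboveI2[where M = "\<Sum>n\<in>supp f. M n"]) simp
qed

end

section \<open>Crossed products of decomposable systems\<close>

text \<open>\<open>Y\<close> is the disjoint union of \<open>N\<close> equivariant copies \<open>H i\<close> of \<open>X\<close>. Since \<open>X\<close> is compact and \<open>Y\<close> is
  Hausdorff, continuous bijectivity is enough to identify the topologies.\<close>

locale system_decomposition =
  X: int_system X h + Y: int_system Y k
  for X :: "'x topology" and h and Y :: "'y topology" and k +
  fixes N :: nat and H :: "nat \<Rightarrow> 'x \<Rightarrow> 'y"
  assumes compact_X: "compact_space X" and Hausdorff_Y: "Hausdorff_space Y"
    and H_continuous: "i < N \<Longrightarrow> continuous_map X Y (H i)"
    and H_inj: "\<lbrakk>i < N; j < N; x \<in> topspace X; x' \<in> topspace X; H i x = H j x'\<rbrakk> \<Longrightarrow> i = j \<and> x = x'"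
    and H_surj: "y \<in> topspace Y \<Longrightarrow> \<exists>i<N. \<exists>x\<in>topspace X. y = H i x"
    and H_equivariant: "\<lbrakk>i < N; x \<in> topspace X\<rbrakk> \<Longrightarrow> H i (h m x) = k m (H i x)"
begin

lemma H_closed: "\<lbrakk>i < N; x \<in> topspace X\<rbrakk> \<Longrightarrow> H i x \<in> topspace Y"
  using H_continuous[of i] by (auto simp: continuous_map_def)

definition rest :: "nat \<Rightarrow> (int \<Rightarrow> 'y \<Rightarrow> complex) \<Rightarrow> int \<Rightarrow> 'x \<Rightarrow> complex" where
  "rest i f n = (\<lambda>x\<in>topspace X. f n (H i x))"

lemma rest_apply: "x \<in> topspace X \<Longrightarrow> rest i f n x = f n (H i x)"
  by (simp add: rest_def)

lemma rest_closed:
  assumes i: "i < N" and f: "f \<in> carrier Y.A"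
  shows "rest i f \<in> carrier X.A"
proof (rule X.A_carrierI)
  show "rest i f n \<in> carrier X.C" for n
    unfolding rest_def
    using continuous_map_compose[OF H_continuous[OF i] cont_algebra_continuous[OF Y.A_coeff[OF f, of n]]]
    by (intro cont_algebra_restrict_closed) (simp add: comp_def)
  show "finite (Y.supp f)" by (rule Y.finite_supp[OF f])
qed (use i in \<open>simp add: rest_apply Y.not_in_supp H_closed\<close>)

text \<open>A closed set of \<open>Y\<close> is a union of images under the \<open>H i\<close>, and these are closed maps because
  \<open>X\<close> is compact and \<open>Y\<close> is Hausdorff.\<close>

lemma glued_continuous:
  assumes z: "\<And>i. i < N \<Longrightarrow> continuous_map X Z (z i)"
    and f: "\<And>i x. \<lbrakk>i < N; x \<in> topspace X\<rbrakk> \<Longrightarrow> f (H i x) = z i x"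
  shows "continuous_map Y Z f"
  unfolding continuous_map_closedin
proof (intro conjI allI impI)
  show "f \<in> topspace Y \<rightarrow> topspace Z"
  proof
    fix y assume "y \<in> topspace Y"
    then obtain i x where "i < N" "x \<in> topspace X" "y = H i x"
      using H_surj by blast
    then show "f y \<in> topspace Z"
      using z f by (auto simp: continuous_map_def)
  qed
  fix D assume D: "closedin Z D"
  have "{y \<in> topspace Y. f y \<in> D} = (\<Union>i\<in>{..<N}. H i ` {x \<in> topspace X. z i x \<in> D})"
    using H_surj f H_closed by fastforce
  moreover have "closedin Y (H i ` {x \<in> topspace X. z i x \<in> D})" if i: "i < N" for i
  proof -
    have "closedin X {x \<in> topspace X. z i x \<in> D}"
      using z[OF i] D by (simp add: continuous_map_closedin)
    then have "compactin X {x \<in> topspace X. z i x \<in> D}"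
      by (rule closedin_compact_space[OF compact_X])
    then have "compactin Y (H i ` {x \<in> topspace X. z i x \<in> D})"
      by (rule image_compactin[OF _ H_continuous[OF i]])
    then show ?thesis
      by (rule compactin_imp_closedin[OF Hausdorff_Y])
  qed
  ultimately show "closedin Y {y \<in> topspace Y. f y \<in> D}"
    by (simp only:) (intro closedin_Union; auto)
qed

text \<open>The inverse of restriction glues coefficient functions along the partition of \<open>Y\<close>.\<close>

lemma rest_surj:
  assumes z: "\<And>i. i < N \<Longrightarrow> z i \<in> carrier X.A"
  shows "\<exists>f\<in>carrier Y.A. \<forall>i<N. rest i f = z i"
proof -
  define G where "G y = (SOME (i, x). i < N \<and> x \<in> topspace X \<and> y = H i x)" for y
  have G: "G (H i x) = (i, x)" if "i < N" "x \<in> topspace X" for i x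
    unfolding G_def by (rule some_equality) (use that H_inj in auto)
  define f where "f n = (\<lambda>y\<in>topspace Y. case G y of (i, x) \<Rightarrow> z i n x)" for n
  have f: "f n (H i x) = z i n x" if "i < N" "x \<in> topspace X" for n i x
    using that by (simp add: f_def G H_closed)
  have "f \<in> carrier Y.A"
  proof (rule Y.A_carrierI)
    show "f n \<in> carrier Y.C" for n
    proof -
      have "continuous_map Y euclidean (f n)"
        by (rule glued_continuous[where z = "\<lambda>i. z i n"])
          (simp_all add: f cont_algebra_continuous X.A_coeff z)
      then show ?thesis by (simp add: cont_algebra_carrier f_def)
    qed
    show "finite (\<Union>i\<in>{..<N}. X.supp (z i))"
      using z by (simp add: X.finite_supp)
    fix n y assume n: "n \<notin> (\<Union>i\<in>{..<N}. X.supp (z i))" and "y \<in> topspace Y"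
    then obtain i x where "i < N" "x \<in> topspace X" "y = H i x"
      using H_surj by blast
    then show "f n y = 0" using n by (simp add: f X.not_in_supp)
  qed
  moreover from this have "rest i f = z i" if "i < N" for i
    by (intro X.A_eqI) (simp_all add: rest_closed that z rest_apply f)
  ultimately show ?thesis by blast
qed

lemma star_alg_decomposition_rest: "star_alg_decomposition Y.A X.A N rest"
proof -
  interpret XA: bounded_star_alg X.A by (rule X.bounded_star_alg_A[OF compact_X])
  show ?thesis
  proof unfold_locales
    fix i f g and c :: complex
    assume i: "i < N"
    show "rest i \<one>\<^bsub>Y.A\<^esub> = \<one>\<^bsub>X.A\<^esub>"
      by (rule X.A_eqI) (use i in \<open>simp_all add: rest_closed Y.A_one_closed X.A_one_closed rest_apply
          H_closed X.A_one Y.A_one\<close>)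
    assume f: "f \<in> carrier Y.A"
    show "rest i f \<in> carrier X.A" by (rule rest_closed[OF i f])
    show "rest i (c \<odot>\<^bsub>Y.A\<^esub> f) = c \<odot>\<^bsub>X.A\<^esub> rest i f"
      by (rule X.A_eqI) (use i f in \<open>simp_all add: rest_closed Y.A_smult_closed X.A_smult_closed rest_apply
          H_closed X.A_smult Y.A_smult\<close>)
    show "rest i (adj Y.A f) = adj X.A (rest i f)"
      by (rule X.A_eqI) (use i f in \<open>simp_all add: rest_closed Y.A_adj_closed X.A_adj_closed rest_apply
          H_closed X.h_closed X.A_adj Y.A_adj H_equivariant\<close>)
    assume g: "g \<in> carrier Y.A"
    show "rest i (f \<oplus>\<^bsub>Y.A\<^esub> g) = rest i f \<oplus>\<^bsub>X.A\<^esub> rest i g"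
      by (rule X.A_eqI) (use i f g in \<open>simp_all add: rest_closed Y.A_add_closed X.A_add_closed rest_apply
          H_closed X.A_add Y.A_add\<close>)
    show "rest i (f \<otimes>\<^bsub>Y.A\<^esub> g) = rest i f \<otimes>\<^bsub>X.A\<^esub> rest i g"
    proof (rule X.A_eqI)
      fix n x assume x: "x \<in> topspace X"
      let ?S = "Y.supp f \<union> X.supp (rest i f)"
      have S: "finite ?S" using i f by (simp add: Y.finite_supp X.finite_supp rest_closed)
      have "rest i (f \<otimes>\<^bsub>Y.A\<^esub> g) n x = (\<Sum>m\<in>?S. f m (H i x) * g (n - m) (k (- m) (H i x)))"
        unfolding rest_apply[OF x] by (rule Y.A_mult[OF f g H_closed[OF i x] S]) simp
      also have "\<dots> = (\<Sum>m\<in>?S. rest i f m x * rest i g (n - m) (h (- m) x))"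
        using i x by (simp add: rest_apply X.h_closed H_equivariant)
      also have "\<dots> = (rest i f \<otimes>\<^bsub>X.A\<^esub> rest i g) n x"
        by (rule X.A_mult[OF rest_closed[OF i f] rest_closed[OF i g] x S, symmetric]) simp
      finally show "rest i (f \<otimes>\<^bsub>Y.A\<^esub> g) n x = (rest i f \<otimes>\<^bsub>X.A\<^esub> rest i g) n x" .
    qed (use i f g in \<open>simp_all add: rest_closed Y.A_mult_closed X.A_mult_closed\<close>)
  next
    fix f g assume f: "f \<in> carrier Y.A" and g: "g \<in> carrier Y.A"
      and eq: "\<And>i. i < N \<Longrightarrow> rest i f = rest i g"
    show "f = g"
    proof (rule Y.A_eqI[OF f g])
      fix n y assume "y \<in> topspace Y"
      then obtain i x where i: "i < N" and x: "x \<in> topspace X" and y: "y = H i x"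
        using H_surj by blast
      show "f n y = g n y"
        using fun_cong[OF fun_cong[OF eq[OF i]], of n x] by (simp add: rest_apply x y)
    qed
  next
    fix z assume "\<And>i. i < N \<Longrightarrow> z i \<in> carrier X.A"
    then show "\<exists>f\<in>carrier Y.A. \<forall>i<N. rest i f = z i" by (rule rest_surj)
  qed
qed

theorem crossed_product_decomposition:
  "cstar_isomorphic (crossed_product Y.C (induced_action Y k))
     (direct_sum_copies N (crossed_product X.C (induced_action X h)))"
proof -
  interpret star_alg_decomposition Y.A X.A N rest by (rule star_alg_decomposition_rest)
  show ?thesis unfolding crossed_product_def by (rule enveloping_iso_direct_sum)
qed

end

section \<open>Powers of a homeomorphism\<close>

context
  fixes X :: "'x topology" and S :: "'x \<Rightarrow> 'x"
  assumes S: "homeomorphic_map X X S"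
begin

lemma homeomorphism_bij: "inj_on S (topspace X)" "S ` topspace X = topspace X"
  using S by (simp_all add: homeomorphic_eq_everything_map)

lemma homeomorphism_inverse:
  assumes "x \<in> topspace X"
  shows "inv_into (topspace X) S x \<in> topspace X" "S (inv_into (topspace X) S x) = x"
  using assms homeomorphism_bij(2) by (auto intro: inv_into_into f_inv_into_f)

lemma continuous_map_funpow: "continuous_map X X T \<Longrightarrow> continuous_map X X (T ^^ n)"
  by (induction n) (auto simp: continuous_map_compose id_def[symmetric])

lemma homeo_power_continuous: "continuous_map X X (homeo_power X S m)"
proof -
  obtain T where T: "homeomorphic_maps X X S T"
    using S by (auto simp: homeomorphic_map_maps)
  then have T': "continuous_map X X T" "\<And>x. x \<in> topspace X \<Longrightarrow> T x \<in> topspace X"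
      "\<And>x. x \<in> topspace X \<Longrightarrow> S (T x) = x"
    by (auto simp: homeomorphic_maps_def continuous_map_def)
  have "T x = inv_into (topspace X) S x" if "x \<in> topspace X" for x
    using T' that homeomorphism_bij(1) by (intro inv_into_f_eq[symmetric]) auto
  then have "continuous_map X X (inv_into (topspace X) S)"
    by (rule continuous_map_eq[OF T'(1)])
  then show ?thesis
    using S by (simp add: homeo_power_def continuous_map_funpow homeomorphic_imp_continuous_map)
qed

lemma homeo_power_closed: "x \<in> topspace X \<Longrightarrow> homeo_power X S m x \<in> topspace X"
  using homeo_power_continuous[of m] by (auto simp: continuous_map_def)

lemma homeo_power_add_one:
  assumes x: "x \<in> topspace X"
  shows "homeo_power X S (m + 1) x = S (homeo_power X S m x)"
proof (cases "m \<ge> 0")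
  case True
  then show ?thesis by (simp add: homeo_power_def nat_add_distrib)
next
  case False
  define k where "k = nat (- m - 1)"
  have k: "m = - int (Suc k)"
    using False by (simp add: k_def)
  have "homeo_power X S (m + 1) = inv_into (topspace X) S ^^ k"
    by (auto simp: homeo_power_def k)
  moreover have "homeo_power X S m = inv_into (topspace X) S \<circ> (inv_into (topspace X) S ^^ k)"
    by (simp add: homeo_power_def k nat_add_distrib)
  moreover have "homeo_power X S (m + 1) x \<in> topspace X"
    by (rule homeo_power_closed[OF x])
  ultimately show ?thesis
    by (simp add: homeomorphism_inverse)
qed

lemma int_system_homeo_power: "int_system X (homeo_power X S)"
proof
  show "continuous_map X X (homeo_power X S m)" for m
    by (rule homeo_power_continuous)
  fix x assume x: "x \<in> topspace X"
  show "homeo_power X S 0 x = x"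
    by (simp add: homeo_power_def)
  show "homeo_power X S (m + n) x = homeo_power X S m (homeo_power X S n x)" for m n
  proof (induction m rule: int_induct[of _ 0])
    case base
    show ?case by (simp add: homeo_power_def)
  next
    case (step1 m)
    then show ?case
      using homeo_power_add_one[OF x, of "m + n"] homeo_power_add_one[OF homeo_power_closed[OF x], of m n]
      by (simp add: algebra_simps)
  next
    case (step2 m)
    have "S (homeo_power X S (m - 1 + n) x) = S (homeo_power X S (m - 1) (homeo_power X S n x))"
      using homeo_power_add_one[OF x, of "m - 1 + n"] homeo_power_add_one[OF homeo_power_closed[OF x], of "m - 1" n]
        step2 by (simp add: algebra_simps)
    then show ?case
      using homeomorphism_bij(1) by (simp add: inj_on_eq_iff homeo_power_closed x)
  qed
qed

end

lemma homeo_power_equivariant: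
  assumes S: "homeomorphic_map X X S" and Y: "int_system Y k"
    and g: "\<And>x. x \<in> topspace X \<Longrightarrow> g x \<in> topspace Y"
    and gen: "\<And>x. x \<in> topspace X \<Longrightarrow> g (S x) = k 1 (g x)"
    and x: "x \<in> topspace X"
  shows "g (homeo_power X S m x) = k m (g x)"
proof -
  interpret Y: int_system Y k by (rule Y)
  show ?thesis
  proof (induction m rule: int_induct[of _ 0])
    case base
    show ?case using x g by (simp add: homeo_power_def Y.h_zero)
  next
    case (step1 m)
    have "k (m + 1) (g x) = k 1 (k m (g x))"
      using Y.h_add[OF g[OF x], of 1 m] by (simp add: add.commute)
    then show ?case
      using step1 by (simp add: homeo_power_add_one[OF S x] gen homeo_power_closed[OF S x])
  next
    case (step2 m)
    have "k 1 (g (homeo_power X S (m - 1) x)) = g (homeo_power X S m x)"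
      using homeo_power_add_one[OF S x, of "m - 1"] gen[OF homeo_power_closed[OF S x], of "m - 1"] by simp
    also have "\<dots> = k 1 (k (m - 1) (g x))"
      using step2 Y.h_add[OF g[OF x], of 1 "m - 1"] by simp
    finally show ?case
      using Y.h_minus(2)[of _ 1] g homeo_power_closed[OF S x] x Y.h_closed by metis
  qed
qed

section \<open>The order of a unit modulo prime powers\<close>

lemma power_one_plus_expand: "\<exists>s. (1 + x) ^ m = 1 + of_nat m * x + x\<^sup>2 * (s :: int)"
proof (induction m)
  case (Suc m)
  then obtain s where s: "(1 + x) ^ m = 1 + of_nat m * x + x\<^sup>2 * s" by blast
  have "(1 + x) ^ Suc m = 1 + of_nat (Suc m) * x + x\<^sup>2 * (s + of_nat m + x * s)"
    by (simp add: s algebra_simps power2_eq_square)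
  then show ?case by blast
qed (auto intro: exI[of _ 0])

text \<open>For \<open>a = 1 + p\<^sup>k t\<close> with \<open>p \<nmid> t\<close> and \<open>k \<ge> 2\<close>, raising to the power \<open>p\<close> raises the valuation of
  \<open>a - 1\<close> by exactly one, and raising to a power prime to \<open>p\<close> does not change it. The bound \<open>k \<ge> 2\<close>
  makes this hold for \<open>p = 2\<close> as well.\<close>

lemma exact_power:
  fixes p k m :: nat and a :: int
  assumes p: "Factorial_Ring.prime p" and k: "k \<ge> 2"
    and a: "a = 1 + int p ^ k * t" "\<not> int p dvd t" and m: "m > 0"
  shows "\<exists>t'. a ^ m = 1 + int p ^ (k + multiplicity p m) * t' \<and> \<not> int p dvd t'"
proof -
  have prime_int: "Factorial_Ring.prime (int p)" using p by simp
  have prime_to: "\<exists>t'. b ^ n = 1 + int p ^ k * t' \<and> \<not> int p dvd t'"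
    if b: "b = 1 + int p ^ k * u" "\<not> int p dvd u" and n: "\<not> p dvd n" and "k \<ge> 2" for b u n k
  proof -
    obtain s where "b ^ n = 1 + int n * (int p ^ k * u) + (int p ^ k * u)\<^sup>2 * s"
      unfolding b using power_one_plus_expand by blast
    then have "b ^ n = 1 + int p ^ k * (int n * u + int p ^ k * (u\<^sup>2 * s))"
      by (simp add: algebra_simps power2_eq_square)
    moreover have "int p dvd int p ^ k * (u\<^sup>2 * s)"
      using \<open>k \<ge> 2\<close> by (simp add: dvd_power)
    moreover have "\<not> int p dvd int n * u"
      using b(2) n prime_dvd_mult_iff[OF prime_int] by simp
    ultimately show ?thesis
      by (metis dvd_add_left_iff)
  qed
  have step: "\<exists>t'. b ^ p = 1 + int p ^ Suc k * t' \<and> \<not> int p dvd t'"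
    if b: "b = 1 + int p ^ k * u" "\<not> int p dvd u" and k: "k \<ge> 2" for b u k
  proof -
    obtain j where j: "k = Suc (Suc j)" using k by (metis add_2_eq_Suc le_Suc_ex)
    obtain s where "b ^ p = 1 + int p * (int p ^ k * u) + (int p ^ k * u)\<^sup>2 * s"
      unfolding b using power_one_plus_expand by blast
    then have "b ^ p = 1 + int p ^ Suc k * (u + int p * (int p ^ j * u\<^sup>2 * s))"
      by (simp add: j algebra_simps power2_eq_square)
    moreover have "\<not> int p dvd u + int p * (int p ^ j * u\<^sup>2 * s)"
      using b(2) by (simp add: dvd_add_left_iff)
    ultimately show ?thesis by blast
  qed
  have iter: "\<exists>t'. a ^ (p ^ e) = 1 + int p ^ (k + e) * t' \<and> \<not> int p dvd t'" for e
  proof (induction e)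
    case 0
    then show ?case using a by auto
  next
    case (Suc e)
    then obtain u where u: "a ^ (p ^ e) = 1 + int p ^ (k + e) * u" "\<not> int p dvd u" by blast
    have "a ^ (p ^ Suc e) = (a ^ (p ^ e)) ^ p"
      by (simp add: mult.commute flip: power_mult)
    then show ?case using step[OF u] k by simp
  qed
  obtain n where n: "m = p ^ multiplicity p m * n" "\<not> p dvd n"
    by (rule multiplicity_decompose'[of m p]) (use m p in \<open>auto dest: not_prime_unit\<close>)
  obtain u where u: "a ^ (p ^ multiplicity p m) = 1 + int p ^ (k + multiplicity p m) * u" "\<not> int p dvd u"
    using iter by blast
  have "a ^ m = (a ^ (p ^ multiplicity p m)) ^ n"
    by (subst n(1)) (simp add: power_mult)
  then show ?thesis using prime_to[OF u n(2)] k by simp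
qed

lemma prime_power_dvd_iff:
  fixes p x :: nat
  assumes "Factorial_Ring.prime p" "x > 0"
  shows "p ^ l dvd x \<longleftrightarrow> l \<le> multiplicity p x"
  using assms multiplicity_geI[of x p l] multiplicity_dvd'[of l p x] not_prime_unit by blast

lemma power_cong_one_iff:
  fixes p k l m :: nat and a :: int
  assumes p: "Factorial_Ring.prime p" and k: "k \<ge> 2"
    and a: "a = 1 + int p ^ k * t" "\<not> int p dvd t"
  shows "int p ^ (k + l) dvd a ^ m - 1 \<longleftrightarrow> p ^ l dvd m"
proof (cases "m = 0")
  case False
  then obtain t' where t': "a ^ m = 1 + int p ^ (k + multiplicity p m) * t'" "\<not> int p dvd t'"
    using exact_power[OF p k a] by blast
  have "int p ^ (k + l) dvd a ^ m - 1 \<longleftrightarrow> l \<le> multiplicity p m"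
  proof
    assume "l \<le> multiplicity p m"
    then have "int p ^ (k + l) dvd int p ^ (k + multiplicity p m)"
      by (intro le_imp_power_dvd) simp
    then show "int p ^ (k + l) dvd a ^ m - 1" by (simp add: t'(1))
  next
    assume *: "int p ^ (k + l) dvd a ^ m - 1"
    show "l \<le> multiplicity p m"
    proof (rule ccontr)
      assume "\<not> l \<le> multiplicity p m"
      then have "int p ^ (k + multiplicity p m) * int p dvd int p ^ (k + l)"
        unfolding power_Suc2[symmetric] by (intro le_imp_power_dvd) simp
      then have "int p ^ (k + multiplicity p m) * int p dvd int p ^ (k + multiplicity p m) * t'"
        using * t'(1) dvd_trans by fastforce
      then show False
        using t'(2) p by (simp add: prime_gt_0_nat)
    qed
  qed
  also have "\<dots> \<longleftrightarrow> p ^ l dvd m"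
    using False p by (simp add: prime_power_dvd_iff)
  finally show ?thesis .
qed simp

definition prime_power_prod :: "nat set \<Rightarrow> (nat \<Rightarrow> nat) \<Rightarrow> nat" where
  "prime_power_prod F L = (\<Prod>p\<in>F. p ^ L p)"

locale prime_set =
  fixes F :: "nat set" and q :: nat
  assumes finite_F: "finite F" and nonempty_F: "F \<noteq> {}" and primes: "p \<in> F \<Longrightarrow> Factorial_Ring.prime p"
    and prime_q: "Factorial_Ring.prime q" and q_notin: "q \<notin> F"
begin

abbreviation M :: "(nat \<Rightarrow> nat) \<Rightarrow> nat" where "M \<equiv> prime_power_prod F"

abbreviation P :: nat where "P \<equiv> \<Prod>F"

lemma coprime_powers: "\<lbrakk>p \<in> F; p' \<in> F; p \<noteq> p'\<rbrakk> \<Longrightarrow> coprime (p ^ m) (p' ^ n)"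
  using primes_coprime[OF primes primes, of p p'] by (auto simp: coprime_power_left_iff coprime_power_right_iff)

lemma M_pos: "M L > 0"
  using primes prime_gt_0_nat by (auto simp: prime_power_prod_def intro!: prod_pos)

lemma M_add: "M (\<lambda>p. K p + L p) = M K * M L"
  by (simp add: prime_power_prod_def power_add prod.distrib)

lemma M_const: "M (\<lambda>p. m) = P ^ m"
  by (simp add: prime_power_prod_def prod_power_distrib)

lemma P_gt_1: "P > 1"
proof -
  obtain p where p: "p \<in> F" using nonempty_F by blast
  then have "p dvd P" using dvd_prodI[OF finite_F, of p "\<lambda>x. x"] by simp
  moreover have "P > 0" by (rule prod_pos) (use primes prime_gt_0_nat in blast)
  ultimately have "p \<le> P" by (rule dvd_imp_le)
  then show ?thesis using prime_gt_1_nat[OF primes[OF p]] by linarith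
qed

lemma coprime_q: "p \<in> F \<Longrightarrow> coprime p q"
  using primes prime_q q_notin primes_coprime by blast

lemma coprime_M: "(\<And>p. p \<in> F \<Longrightarrow> coprime x p) \<Longrightarrow> coprime x (M L)"
  unfolding prime_power_prod_def by (intro prod_coprime_right) (simp add: coprime_power_right_iff)

lemma coprime_M_iff:
  assumes "\<And>p. p \<in> F \<Longrightarrow> L p > 0"
  shows "coprime x (M L) \<longleftrightarrow> (\<forall>p\<in>F. coprime x p)"
proof
  assume x: "coprime x (M L)"
  have "p dvd M L" if "p \<in> F" for p
    unfolding prime_power_prod_def
    using dvd_prodI[OF finite_F that, of "\<lambda>p. p ^ L p"] assms[OF that] dvd_power[of "L p" p] dvd_trans by blast
  then show "\<forall>p\<in>F. coprime x p"
    using x coprime_divisors[OF dvd_refl] by blast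
qed (simp add: coprime_M)

lemma coprime_M_q: "coprime (M L) q"
  using coprime_M[of q L] coprime_q by (simp add: coprime_commute)

lemma cong_M_iff:
  fixes x y :: nat
  shows "[x = y] (mod M L) \<longleftrightarrow> (\<forall>p\<in>F. [x = y] (mod p ^ L p))"
proof
  assume "[x = y] (mod M L)"
  then show "\<forall>p\<in>F. [x = y] (mod p ^ L p)"
    unfolding prime_power_prod_def using finite_F
    by (auto intro: cong_dvd_modulus_nat dvd_prodI)
next
  assume "\<forall>p\<in>F. [x = y] (mod p ^ L p)"
  then show "[x = y] (mod M L)"
    unfolding prime_power_prod_def by (intro cong_cong_prod_coprime_nat) (use coprime_powers in blast)+
qed

lemma M_dvd_iff: "M L dvd m \<longleftrightarrow> (\<forall>p\<in>F. p ^ L p dvd m)"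
  using cong_M_iff[of m 0 L] by (simp add: cong_0_iff)

text \<open>\<open>K p\<close> is the multiplicity of \<open>p\<close> in \<open>q ^ d0 - 1\<close> for an exponent \<open>d0\<close> that makes all these
  multiplicities at least two. The order \<open>d\<close> of \<open>q\<close> modulo \<open>\<Prod> p ^ K p\<close> divides \<open>d0\<close>, so \<open>q ^ d - 1\<close> lies between
  \<open>\<Prod> p ^ K p\<close> and \<open>q ^ d0 - 1\<close> in divisibility and has the same multiplicities at \<open>F\<close>. Then \<open>q ^ (d m) - 1\<close> is
  divisible by \<open>p ^ (K p + l)\<close> exactly if \<open>p ^ l\<close> divides \<open>m\<close>.\<close>

theorem stable_order:
  obtains K d where "\<And>p. K p \<ge> 2" "d > 0" "\<And>L. ord (M (\<lambda>p. K p + L p)) q = d * M L"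
proof -
  define d0 where "d0 = totient (M (\<lambda>p. 2))"
  have d0: "d0 > 0" using M_pos by (simp add: d0_def)
  have q1: "q > 1" using prime_q prime_gt_1_nat by blast
  then have neq: "q ^ d0 - 1 > 0" using one_less_power[OF q1 d0] by simp
  have "[q ^ d0 = 1] (mod M (\<lambda>p. 2))"
    unfolding d0_def by (rule euler_theorem) (use coprime_M_q in \<open>simp add: coprime_commute\<close>)
  then have "M (\<lambda>p. 2) dvd q ^ d0 - 1"
    using q1 by (simp add: cong_altdef_nat)
  then have sq: "p\<^sup>2 dvd q ^ d0 - 1" if "p \<in> F" for p
    using that by (simp add: M_dvd_iff)
  define K where "K p = (if p \<in> F then multiplicity p (q ^ d0 - 1) else 2)" for p
  define d where "d = ord (M K) q"
  have K: "K p \<ge> 2" for p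
    using sq[of p] neq primes[of p] by (simp add: K_def prime_power_dvd_iff)
  have d: "d > 0" using coprime_M_q by (simp add: d_def)
  have "M K dvd q ^ d0 - 1"
    by (auto simp: M_dvd_iff K_def multiplicity_dvd)
  then have "[q ^ d0 = 1] (mod M K)"
    using q1 by (simp add: cong_altdef_nat)
  then have "d dvd d0" unfolding ord_divides d_def .
  then obtain c where c: "d0 = d * c" ..
  have "[q ^ d = 1] (mod M K)" unfolding d_def by (rule ord)
  then have "M K dvd q ^ d - 1" using q1 by (simp add: cong_altdef_nat)
  then have lower: "p ^ K p dvd q ^ d - 1" if "p \<in> F" for p
    using that by (simp add: M_dvd_iff)
  have exact: "\<exists>t. int q ^ d = 1 + int p ^ K p * t \<and> \<not> int p dvd t" if p: "p \<in> F" for p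
  proof -
    have eq: "int (q ^ d - 1) = int q ^ d - 1" using q1 by (simp add: of_nat_diff)
    obtain t where t: "q ^ d - 1 = p ^ K p * t" using lower[OF p] ..
    have "int q ^ d = 1 + int p ^ K p * int t"
      using eq unfolding t by simp
    moreover have "\<not> int p dvd int t"
    proof
      assume "int p dvd int t"
      then have "p ^ Suc (K p) dvd q ^ d - 1"
        unfolding t by (simp add: mult_dvd_mono)
      moreover have "q ^ d - 1 dvd q ^ d0 - 1"
      proof -
        have "int q ^ d - 1 dvd (int q ^ d) ^ c - 1"
          using power_diff_1_eq[of "int q ^ d" c] by simp
        then have "int (q ^ d - 1) dvd int (q ^ d0 - 1)"
          using q1 by (simp add: of_nat_diff c power_mult)
        then show ?thesis by (simp only: of_nat_dvd_iff)
      qed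
      ultimately have "p ^ Suc (K p) dvd q ^ d0 - 1" by (rule dvd_trans)
      then have "Suc (K p) \<le> multiplicity p (q ^ d0 - 1)"
        using neq primes[OF p] by (simp only: prime_power_dvd_iff)
      then show False using p by (simp add: K_def)
    qed
    ultimately show ?thesis by blast
  qed
  have order: "ord (M (\<lambda>p. K p + L p)) q = d * M L" for L
  proof (rule dvd_antisym)
    have iff: "[q ^ (d * m) = 1] (mod M (\<lambda>p. K p + L p)) \<longleftrightarrow> M L dvd m" for m
    proof -
      have "[q ^ (d * m) = 1] (mod p ^ (K p + L p)) \<longleftrightarrow> p ^ L p dvd m" if p: "p \<in> F" for p
      proof -
        obtain t where t: "int q ^ d = 1 + int p ^ K p * t" "\<not> int p dvd t" using exact[OF p] by blast
        have "[q ^ (d * m) = 1] (mod p ^ (K p + L p)) \<longleftrightarrow> int p ^ (K p + L p) dvd (int q ^ d) ^ m - 1"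
          by (simp add: cong_iff_dvd_diff power_mult flip: cong_int_iff)
        also have "\<dots> \<longleftrightarrow> p ^ L p dvd m"
          by (rule power_cong_one_iff[OF primes[OF p] K t])
        finally show ?thesis .
      qed
      then show ?thesis by (simp add: cong_M_iff M_dvd_iff)
    qed
    show "ord (M (\<lambda>p. K p + L p)) q dvd d * M L"
      using iff[of "M L"] unfolding ord_divides by simp
    have one: "[q ^ ord (M (\<lambda>p. K p + L p)) q = 1] (mod M (\<lambda>p. K p + L p))" by (rule ord)
    then have "[q ^ ord (M (\<lambda>p. K p + L p)) q = 1] (mod M K)"
      by (rule cong_dvd_modulus_nat) (simp add: M_add)
    then obtain m where m: "ord (M (\<lambda>p. K p + L p)) q = d * m"
      unfolding ord_divides d_def by blast
    show "d * M L dvd ord (M (\<lambda>p. K p + L p)) q"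
      using one iff[of m] unfolding m by (simp add: mult_dvd_mono)
  qed
  show ?thesis using that[OF K d order] .
qed

lemma totient_M:
  assumes "\<And>p. p \<in> F \<Longrightarrow> L p > 0"
  shows "totient (M L) = (\<Prod>p\<in>F. (p - 1) * p ^ (L p - 1))"
proof -
  have "totient (M L) = (\<Prod>p\<in>F. totient (p ^ L p))"
    unfolding prime_power_prod_def
  proof (rule totient_prod_coprime)
    show "pairwise coprime ((\<lambda>p. p ^ L p) ` F)"
    proof (rule pairwiseI)
      fix x y assume "x \<in> (\<lambda>p. p ^ L p) ` F" "y \<in> (\<lambda>p. p ^ L p) ` F" "x \<noteq> y"
      then obtain p p' where "p \<in> F" "p' \<in> F" "x = p ^ L p" "y = p' ^ L p'" "p \<noteq> p'" by auto
      then show "coprime x y" using coprime_powers by metis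
    qed
    show "inj_on (\<lambda>p. p ^ L p) F"
    proof (rule inj_onI, rule ccontr)
      fix p p' assume p: "p \<in> F" "p' \<in> F" and eq: "p ^ L p = p' ^ L p'" and "p \<noteq> p'"
      then have "coprime (p ^ L p) (p ^ L p)" using coprime_powers by metis
      moreover have "p ^ L p > 1"
        using one_less_power[of p "L p"] prime_gt_1_nat[OF primes[OF p(1)]] assms[OF p(1)] by simp
      ultimately show False by auto
    qed
  qed
  also have "\<dots> = (\<Prod>p\<in>F. (p - 1) * p ^ (L p - 1))"
    using assms primes by (intro prod.cong) (simp_all add: totient_prime_power)
  finally show ?thesis .
qed

lemma totient_M_add:
  assumes "\<And>p. p \<in> F \<Longrightarrow> K p > 0"
  shows "totient (M (\<lambda>p. K p + L p)) = totient (M K) * M L"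
proof -
  have "(p - 1) * p ^ (K p + L p - 1) = (p - 1) * p ^ (K p - 1) * p ^ L p" if "p \<in> F" for p
    using assms[OF that] by (simp add: mult.assoc flip: power_add)
  then have "(\<Prod>p\<in>F. (p - 1) * p ^ (K p + L p - 1)) = (\<Prod>p\<in>F. (p - 1) * p ^ (K p - 1)) * M L"
    unfolding prime_power_prod_def prod.distrib[symmetric] by (intro prod.cong refl)
  then show ?thesis
    using assms by (simp add: totient_M)
qed

end

section \<open>Representatives for the cosets of a cyclic group of units\<close>

lemma card_units_mod: "n > 1 \<Longrightarrow> card {x. x < n \<and> coprime x n} = totient n"
proof -
  assume n: "n > 1"
  have "{x. x < n \<and> coprime x n} = totatives n"
    using n by (auto simp: totatives_def intro: Suc_leI gr0I order.not_eq_order_implies_strict)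
  then show ?thesis by (simp add: totient_def)
qed

text \<open>The least elements of the orbits of multiplication by \<open>q\<close> serve as representatives. Distinct exponents
  below the order give distinct elements of an orbit.\<close>

lemma coset_representatives:
  fixes n q :: nat
  assumes n: "n > 1" and q: "coprime n q"
  obtains N :: nat and r where "\<And>i. i < N \<Longrightarrow> coprime (r i) n"
    "bij_betw (\<lambda>(i, e). r i * q ^ e mod n) ({..<N} \<times> {..<ord n q}) {x. x < n \<and> coprime x n}"
proof -
  define U where "U = {x. x < n \<and> coprime x n}"
  define d where "d = ord n q"
  have d: "d > 0" using q by (simp add: d_def)
  have qd: "[q ^ (d * m) = 1] (mod n)" for m
    unfolding ord_divides d_def by simp
  define orbit where "orbit u = range (\<lambda>e. u * q ^ e mod n)" for u
  have fin: "finite (orbit u)" for u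
    by (rule finite_subset[of _ "{..<n}"]) (use n in \<open>auto simp: orbit_def\<close>)
  have orbit_U: "orbit u \<subseteq> U" if "u \<in> U" for u
    using that n q by (auto simp: orbit_def U_def coprime_mod_left_iff coprime_commute)
  have self: "u \<in> orbit u" if "u \<in> U" for u
    using that by (auto simp: orbit_def U_def intro!: image_eqI[of _ _ 0])
  have sub: "orbit v \<subseteq> orbit u" if v: "v \<in> orbit u" for u v
  proof -
    obtain e where "v = u * q ^ e mod n" using v by (auto simp: orbit_def)
    then have "v * q ^ j mod n = u * q ^ (e + j) mod n" for j
      by (simp add: mod_mult_left_eq power_add mult.assoc)
    then have "v * q ^ j mod n \<in> orbit u" for j
      unfolding orbit_def by (metis rangeI)
    then show ?thesis unfolding orbit_def[of v] by blast
  qed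
  have sym: "u \<in> orbit v" if u: "u \<in> U" and v: "v \<in> orbit u" for u v
  proof -
    obtain e where e: "v = u * q ^ e mod n" using v by (auto simp: orbit_def)
    have "e \<le> d * e" using d by simp
    then have "v * q ^ (d * e - e) mod n = u * q ^ (d * e) mod n"
      by (simp add: e mod_mult_left_eq mult.assoc flip: power_add)
    also have "\<dots> = u"
      using cong_scalar_left[OF qd, of u e] u by (simp add: cong_def U_def)
    finally show ?thesis by (metis orbit_def rangeI)
  qed
  have orbit_eq: "orbit v = orbit u" if "u \<in> U" "v \<in> orbit u" for u v
    using sub[OF that(2)] sub[OF sym[OF that]] by blast
  define R where "R = (\<lambda>u. Min (orbit u)) ` U"
  have rep: "Min (orbit u) \<in> orbit u" if "u \<in> U" for u
    using Min_in[OF fin] self[OF that] by blast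
  have R_U: "R \<subseteq> U" using rep orbit_U by (auto simp: R_def)
  have R_Min: "Min (orbit r) = r" if "r \<in> R" for r
  proof -
    obtain u where "u \<in> U" "r = Min (orbit u)" using \<open>r \<in> R\<close> by (auto simp: R_def)
    then show ?thesis using orbit_eq[OF _ rep] by simp
  qed
  have bij: "bij_betw (\<lambda>(r, e). r * q ^ e mod n) (R \<times> {..<d}) U"
    unfolding bij_betw_def
  proof (intro conjI subset_antisym subsetI inj_onI)
    fix x y assume x: "x \<in> R \<times> {..<d}" and y: "y \<in> R \<times> {..<d}"
      and eq: "(\<lambda>(r, e). r * q ^ e mod n) x = (\<lambda>(r, e). r * q ^ e mod n) y"
    obtain r e where re: "x = (r, e)" by fastforce
    obtain r' e' where re': "y = (r', e')" by fastforce
    define z where "z = r * q ^ e mod n"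
    have z': "z = r' * q ^ e' mod n" using eq by (simp add: z_def re re')
    have z: "z \<in> orbit r" unfolding orbit_def z_def by (rule rangeI)
    have z'': "z \<in> orbit r'" unfolding orbit_def z' by (rule rangeI)
    have r: "r \<in> R" "r' \<in> R" "r \<in> U" "r' \<in> U" using x y R_U by (auto simp: re re')
    have "orbit r = orbit r'" by (rule trans[OF orbit_eq[OF r(3) z, symmetric] orbit_eq[OF r(4) z'']])
    then have rr: "r = r'" using R_Min[OF r(1)] R_Min[OF r(2)] by (metis (no_types))
    have "[r * q ^ e = r * q ^ e'] (mod n)" using z' unfolding z_def rr cong_def .
    then have "[q ^ e = q ^ e'] (mod n)"
      using r(3) by (simp add: cong_mult_lcancel_nat U_def)
    then have "[e = e'] (mod d)" using q by (simp add: order_divides_expdiff d_def)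
    then have "e = e'" using x y by (simp add: re re' cong_def)
    then show "x = y" by (simp add: re re' rr)
  next
    fix u assume "u \<in> (\<lambda>(r, e). r * q ^ e mod n) ` (R \<times> {..<d})"
    then obtain r e where r: "r \<in> R" and "u = r * q ^ e mod n" by auto
    then have "u \<in> orbit r" unfolding orbit_def by blast
    then show "u \<in> U" using orbit_U[of r] r R_U by blast
  next
    fix u assume u: "u \<in> U"
    define r where "r = Min (orbit u)"
    have r: "r \<in> R" using u by (auto simp: R_def r_def)
    have "u \<in> orbit r" unfolding r_def by (rule sym[OF u rep[OF u]])
    then obtain e where e: "u = r * q ^ e mod n" by (auto simp: orbit_def)
    have "[q ^ e = q ^ (e mod d)] (mod n)"
      unfolding order_divides_expdiff[OF q] by (simp add: d_def cong_def)
    then have "u = r * q ^ (e mod d) mod n"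
      using cong_scalar_left e by (auto simp: cong_def)
    then show "u \<in> (\<lambda>(r, e). r * q ^ e mod n) ` (R \<times> {..<d})"
      using r d by (intro image_eqI[of _ _ "(r, e mod d)"]) auto
  qed
  have "finite R" using R_U by (rule finite_subset) (simp add: U_def)
  then obtain r where r: "bij_betw r {..<card R} R"
    using ex_bij_betw_nat_finite[of R] by (auto simp: atLeast0LessThan)
  have "bij_betw (map_prod r id) ({..<card R} \<times> {..<d}) (R \<times> {..<d})"
    using r bij_betw_map_prod[OF r, of id "{..<d}" "{..<d}"] by simp
  moreover have "(\<lambda>(r, e). r * q ^ e mod n) \<circ> map_prod r id = (\<lambda>(i, e). r i * q ^ e mod n)"
    by (simp add: fun_eq_iff)
  ultimately have "bij_betw (\<lambda>(i, e). r i * q ^ e mod n) ({..<card R} \<times> {..<d}) U"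
    using bij_betw_trans[OF _ bij] by metis
  then have indexed: "bij_betw (\<lambda>(i, e). r i * q ^ e mod n) ({..<card R} \<times> {..<ord n q}) {x. x < n \<and> coprime x n}"
    unfolding U_def d_def .
  have "coprime (r i) n" if "i < card R" for i
    using that r R_U by (auto simp: bij_betw_def U_def)
  then show ?thesis using indexed by (rule that)
qed

text \<open>Injectivity survives the passage to a multiple of the modulus: reduction determines the representative,
  and then the exponent is determined up to the larger order. When the totient grows by the same factor as the
  order of \<open>q\<close>, counting gives surjectivity.\<close>

lemma lift_representatives:
  fixes n n' q :: nat and r :: "'i \<Rightarrow> nat"
  assumes n: "n > 1" and n': "n' > 1" "n dvd n'" and q: "coprime n' q"
    and r: "\<And>i. i \<in> I \<Longrightarrow> coprime (r i) n'"
    and bij: "bij_betw (\<lambda>(i, e). r i * q ^ e mod n) (I \<times> {..<ord n q}) {x. x < n \<and> coprime x n}"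
    and card: "totient n' * ord n q = totient n * ord n' q"
  shows "bij_betw (\<lambda>(i, e). r i * q ^ e mod n') (I \<times> {..<ord n' q}) {x. x < n' \<and> coprime x n'}"
proof -
  let ?U = "{x. x < n' \<and> coprime x n'}"
  have qn: "coprime n q" using q n'(2) coprime_divisors[of n n' q q] by simp
  have d: "ord n q > 0" using qn by simp
  have inj: "inj_on (\<lambda>(i, e). r i * q ^ e mod n') (I \<times> {..<ord n' q})"
  proof (rule inj_onI, clarify)
    fix i e i' e' assume i: "i \<in> I" "i' \<in> I" and e: "e < ord n' q" "e' < ord n' q"
      and "r i * q ^ e mod n' = r i' * q ^ e' mod n'"
    then have eq: "[r i * q ^ e = r i' * q ^ e'] (mod n')" by (simp add: cong_def)
    have red: "[s * q ^ j = s * q ^ (j mod ord n q)] (mod n)" for s j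
    proof (rule cong_mult)
      show "[q ^ j = q ^ (j mod ord n q)] (mod n)"
        unfolding order_divides_expdiff[OF qn] by (simp add: cong_def)
    qed simp
    have "[r i * q ^ (e mod ord n q) = r i' * q ^ (e' mod ord n q)] (mod n)"
      using cong_dvd_modulus_nat[OF eq n'(2)] red[of "r i" e] red[of "r i'" e'] cong_trans cong_sym by meson
    then have "(i, e mod ord n q) = (i', e' mod ord n q)"
      using i d bij by (intro inj_onD[OF bij_betw_imp_inj_on[OF bij]]) (auto simp: cong_def)
    then have ii: "i = i'" by simp
    have "[q ^ e = q ^ e'] (mod n')"
      using eq r[OF i(2)] by (simp add: ii cong_mult_lcancel_nat)
    then have "[e = e'] (mod ord n' q)" using q by (simp add: order_divides_expdiff)
    then show "i = i' \<and> e = e'" using e ii by (simp add: cong_def)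
  qed
  have "(\<lambda>(i, e). r i * q ^ e mod n') ` (I \<times> {..<ord n' q}) = ?U"
  proof (rule card_subset_eq)
    show "(\<lambda>(i, e). r i * q ^ e mod n') ` (I \<times> {..<ord n' q}) \<subseteq> ?U"
      using n' q r by (auto simp: coprime_mod_left_iff coprime_commute)
    have "card I * ord n q = totient n"
      using bij_betw_same_card[OF bij] card_units_mod[OF n] by (simp add: card_cartesian_product)
    then have "card I * ord n' q * ord n q = totient n' * ord n q"
      using card by (metis mult.assoc mult.commute)
    then have "card I * ord n' q = totient n'" using d by simp
    then show "card ((\<lambda>(i, e). r i * q ^ e mod n') ` (I \<times> {..<ord n' q})) = card ?U"
      using card_image[OF inj] card_units_mod[OF n'(1)] by (simp add: card_cartesian_product)
  qed simp
  then show ?thesis using inj by (simp add: bij_betw_def)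
qed

section \<open>The odometer\<close>

definition weight :: "(nat \<Rightarrow> nat) \<Rightarrow> nat \<Rightarrow> nat" where
  "weight n k = (\<Prod>i<k. n i)"

text \<open>The number whose mixed radix digits are the first \<open>k\<close> entries of \<open>x\<close>.\<close>

definition digit_value :: "(nat \<Rightarrow> nat) \<Rightarrow> (nat \<Rightarrow> nat) \<Rightarrow> nat \<Rightarrow> nat" where
  "digit_value n x k = (\<Sum>i<k. x i * weight n i)"

lemma weight_simps [simp]: "weight n 0 = 1" "weight n (Suc k) = weight n k * n k"
  by (simp_all add: weight_def mult.commute)

lemma digit_value_simps [simp]:
  "digit_value n x 0 = 0" "digit_value n x (Suc k) = digit_value n x k + x k * weight n k"
  by (simp_all add: digit_value_def)

lemma digit_value_local: "(\<And>i. i < k \<Longrightarrow> x i = y i) \<Longrightarrow> digit_value n x k = digit_value n y k"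
  by (simp add: digit_value_def)

locale digit_bases =
  fixes n :: "nat \<Rightarrow> nat"
  assumes n_ge_2: "n k \<ge> 2"
begin

abbreviation X :: "(nat \<Rightarrow> nat) topology" where "X \<equiv> odometer_space n"

lemma topspace_X: "x \<in> topspace X \<longleftrightarrow> (\<forall>k. x k < n k)"
  by (auto simp: odometer_space_def PiE_iff)

lemma weight_pos: "weight n k > 0"
  unfolding weight_def using n_ge_2 by (intro prod_pos) (metis less_le_trans pos2)

lemma compact_X: "compact_space X"
  by (simp add: odometer_space_def compact_space_product_topology compact_space_discrete_topology)

lemma Hausdorff_X: "Hausdorff_space X"
  by (simp add: odometer_space_def Hausdorff_space_product_topology)

lemma digit_value_less:
  assumes x: "x \<in> topspace X"
  shows "digit_value n x k < weight n k"
proof (induction k)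
  case (Suc k)
  have "digit_value n x (Suc k) < weight n k + x k * weight n k"
    using Suc by simp
  also have "\<dots> = weight n k * Suc (x k)" by simp
  also have "\<dots> \<le> weight n k * n k"
    using x by (intro mult_le_mono2) (simp add: topspace_X Suc_leI)
  finally show ?case by simp
qed simp

lemma weight_dvd: "k \<le> m \<Longrightarrow> weight n k dvd weight n m"
  by (induction m rule: dec_induct) simp_all

lemma digit_value_cong:
  assumes "k \<le> m"
  shows "[digit_value n x m = digit_value n x k] (mod weight n k)"
  using assms
proof (induction m rule: dec_induct)
  case (step m)
  have "[x m * weight n m = 0] (mod weight n k)"
    using weight_dvd[OF step(1)] by (simp add: cong_0_iff)
  from cong_add[OF step(3) this] show ?case by simp
qed simp

lemma digit_value_inj:
  assumes "\<And>k. digit_value n x k = digit_value n y k"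
  shows "x = y"
proof
  fix k
  have "x k * weight n k = y k * weight n k"
    using assms[of k] assms[of "Suc k"] by simp
  then show "x k = y k" using weight_pos[of k] by simp
qed

lemma digit_value_surj:
  assumes less: "\<And>k. s k < weight n k" and coherent: "\<And>k. s (Suc k) mod weight n k = s k"
  shows "\<exists>x\<in>topspace X. \<forall>k. digit_value n x k = s k"
proof (intro bexI allI)
  let ?x = "\<lambda>k. s (Suc k) div weight n k"
  show "digit_value n ?x k = s k" for k
  proof (induction k)
    case 0
    then show ?case using less[of 0] by simp
  next
    case (Suc k)
    then show ?case
      using coherent[of k] mod_mult_div_eq[of "s (Suc k)" "weight n k"] by (simp add: mult.commute)
  qed
  show "?x \<in> topspace X"
    using less[of "Suc k" for k] by (simp add: topspace_X less_mult_imp_div_less mult.commute)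
qed

lemma odometer_closed: "x \<in> topspace X \<Longrightarrow> odometer n x \<in> topspace X"
  using n_ge_2 by (auto simp: topspace_X odometer_def intro!: mod_less_divisor intro: less_le_trans[OF pos2])

text \<open>The odometer adds \<open>1\<close> to the value of the first \<open>k\<close> digits, except that a carry out of position \<open>k - 1\<close> is
  lost; it is worth \<open>weight n k\<close>.\<close>

lemma digit_value_odometer_carry:
  assumes x: "x \<in> topspace X"
  shows "digit_value n (odometer n x) k + (if \<forall>j<k. x j = n j - 1 then weight n k else 0) = digit_value n x k + 1"
proof (induction k)
  case (Suc k)
  show ?case
  proof (cases "\<forall>j<k. x j = n j - 1")
    case carry: True
    show ?thesis
    proof (cases "x k = n k - 1")
      case True
      then have "x k + 1 = n k" using n_ge_2[of k] by simp
      moreover from this have "weight n k * n k = weight n k + x k * weight n k"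
        by (metis add.commute mult.commute mult_Suc_right Suc_eq_plus1)
      ultimately show ?thesis
        using Suc carry True by (simp add: odometer_def less_Suc_eq)
    next
      case False
      moreover have "x k < n k" using x by (simp add: topspace_X)
      ultimately have "x k + 1 < n k" by linarith
      then show ?thesis
        using Suc carry False by (auto simp: odometer_def less_Suc_eq)
    qed
  next
    case False
    then have no_carry: "\<not> (\<forall>j<Suc k. x j = n j - 1)" using less_SucI by blast
    have "odometer n x k = x k" unfolding odometer_def by (rule if_not_P[OF False])
    then show ?thesis
      using Suc unfolding if_not_P[OF False] if_not_P[OF no_carry] by simp
  qed
qed simp

lemma digit_value_odometer:
  assumes x: "x \<in> topspace X"
  shows "[digit_value n (odometer n x) k = digit_value n x k + 1] (mod weight n k)"
proof -
  have "digit_value n x k + 1 \<in> {digit_value n (odometer n x) k, digit_value n (odometer n x) k + weight n k}"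
    using digit_value_odometer_carry[OF x, of k] by (auto split: if_splits)
  then show ?thesis by (auto simp: cong_def simp del: One_nat_def)
qed

text \<open>A map that looks at finitely many digits only is constant on cylinder sets, which are open.\<close>

lemma continuous_map_finite_digits:
  assumes closed: "\<And>x. x \<in> topspace X \<Longrightarrow> f x \<in> U"
    and local: "\<And>x y. \<lbrakk>x \<in> topspace X; y \<in> topspace X; \<And>i. i < k \<Longrightarrow> x i = y i\<rbrakk> \<Longrightarrow> f x = f y"
  shows "continuous_map X (discrete_topology U) f"
  unfolding continuous_map_def
proof (intro conjI allI impI)
  show "f \<in> topspace X \<rightarrow> topspace (discrete_topology U)"
    using closed by auto
  fix V
  show "openin X {x \<in> topspace X. f x \<in> V}"
  proof (subst openin_subopen, intro ballI)
    fix x assume x: "x \<in> {x \<in> topspace X. f x \<in> V}"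
    define W where "W = (\<Pi>\<^sub>E i\<in>UNIV. if i < k then {x i} else {0..<n i})"
    have "{i. (if i < k then {x i} else {0..<n i}) \<noteq> {0..<n i}} \<subseteq> {..<k}"
      by auto
    then have "finite {i. (if i < k then {x i} else {0..<n i}) \<noteq> {0..<n i}}"
      using finite_subset by blast
    then have "openin X W"
      using x unfolding W_def odometer_space_def openin_PiE_gen
      by (auto simp: PiE_iff)
    moreover have "x \<in> W"
      using x by (auto simp: W_def PiE_iff topspace_X)
    moreover have "W \<subseteq> {x \<in> topspace X. f x \<in> V}"
    proof
      fix y assume y: "y \<in> W"
      have yX: "y i < n i" "i < k \<Longrightarrow> y i = x i" for i
        using y x by (auto simp: W_def PiE_iff topspace_X dest!: spec[of _ i] split: if_splits)
      then have "y \<in> topspace X" by (simp add: topspace_X)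
      moreover from this have "f y = f x"
        using x yX(2) by (intro local) auto
      ultimately show "y \<in> {x \<in> topspace X. f x \<in> V}" using x by simp
    qed
    ultimately show "\<exists>W. openin X W \<and> x \<in> W \<and> W \<subseteq> {x \<in> topspace X. f x \<in> V}" by blast
  qed
qed

lemma odometer_continuous: "continuous_map X X (odometer n)"
proof -
  have "continuous_map X (discrete_topology {0..<n k}) (\<lambda>x. odometer n x k)" for k
  proof (rule continuous_map_finite_digits)
    show "odometer n x k \<in> {0..<n k}" if "x \<in> topspace X" for x
      using odometer_closed[OF that] by (simp add: topspace_X)
    show "odometer n x k = odometer n y k" if "\<And>i. i < Suc k \<Longrightarrow> x i = y i" for x y
      using that by (auto simp: odometer_def)
  qed
  then show ?thesis
    unfolding odometer_space_def[of n] continuous_map_componentwise_UNIV by (simp add: odometer_space_def)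
qed

end

section \<open>Residue rings, \<open>p\<close>-adic integers and their finite products\<close>

text \<open>The cosets that form \<^term>\<open>ZFact k\<close>, described by congruences to make integer arithmetic available.\<close>

definition residue_class :: "int \<Rightarrow> int \<Rightarrow> int set" where
  "residue_class k a = {b. [b = a] (mod k)}"

lemma residue_class_eq_iff: "residue_class k a = residue_class k b \<longleftrightarrow> [a = b] (mod k)"
proof
  assume "residue_class k a = residue_class k b"
  then have "a \<in> residue_class k b" by (metis (mono_tags) cong_refl mem_Collect_eq residue_class_def)
  then show "[a = b] (mod k)" by (simp add: residue_class_def)
qed (simp add: residue_class_def cong_def)

lemma residue_class_coset: "(Idl\<^bsub>\<Z>\<^esub> {k}) +>\<^bsub>\<Z>\<^esub> a = residue_class k a"
proof -
  have "(\<exists>x. b = x * k + a) \<longleftrightarrow> [b = a] (mod k)" for b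
  proof -
    have "(\<exists>x. b = x * k + a) \<longleftrightarrow> (\<exists>x. b - a = k * x)" by (auto simp: algebra_simps)
    then show ?thesis by (simp add: cong_iff_dvd_diff dvd_def)
  qed
  then show ?thesis
    by (auto simp: int_Idl a_r_coset_def' residue_class_def)
qed

lemma ZFact_ops:
  shows carrier_ZFact: "carrier (ZFact k) = range (residue_class k)"
    and ZFact_mult: "residue_class k a \<otimes>\<^bsub>ZFact k\<^esub> residue_class k b = residue_class k (a * b)"
    and ZFact_add: "residue_class k a \<oplus>\<^bsub>ZFact k\<^esub> residue_class k b = residue_class k (a + b)"
    and ZFact_one: "\<one>\<^bsub>ZFact k\<^esub> = residue_class k 1"
    and ZFact_zero: "\<zero>\<^bsub>ZFact k\<^esub> = residue_class k 0"
proof -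
  interpret ideal "Idl\<^bsub>\<Z>\<^esub> {k}" \<Z> by (simp add: int.genideal_ideal)
  show "carrier (ZFact k) = range (residue_class k)"
    by (auto simp: ZFact_defs A_RCOSETS_def' residue_class_coset)
  show "residue_class k a \<otimes>\<^bsub>ZFact k\<^esub> residue_class k b = residue_class k (a * b)"
    using rcoset_mult_add[of a b] by (simp add: ZFact_defs residue_class_coset)
  show "residue_class k a \<oplus>\<^bsub>ZFact k\<^esub> residue_class k b = residue_class k (a + b)"
    using a_rcos_sum[of a b] by (simp add: ZFact_defs residue_class_coset)
  show "\<one>\<^bsub>ZFact k\<^esub> = residue_class k 1"
    by (simp add: ZFact_defs residue_class_coset)
  show "\<zero>\<^bsub>ZFact k\<^esub> = residue_class k 0"
    using residue_class_coset[of k 0] by (simp add: ZFact_defs a_r_coset_def' int_Idl)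
qed

lemma ZFact_Units: "residue_class k a \<in> Units (ZFact k) \<longleftrightarrow> coprime a k"
proof -
  have "residue_class k a \<in> Units (ZFact k) \<longleftrightarrow> (\<exists>b. [a * b = 1] (mod k))"
    by (auto simp: Units_def carrier_ZFact ZFact_mult ZFact_one residue_class_eq_iff mult.commute)
  then show ?thesis by (simp add: coprime_iff_invertible_int)
qed

lemma nat_image_simps:
  "nat_image R 0 = \<zero>\<^bsub>R\<^esub>" "nat_image R (Suc n) = nat_image R n \<oplus>\<^bsub>R\<^esub> \<one>\<^bsub>R\<^esub>"
  by (simp_all add: nat_image_def add_pow_def nat_pow_def)

lemma nat_image_ZFact: "nat_image (ZFact k) n = residue_class k (int n)"
  by (induction n) (simp_all add: nat_image_simps ZFact_zero ZFact_one ZFact_add add.commute)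

text \<open>A power in a product of groups is trivial if and only if all its components are.\<close>

lemma unit_order_iff:
  assumes q: "\<And>p. p \<in> F \<Longrightarrow> coprime p q"
  shows "unit_order F l q dvd m \<longleftrightarrow> (\<forall>p\<in>F. [q ^ m = 1] (mod p ^ l p))"
proof -
  let ?U = "\<lambda>p. units_of (ZFact (int p ^ l p))"
  let ?G = "product_group F ?U"
  define g where "g = (\<lambda>p\<in>F. nat_image (ZFact (int p ^ l p)) q)"
  have grp: "group (?U p)" for p
    using cring.axioms(1)[OF ZFact_is_cring] ring.is_monoid monoid.units_group by blast
  interpret G: group ?G by (simp add: grp)
  have "coprime (int q) (int p ^ l p)" if "p \<in> F" for p
    using q[OF that] by (simp add: coprime_commute coprime_power_right_iff)
  then have g: "g \<in> carrier ?G"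
    by (auto simp: g_def nat_image_ZFact units_of_carrier ZFact_Units)
  have pow: "g [^]\<^bsub>?G\<^esub> m = (\<lambda>p\<in>F. residue_class (int p ^ l p) (int q ^ m))" for m
  proof (induction m)
    case 0
    show ?case by (simp add: units_of_one ZFact_one)
  next
    case (Suc m)
    show ?case
      unfolding G.nat_pow_Suc Suc mult_product_group
      by (rule restrict_ext) (simp add: g_def nat_image_ZFact units_of_mult ZFact_mult mult.commute)
  qed
  have "unit_order F l q dvd m \<longleftrightarrow> g [^]\<^bsub>?G\<^esub> m = \<one>\<^bsub>?G\<^esub>"
    using G.pow_eq_id[OF g, of m] by (simp add: unit_order_def g_def)
  also have "\<dots> \<longleftrightarrow> (\<forall>p\<in>F. residue_class (int p ^ l p) (int q ^ m) = residue_class (int p ^ l p) 1)"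
    unfolding pow by (auto simp: units_of_one ZFact_one restrict_def fun_eq_iff)
  also have "\<dots> \<longleftrightarrow> (\<forall>p\<in>F. [q ^ m = 1] (mod p ^ l p))"
    by (simp add: residue_class_eq_iff flip: cong_int_iff)
  finally show ?thesis .
qed

text \<open>The \<open>p\<close>-adic integer given by a sequence of integers whose entry with index \<open>n\<close> is relevant modulo \<open>p\<^sup>n\<close>.\<close>

definition padic :: "nat \<Rightarrow> (nat \<Rightarrow> int) \<Rightarrow> nat \<Rightarrow> int set" where
  "padic p a n = residue_class (int p ^ n) (a n)"

definition coherent :: "nat \<Rightarrow> (nat \<Rightarrow> int) \<Rightarrow> bool" where
  "coherent p a \<longleftrightarrow> (\<forall>n. [a (Suc n) = a n] (mod int p ^ n))"

lemma coherent_cong: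
  assumes "coherent p a" "n \<le> m"
  shows "[a m = a n] (mod int p ^ n)"
  using assms(2)
proof (induction m rule: dec_induct)
  case (step m)
  have "[a (Suc m) = a m] (mod int p ^ n)"
    using assms(1) step(1) by (auto simp: coherent_def intro: cong_dvd_modulus le_imp_power_dvd)
  then show ?case using step(3) cong_trans by blast
qed simp

lemma coherent_ops:
  shows coherent_mult: "\<lbrakk>coherent p a; coherent p b\<rbrakk> \<Longrightarrow> coherent p (\<lambda>n. a n * b n)"
    and coherent_const: "coherent p (\<lambda>n. c)"
  by (simp_all add: coherent_def cong_mult)

lemma residue_class_subset_iff: "residue_class (k * m) b \<subseteq> residue_class k a \<longleftrightarrow> [b = a] (mod k)"
proof
  assume "residue_class (k * m) b \<subseteq> residue_class k a"
  moreover have "b \<in> residue_class (k * m) b" by (simp add: residue_class_def)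
  ultimately have "b \<in> residue_class k a" by blast
  then show "[b = a] (mod k)" by (simp add: residue_class_def)
next
  assume "[b = a] (mod k)"
  then show "residue_class (k * m) b \<subseteq> residue_class k a"
    by (auto simp: residue_class_def intro: cong_trans[OF cong_modulus_mult])
qed

lemma carrier_padic: "carrier (padic_ring p) = padic p ` {a. coherent p a}"
proof (intro subset_antisym subsetI)
  fix x assume x: "x \<in> carrier (padic_ring p)"
  then have "\<And>n. x n \<in> range (residue_class (int p ^ n))" and sub: "\<And>n. x (Suc n) \<subseteq> x n"
    by (auto simp: padic_ring_def carrier_ZFact)
  then have "\<forall>n. \<exists>a. x n = residue_class (int p ^ n) a" by blast
  then obtain a where a: "\<And>n. x n = residue_class (int p ^ n) (a n)" by metis
  have "coherent p a"
    unfolding coherent_def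
  proof
    fix n
    show "[a (Suc n) = a n] (mod int p ^ n)"
      using sub[of n] residue_class_subset_iff[of "int p ^ n" "int p"] by (simp add: a mult.commute)
  qed
  moreover have "x = padic p a" by (simp add: fun_eq_iff a padic_def)
  ultimately show "x \<in> padic p ` {a. coherent p a}" by blast
next
  fix x assume "x \<in> padic p ` {a. coherent p a}"
  then obtain a where a: "coherent p a" "x = padic p a" by blast
  have "padic p a (Suc n) \<subseteq> padic p a n" for n
    using a(1) residue_class_subset_iff[of "int p ^ n" "int p"] by (simp add: padic_def coherent_def mult.commute)
  then show "x \<in> carrier (padic_ring p)"
    by (auto simp: padic_ring_def carrier_ZFact padic_def a(2))
qed

lemma padic_ops:
  shows padic_mult: "padic p a \<otimes>\<^bsub>padic_ring p\<^esub> padic p b = padic p (\<lambda>n. a n * b n)"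
    and padic_add: "padic p a \<oplus>\<^bsub>padic_ring p\<^esub> padic p b = padic p (\<lambda>n. a n + b n)"
    and padic_one: "\<one>\<^bsub>padic_ring p\<^esub> = padic p (\<lambda>n. 1)"
    and padic_zero: "\<zero>\<^bsub>padic_ring p\<^esub> = padic p (\<lambda>n. 0)"
  by (simp_all add: padic_ring_def product_ring_def padic_def ZFact_mult ZFact_add ZFact_one ZFact_zero fun_eq_iff)

lemma padic_eq_iff: "padic p a = padic p b \<longleftrightarrow> (\<forall>n. [a n = b n] (mod int p ^ n))"
  by (simp add: padic_def fun_eq_iff residue_class_eq_iff)

definition padic_tuple :: "nat set \<Rightarrow> (nat \<Rightarrow> nat \<Rightarrow> int) \<Rightarrow> nat \<Rightarrow> nat \<Rightarrow> int set" where
  "padic_tuple F a = (\<lambda>p\<in>F. padic p (a p))"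

abbreviation coherent_tuple :: "nat set \<Rightarrow> (nat \<Rightarrow> nat \<Rightarrow> int) \<Rightarrow> bool" where
  "coherent_tuple F a \<equiv> \<forall>p\<in>F. coherent p (a p)"

lemma carrier_ZF: "carrier (ZF_ring F) = padic_tuple F ` {a. coherent_tuple F a}"
proof (intro subset_antisym subsetI)
  fix x assume "x \<in> carrier (ZF_ring F)"
  then have x: "x \<in> extensional F" "\<forall>p\<in>F. \<exists>a. coherent p a \<and> x p = padic p a"
    by (auto simp: ZF_ring_def product_ring_def carrier_padic PiE_iff)
  then obtain a where a: "\<forall>p\<in>F. coherent p (a p) \<and> x p = padic p (a p)"
    unfolding bchoice_iff by blast
  have "x = padic_tuple F a"
    by (rule extensionalityI[OF x(1)]) (use a in \<open>simp_all add: padic_tuple_def\<close>)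
  then show "x \<in> padic_tuple F ` {a. coherent_tuple F a}" using a by blast
qed (auto simp: ZF_ring_def product_ring_def carrier_padic padic_tuple_def)

lemma padic_tuple_closed: "coherent_tuple F a \<Longrightarrow> padic_tuple F a \<in> carrier (ZF_ring F)"
  by (auto simp: carrier_ZF)

lemma padic_tuple_ops:
  shows padic_tuple_mult: "padic_tuple F a \<otimes>\<^bsub>ZF_ring F\<^esub> padic_tuple F b = padic_tuple F (\<lambda>p n. a p n * b p n)"
    and padic_tuple_one: "\<one>\<^bsub>ZF_ring F\<^esub> = padic_tuple F (\<lambda>p n. 1)"
    and padic_tuple_zero: "\<zero>\<^bsub>ZF_ring F\<^esub> = padic_tuple F (\<lambda>p n. 0)"
    and padic_tuple_add: "padic_tuple F a \<oplus>\<^bsub>ZF_ring F\<^esub> padic_tuple F b = padic_tuple F (\<lambda>p n. a p n + b p n)"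
  by (auto simp: ZF_ring_def product_ring_def padic_tuple_def padic_mult padic_add padic_one padic_zero
      intro!: restrict_ext)

lemma padic_tuple_eq_iff:
  "padic_tuple F a = padic_tuple F b \<longleftrightarrow> (\<forall>p\<in>F. \<forall>n. [a p n = b p n] (mod int p ^ n))"
  by (auto simp: padic_tuple_def fun_eq_iff restrict_def simp flip: padic_eq_iff)

lemma monoid_ZF: "Group.monoid (ZF_ring F)"
proof (rule monoidI)
  fix x y z assume "x \<in> carrier (ZF_ring F)" "y \<in> carrier (ZF_ring F)" "z \<in> carrier (ZF_ring F)"
  then obtain a b c where "coherent_tuple F a" "coherent_tuple F b" "coherent_tuple F c"
    and eqs: "x = padic_tuple F a" "y = padic_tuple F b" "z = padic_tuple F c"
    by (auto simp: carrier_ZF)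
  then show "x \<otimes>\<^bsub>ZF_ring F\<^esub> y \<in> carrier (ZF_ring F)"
    by (simp add: padic_tuple_mult padic_tuple_closed coherent_mult)
  show "x \<otimes>\<^bsub>ZF_ring F\<^esub> y \<otimes>\<^bsub>ZF_ring F\<^esub> z = x \<otimes>\<^bsub>ZF_ring F\<^esub> (y \<otimes>\<^bsub>ZF_ring F\<^esub> z)"
    by (simp add: eqs padic_tuple_mult mult.assoc)
  show "\<one>\<^bsub>ZF_ring F\<^esub> \<otimes>\<^bsub>ZF_ring F\<^esub> x = x" "x \<otimes>\<^bsub>ZF_ring F\<^esub> \<one>\<^bsub>ZF_ring F\<^esub> = x"
    by (simp_all add: eqs padic_tuple_mult padic_tuple_one)
qed (simp add: padic_tuple_one padic_tuple_closed coherent_const)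

lemma nat_image_ZF: "nat_image (ZF_ring F) m = padic_tuple F (\<lambda>p n. int m)"
  by (induction m) (simp_all add: nat_image_simps padic_tuple_zero padic_tuple_one padic_tuple_add add.commute)

text \<open>An inverse of a coherent sequence of units is built level by level; it is coherent because
  inverses modulo \<open>p\<^sup>n\<close> are unique.\<close>

lemma ZF_Units_iff:
  assumes a: "coherent_tuple F a"
  shows "padic_tuple F a \<in> Units (ZF_ring F) \<longleftrightarrow> (\<forall>p\<in>F. \<forall>n. coprime (a p n) (int p ^ n))"
proof
  assume "padic_tuple F a \<in> Units (ZF_ring F)"
  then obtain y where "y \<in> carrier (ZF_ring F)" "padic_tuple F a \<otimes>\<^bsub>ZF_ring F\<^esub> y = \<one>\<^bsub>ZF_ring F\<^esub>"
    by (auto simp: Units_def)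
  then obtain b where "padic_tuple F a \<otimes>\<^bsub>ZF_ring F\<^esub> padic_tuple F b = \<one>\<^bsub>ZF_ring F\<^esub>"
    by (auto simp: carrier_ZF)
  then have "\<forall>p\<in>F. \<forall>n. [a p n * b p n = 1] (mod int p ^ n)"
    by (simp add: padic_tuple_mult padic_tuple_one padic_tuple_eq_iff)
  then show "\<forall>p\<in>F. \<forall>n. coprime (a p n) (int p ^ n)"
    using coprime_iff_invertible_int by blast
next
  assume cop: "\<forall>p\<in>F. \<forall>n. coprime (a p n) (int p ^ n)"
  then have "\<forall>p\<in>F. \<exists>b. \<forall>n. [a p n * b n = 1] (mod int p ^ n)"
    unfolding coprime_iff_invertible_int by metis
  then obtain b where b: "\<And>p n. p \<in> F \<Longrightarrow> [a p n * b p n = 1] (mod int p ^ n)"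
    unfolding bchoice_iff by blast
  have "coherent p (b p)" if p: "p \<in> F" for p
    unfolding coherent_def
  proof
    fix n
    have "[a p n * b p (Suc n) = a p (Suc n) * b p (Suc n)] (mod int p ^ n)"
      using a p by (intro cong_mult) (auto simp: coherent_def cong_sym)
    also have "[a p (Suc n) * b p (Suc n) = 1] (mod int p ^ n)"
      by (rule cong_dvd_modulus[OF b[OF p]]) (simp add: le_imp_power_dvd)
    also have "[1 = a p n * b p n] (mod int p ^ n)"
      by (rule cong_sym[OF b[OF p]])
    finally show "[b p (Suc n) = b p n] (mod int p ^ n)"
      using cop p by (simp add: cong_mult_lcancel)
  qed
  then have "padic_tuple F b \<in> carrier (ZF_ring F)" by (simp add: padic_tuple_closed)
  moreover have "padic_tuple F a \<otimes>\<^bsub>ZF_ring F\<^esub> padic_tuple F b = \<one>\<^bsub>ZF_ring F\<^esub>"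
    "padic_tuple F b \<otimes>\<^bsub>ZF_ring F\<^esub> padic_tuple F a = \<one>\<^bsub>ZF_ring F\<^esub>"
    using b by (simp_all add: padic_tuple_mult padic_tuple_one padic_tuple_eq_iff mult.commute)
  ultimately show "padic_tuple F a \<in> Units (ZF_ring F)"
    using padic_tuple_closed[OF a] by (auto simp: Units_def)
qed

section \<open>Multiplication by \<open>q\<close> on the unit group\<close>

lemma Units_subset_product: "Units (ZF_ring F) \<subseteq> (\<Pi>\<^sub>E p\<in>F. carrier (padic_ring p))"
  by (auto simp: Units_def ZF_ring_def product_ring_def)

lemma topspace_padic: "topspace (padic_topology p) = carrier (padic_ring p)"
  by (auto simp: padic_topology_def padic_ring_def)

lemma topspace_ZF_units: "topspace (ZF_units_topology F) = Units (ZF_ring F)"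
  using Units_subset_product[of F] by (auto simp: ZF_units_topology_def topspace_padic)

lemma Hausdorff_ZF_units: "Hausdorff_space (ZF_units_topology F)"
  by (simp add: ZF_units_topology_def padic_topology_def Hausdorff_space_subtopology Hausdorff_space_product_topology)

lemma continuous_map_into_ZF_units:
  assumes units: "\<And>z. z \<in> topspace Z \<Longrightarrow> g z \<in> Units (ZF_ring F)"
    and comp: "\<And>p n. p \<in> F \<Longrightarrow> continuous_map Z (discrete_topology (carrier (ZFact (int p ^ n)))) (\<lambda>z. g z p n)"
  shows "continuous_map Z (ZF_units_topology F) g"
proof -
  have mem: "g z \<in> (\<Pi>\<^sub>E p\<in>F. carrier (padic_ring p))" if "z \<in> topspace Z" for z
    using units[OF that] Units_subset_product[of F] by blast
  have "continuous_map Z (padic_topology p) (\<lambda>z. g z p)" if p: "p \<in> F" for p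
    unfolding padic_topology_def continuous_map_in_subtopology continuous_map_componentwise_UNIV
    using comp[OF p] mem p by auto
  then have "continuous_map Z (product_topology padic_topology F) g"
    unfolding continuous_map_componentwise using mem by (auto simp: PiE_iff)
  then show ?thesis
    unfolding ZF_units_topology_def continuous_map_in_subtopology using units by blast
qed

lemma continuous_ZF_component:
  assumes "p \<in> F"
  shows "continuous_map (ZF_units_topology F) (discrete_topology (carrier (ZFact (int p ^ n)))) (\<lambda>y. y p n)"
proof -
  have 1: "continuous_map (ZF_units_topology F) (padic_topology p) (\<lambda>y. y p)"
    unfolding ZF_units_topology_def
    by (intro continuous_map_from_subtopology continuous_map_product_projection assms)
  have 2: "continuous_map (padic_topology p) (discrete_topology (carrier (ZFact (int p ^ n)))) (\<lambda>x. x n)"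
    unfolding padic_topology_def
    by (intro continuous_map_from_subtopology continuous_map_product_projection) simp
  show ?thesis using continuous_map_compose[OF 1 2] by (simp add: comp_def)
qed

lemma ZF_mult_component:
  assumes "p \<in> F"
  shows "(x \<otimes>\<^bsub>ZF_ring F\<^esub> y) p n = x p n \<otimes>\<^bsub>ZFact (int p ^ n)\<^esub> y p n"
  using assms by (simp add: ZF_ring_def product_ring_def padic_ring_def)

text \<open>In each component modulo \<open>p\<^sup>n\<close>, multiplication is a map between discrete spaces.\<close>

lemma continuous_unit_mult:
  assumes v: "v \<in> Units (ZF_ring F)"
  shows "continuous_map (ZF_units_topology F) (ZF_units_topology F) (\<lambda>y. v \<otimes>\<^bsub>ZF_ring F\<^esub> y)"
proof (rule continuous_map_into_ZF_units)
  interpret R: Group.monoid "ZF_ring F" by (rule monoid_ZF)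
  show "v \<otimes>\<^bsub>ZF_ring F\<^esub> z \<in> Units (ZF_ring F)" if "z \<in> topspace (ZF_units_topology F)" for z
    using v that by (simp add: topspace_ZF_units)
  fix p n assume p: "p \<in> F"
  interpret Z: cring "ZFact (int p ^ n)" by (rule ZFact_is_cring)
  have "v \<in> (\<Pi>\<^sub>E p\<in>F. carrier (padic_ring p))"
    using v Units_subset_product[of F] by blast
  then have "v p \<in> carrier (padic_ring p)" using p by blast
  then have "v p n \<in> carrier (ZFact (int p ^ n))" by (simp add: padic_ring_def)
  then have "continuous_map (discrete_topology (carrier (ZFact (int p ^ n))))
      (discrete_topology (carrier (ZFact (int p ^ n)))) (\<lambda>c. v p n \<otimes>\<^bsub>ZFact (int p ^ n)\<^esub> c)"
    by (auto simp: continuous_map_from_discrete_topology)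
  from continuous_map_compose[OF continuous_ZF_component[OF p] this]
  show "continuous_map (ZF_units_topology F) (discrete_topology (carrier (ZFact (int p ^ n))))
      (\<lambda>z. (v \<otimes>\<^bsub>ZF_ring F\<^esub> z) p n)"
    by (simp add: comp_def ZF_mult_component[OF p])
qed

definition unit_mult :: "nat set \<Rightarrow> nat \<Rightarrow> int \<Rightarrow> (nat \<Rightarrow> nat \<Rightarrow> int set) \<Rightarrow> nat \<Rightarrow> nat \<Rightarrow> int set" where
  "unit_mult F q m x = (nat_image (ZF_ring F) q [^]\<^bsub>units_of (ZF_ring F)\<^esub> m) \<otimes>\<^bsub>ZF_ring F\<^esub> x"

lemma sigma_action_unit_mult: "sigma_action F q = induced_action (ZF_units_topology F) (unit_mult F q)"
  unfolding sigma_action_def unit_mult_def[abs_def] ..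

context
  fixes F :: "nat set" and q :: nat
  assumes coprime_q: "\<And>p. p \<in> F \<Longrightarrow> coprime p q"
begin

lemma q_unit: "nat_image (ZF_ring F) q \<in> Units (ZF_ring F)"
  using coprime_q by (simp add: nat_image_ZF ZF_Units_iff coherent_const coprime_power_right_iff coprime_commute)

lemma int_system_unit_mult: "int_system (ZF_units_topology F) (unit_mult F q)"
proof
  interpret R: Group.monoid "ZF_ring F" by (rule monoid_ZF)
  interpret U: group "units_of (ZF_ring F)" by (rule R.units_group)
  have pow: "nat_image (ZF_ring F) q [^]\<^bsub>units_of (ZF_ring F)\<^esub> m \<in> Units (ZF_ring F)" for m :: int
    using U.int_pow_closed[of "nat_image (ZF_ring F) q" m] q_unit by (simp add: units_of_carrier)
  show "continuous_map (ZF_units_topology F) (ZF_units_topology F) (unit_mult F q m)" for m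
    unfolding unit_mult_def[abs_def] by (rule continuous_unit_mult[OF pow])
  fix x assume "x \<in> topspace (ZF_units_topology F)"
  then have x: "x \<in> carrier (ZF_ring F)" by (auto simp: topspace_ZF_units)
  show "unit_mult F q 0 x = x"
    using x by (simp add: unit_mult_def units_of_one)
  show "unit_mult F q (m + n) x = unit_mult F q m (unit_mult F q n x)" for m n
    using U.int_pow_mult[of "nat_image (ZF_ring F) q" m n] q_unit x pow R.Units_closed
    by (simp add: unit_mult_def units_of_carrier units_of_mult R.m_assoc)
qed

lemma unit_mult_one: "unit_mult F q 1 (padic_tuple F a) = padic_tuple F (\<lambda>p n. int q * a p n)"
proof -
  interpret R: Group.monoid "ZF_ring F" by (rule monoid_ZF)
  interpret U: group "units_of (ZF_ring F)" by (rule R.units_group)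
  show ?thesis
    using q_unit by (simp add: unit_mult_def U.int_pow_1 units_of_carrier nat_image_ZF padic_tuple_mult)
qed

end

section \<open>The unit group as a disjoint union of odometers\<close>

text \<open>The numbers \<open>r i\<close> with \<open>i < N\<close> represent the cosets of the group generated by \<open>q\<close> in the units modulo
  \<open>\<Prod> p ^ K p\<close>, a level from which on the order of \<open>q\<close> grows as fast as the modulus.\<close>

locale stable_level = prime_set F q for F q +
  fixes K :: "nat \<Rightarrow> nat" and d N :: nat and r :: "nat \<Rightarrow> nat"
  assumes K_ge_2: "K p \<ge> 2" and d_pos: "d > 0"
    and stable: "ord (M (\<lambda>p. K p + L p)) q = d * M L"
    and r_coprime: "i < N \<Longrightarrow> coprime (r i) (M K)"
    and reps: "bij_betw (\<lambda>(i, e). r i * q ^ e mod M K) ({..<N} \<times> {..<d}) {x. x < M K \<and> coprime x (M K)}"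

lemma (in prime_set) prime_power_prod_gt_1:
  assumes "\<And>p. L p > 0"
  shows "M L > 1"
proof -
  obtain p where p: "p \<in> F" using nonempty_F by blast
  have "p ^ L p dvd M L"
    unfolding prime_power_prod_def by (rule dvd_prodI[OF finite_F p])
  then have "p ^ L p \<le> M L" using M_pos by (intro dvd_imp_le)
  moreover have "1 < p ^ L p"
    using assms prime_gt_1_nat[OF primes[OF p]] by (intro one_less_power)
  ultimately show ?thesis by linarith
qed

lemma (in prime_set) stable_level_exists:
  obtains K d N r where "stable_level F q K d N r"
proof -
  obtain K d where K: "\<And>p. K p \<ge> 2" and d: "d > 0" and stable: "\<And>L. ord (M (\<lambda>p. K p + L p)) q = d * M L"
    using stable_order by blast
  have ord: "ord (M K) q = d"
    using stable[of "\<lambda>p. 0"] by (simp add: M_const[of 0, simplified])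
  have "K p > 0" for p using K[of p] by simp
  then have "M K > 1" by (rule prime_power_prod_gt_1)
  then show ?thesis
  proof (rule coset_representatives[OF _ coprime_M_q])
    fix N :: nat and r
    assume "\<And>i. i < N \<Longrightarrow> coprime (r i) (M K)"
      "bij_betw (\<lambda>(i, e). r i * q ^ e mod M K) ({..<N} \<times> {..<ord (M K) q}) {x. x < M K \<and> coprime x (M K)}"
    then have "stable_level F q K d N r"
      using K d stable by unfold_locales (simp_all add: ord)
    then show ?thesis by (rule that)
  qed
qed

context stable_level
begin

definition modulus :: "nat \<Rightarrow> nat" where "modulus m = M (\<lambda>p. K p + m)"

lemma K_pos: "K p > 0" using K_ge_2[of p] by simp

lemma modulus_gt_1: "modulus m > 1"
  unfolding modulus_def by (rule prime_power_prod_gt_1) (simp add: K_pos)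

lemma modulus_zero: "modulus 0 = M K"
  by (simp add: modulus_def)

lemma modulus_dvd: "k \<le> m \<Longrightarrow> modulus k dvd modulus m"
  unfolding modulus_def M_add M_const by (intro mult_dvd_mono le_imp_power_dvd) simp_all

lemma ord_modulus: "ord (modulus m) q = d * P ^ m"
  unfolding modulus_def stable M_const ..

lemma coprime_modulus_iff: "coprime x (modulus m) \<longleftrightarrow> (\<forall>p\<in>F. coprime x p)"
  unfolding modulus_def by (rule coprime_M_iff) (simp add: K_pos)

lemma coprime_modulus_q: "coprime (modulus m) q"
  unfolding modulus_def by (rule coprime_M_q)

lemma r_coprime_modulus: "i < N \<Longrightarrow> coprime (r i) (modulus m)"
  using r_coprime[of i] coprime_modulus_iff[of "r i" 0] coprime_modulus_iff[of "r i" m] by (simp add: modulus_zero)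

text \<open>The same representatives work modulo \<open>P\<^sup>m \<Prod> p ^ K p\<close>, because \<open>N\<close> cosets with \<open>d P\<^sup>m\<close> elements each
  exhaust the units.\<close>

lemma level_bij:
  "bij_betw (\<lambda>(i, e). r i * q ^ e mod modulus m) ({..<N} \<times> {..<d * P ^ m})
     {x. x < modulus m \<and> coprime x (modulus m)}"
proof -
  have ord0: "ord (modulus 0) q = d" by (simp add: ord_modulus)
  have "totient (modulus m) = totient (modulus 0) * P ^ m"
    unfolding modulus_def using totient_M_add[of K "\<lambda>p. m"] by (simp add: K_pos M_const)
  then have "totient (modulus m) * ord (modulus 0) q = totient (modulus 0) * ord (modulus m) q"
    by (simp add: ord0 ord_modulus)
  moreover have "bij_betw (\<lambda>(i, e). r i * q ^ e mod modulus 0) ({..<N} \<times> {..<ord (modulus 0) q})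
      {x. x < modulus 0 \<and> coprime x (modulus 0)}"
    unfolding ord0 unfolding modulus_zero by (rule reps)
  ultimately show ?thesis
    using lift_representatives[OF modulus_gt_1 modulus_gt_1 modulus_dvd[OF le0] coprime_modulus_q, of "{..<N}" r m]
    by (simp add: r_coprime_modulus ord_modulus)
qed

lemma card_eq: "N * d = totient (M K)"
  using bij_betw_same_card[OF reps] card_units_mod[OF modulus_gt_1[of 0]]
  by (simp add: modulus_zero card_cartesian_product)

lemma N_pos: "N > 0"
proof -
  have "totient (M K) > 0" using M_pos by simp
  then show ?thesis using card_eq by (cases N) auto
qed

lemma level_inj:
  assumes "i < N" "j < N" "e < d * P ^ m" "e' < d * P ^ m"
    and "[r i * q ^ e = r j * q ^ e'] (mod modulus m)"
  shows "i = j \<and> e = e'"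
  using inj_onD[OF bij_betw_imp_inj_on[OF level_bij[of m]], of "(i, e)" "(j, e')"] assms
  by (simp add: cong_def)

lemma power_cong_modulus: "[e = e'] (mod d * P ^ m) \<Longrightarrow> [q ^ e = q ^ e'] (mod modulus m)"
  by (simp add: order_divides_expdiff[OF coprime_modulus_q] ord_modulus)

lemma cong_modulus_prime:
  fixes x y :: nat
  assumes "[x = y] (mod modulus m)" "p \<in> F" "k \<le> K p + m"
  shows "[x = y] (mod p ^ k)"
proof -
  have "[x = y] (mod p ^ (K p + m))"
    using assms(1,2) unfolding modulus_def cong_M_iff by blast
  then show ?thesis
    by (rule cong_dvd_modulus_nat) (simp add: assms(3) le_imp_power_dvd)
qed

text \<open>The factor \<open>P\<close> in the first base keeps this base at least two when \<open>d = 1\<close>.\<close>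

definition base :: "nat \<Rightarrow> nat" where "base k = (if k = 0 then d * P else P)"

lemma base_ge_2: "base k \<ge> 2"
proof -
  have "d * P \<ge> 1 * P" using d_pos by (intro mult_le_mono1) simp
  then have "d * P \<ge> 2" using P_gt_1 by linarith
  then show ?thesis using P_gt_1 by (simp add: base_def)
qed

sublocale digit_bases base by unfold_locales (rule base_ge_2)

lemma weight_base: "weight base (Suc k) = d * P ^ Suc k"
  by (induction k) (simp_all add: base_def)

abbreviation dval :: "(nat \<Rightarrow> nat) \<Rightarrow> nat \<Rightarrow> nat" where "dval \<equiv> digit_value base"

lemma dval_cong: "k \<le> m \<Longrightarrow> [q ^ dval x (Suc m) = q ^ dval x (Suc k)] (mod modulus (Suc k))"
  using digit_value_cong[of "Suc k" "Suc m" x] unfolding weight_base by (intro power_cong_modulus) simp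

text \<open>\<open>H i\<close> is the extension of \<open>e \<mapsto> r i q\<^sup>e\<close> from \<open>\<nat>\<close> to the odometer. The first \<open>n + 1\<close> digits
  determine its value modulo \<open>p\<^sup>n\<close>.\<close>

definition rep :: "nat \<Rightarrow> (nat \<Rightarrow> nat) \<Rightarrow> nat \<Rightarrow> nat \<Rightarrow> int" where
  "rep i x p n = int (r i * q ^ dval x (Suc n))"

definition H :: "nat \<Rightarrow> (nat \<Rightarrow> nat) \<Rightarrow> nat \<Rightarrow> nat \<Rightarrow> int set" where
  "H i x = padic_tuple F (rep i x)"

lemma rep_coherent: "coherent_tuple F (rep i x)"
proof
  fix p assume p: "p \<in> F"
  show "coherent p (rep i x p)"
    unfolding coherent_def
  proof
    fix n
    have "[r i * q ^ dval x (Suc (Suc n)) = r i * q ^ dval x (Suc n)] (mod p ^ n)"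
      by (rule cong_modulus_prime[OF cong_scalar_left[OF dval_cong] p]) simp_all
    then show "[rep i x p (Suc n) = rep i x p n] (mod int p ^ n)"
      unfolding rep_def of_nat_power[symmetric] cong_int_iff .
  qed
qed

lemma coprime_q_iff: "p \<in> F \<Longrightarrow> coprime q p"
  using coprime_q by (simp add: coprime_commute)

lemma H_unit:
  assumes "i < N"
  shows "H i x \<in> Units (ZF_ring F)"
proof -
  have "coprime (rep i x p n) (int p ^ n)" if p: "p \<in> F" for p n
    unfolding rep_def of_nat_power[symmetric] coprime_int_iff
    using r_coprime[OF assms] coprime_modulus_iff[of "r i" 0] coprime_q_iff[OF p] p
    by (simp add: modulus_zero coprime_power_left_iff coprime_power_right_iff)
  then show ?thesis
    unfolding H_def by (simp add: ZF_Units_iff[OF rep_coherent])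
qed

lemma H_continuous:
  assumes "i < N"
  shows "continuous_map X (ZF_units_topology F) (H i)"
proof (rule continuous_map_into_ZF_units)
  show "H i x \<in> Units (ZF_ring F)" for x by (rule H_unit[OF assms])
  fix p n assume p: "p \<in> F"
  show "continuous_map X (discrete_topology (carrier (ZFact (int p ^ n)))) (\<lambda>x. H i x p n)"
  proof (rule continuous_map_finite_digits)
    show "H i x p n \<in> carrier (ZFact (int p ^ n))" for x
      using p by (simp add: H_def padic_tuple_def padic_def carrier_ZFact)
    show "H i x p n = H i y p n" if "\<And>j. j < Suc n \<Longrightarrow> x j = y j" for x y
      using p digit_value_local[of "Suc n" x y base, OF that]
      by (simp add: H_def padic_tuple_def padic_def rep_def del: digit_value_simps)
  qed
qed

text \<open>At level \<open>m + 1\<close> the residue of \<open>H i x\<close> at \<open>p\<close> has to be read modulo \<open>p ^ (K p + m + 1)\<close>. There the sequence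
  uses \<open>K p + m + 2\<close> digits, but the first \<open>m + 1\<close> digits already determine it.\<close>

lemma H_inj:
  assumes ij: "i < N" "j < N" and xy: "x \<in> topspace X" "y \<in> topspace X" and eq: "H i x = H j y"
  shows "i = j \<and> x = y"
proof -
  have level: "i = j \<and> dval x (Suc m) = dval y (Suc m)" for m
  proof (rule level_inj[OF ij])
    show "dval x (Suc m) < d * P ^ Suc m" "dval y (Suc m) < d * P ^ Suc m"
      using digit_value_less[OF xy(1), of "Suc m"] digit_value_less[OF xy(2), of "Suc m"]
      unfolding weight_base .
    have "[r i * q ^ dval x (Suc m) = r j * q ^ dval y (Suc m)] (mod p ^ (K p + Suc m))" if p: "p \<in> F" for p
    proof -
      have red: "[r l * q ^ dval z (Suc (K p + Suc m)) = r l * q ^ dval z (Suc m)] (mod p ^ (K p + Suc m))" for l z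
        by (rule cong_modulus_prime[OF cong_scalar_left[OF dval_cong] p]) simp_all
      have "[rep i x p (K p + Suc m) = rep j y p (K p + Suc m)] (mod int p ^ (K p + Suc m))"
        using eq p unfolding H_def padic_tuple_eq_iff by blast
      then have "[r i * q ^ dval x (Suc (K p + Suc m)) = r j * q ^ dval y (Suc (K p + Suc m))] (mod p ^ (K p + Suc m))"
        unfolding rep_def of_nat_power[symmetric] cong_int_iff .
      then have "[r i * q ^ dval x (Suc m) = r j * q ^ dval y (Suc (K p + Suc m))] (mod p ^ (K p + Suc m))"
        by (rule cong_trans[OF cong_sym[OF red]])
      then show ?thesis by (rule cong_trans[OF _ red])
    qed
    then show "[r i * q ^ dval x (Suc m) = r j * q ^ dval y (Suc m)] (mod modulus (Suc m))"
      unfolding modulus_def cong_M_iff by blast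
  qed
  have "dval x k = dval y k" for k
    using level[of "k - 1"] by (cases k) simp_all
  then show ?thesis using level digit_value_inj by blast
qed

text \<open>Level by level, a unit of \<open>\<int>\<^sub>F\<close> is a residue modulo \<open>modulus m\<close>, hence of the form \<open>r i q\<^sup>e\<close> with
  unique \<open>i\<close> and \<open>e < d P\<^sup>m\<close>; uniqueness makes these exponents the values of a single digit sequence.\<close>

lemma H_surj:
  assumes y: "y \<in> Units (ZF_ring F)"
  shows "\<exists>i<N. \<exists>x\<in>topspace X. y = H i x"
proof -
  interpret R: Group.monoid "ZF_ring F" by (rule monoid_ZF)
  obtain a where a: "coherent_tuple F a" and ya: "y = padic_tuple F a"
    using R.Units_closed[OF y] by (auto simp: carrier_ZF)
  have cop: "coprime (a p n) (int p ^ n)" if "p \<in> F" for p n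
    using y that unfolding ya ZF_Units_iff[OF a] by blast
  have "\<exists>c i e. i < N \<and> e < d * P ^ m \<and> c = r i * q ^ e \<and> (\<forall>p\<in>F. [int c = a p (K p + m)] (mod int p ^ (K p + m)))" for m
  proof -
    define b where "b p = nat (a p (K p + m) mod int p ^ (K p + m))" for p
    have b: "[int (b p) = a p (K p + m)] (mod int p ^ (K p + m))" if "p \<in> F" for p
      using prime_gt_0_nat[OF primes[OF that]] by (simp add: b_def cong_def)
    obtain c where c: "\<forall>p\<in>F. [c = b p] (mod p ^ (K p + m))"
      using chinese_remainder_nat[OF finite_F, of "\<lambda>p. p ^ (K p + m)" b] coprime_powers by blast
    have ca: "[int c = a p (K p + m)] (mod int p ^ (K p + m))" if p: "p \<in> F" for p
    proof -
      have "[int c = int (b p)] (mod int (p ^ (K p + m)))"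
        using c p unfolding cong_int_iff by blast
      then show ?thesis using b[OF p] cong_trans by simp
    qed
    have "coprime c p" if p: "p \<in> F" for p
    proof -
      have "coprime (int c) (int p ^ (K p + m))"
        using cong_imp_coprime[OF cong_sym[OF ca[OF p]]] cop[OF p] by blast
      then show ?thesis using K_pos[of p] by (simp add: coprime_power_right_iff)
    qed
    then have "c mod modulus m \<in> {x. x < modulus m \<and> coprime x (modulus m)}"
      using modulus_gt_1[of m] coprime_modulus_iff[of c m] by (auto simp: coprime_mod_left_iff)
    then have "c mod modulus m \<in> (\<lambda>(i, e). r i * q ^ e mod modulus m) ` ({..<N} \<times> {..<d * P ^ m})"
      unfolding bij_betw_imp_surj_on[OF level_bij[of m]] .
    then obtain i e where ie: "i < N" "e < d * P ^ m" and "c mod modulus m = r i * q ^ e mod modulus m"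
      by auto
    then have "[r i * q ^ e = c] (mod modulus m)" by (simp add: cong_def)
    then have "[int (r i * q ^ e) = int c] (mod int p ^ (K p + m))" if "p \<in> F" for p
      using that unfolding modulus_def cong_M_iff of_nat_power[symmetric] cong_int_iff by blast
    then show ?thesis using ie ca cong_trans by blast
  qed
  then obtain c i e where i: "\<And>m. i m < N" and e: "\<And>m. e m < d * P ^ m" and c: "\<And>m. c m = r (i m) * q ^ e m"
    and ca: "\<And>m p. p \<in> F \<Longrightarrow> [int (c m) = a p (K p + m)] (mod int p ^ (K p + m))"
    by metis
  have step: "i (Suc m) = i m \<and> e (Suc m) mod (d * P ^ m) = e m" for m
  proof (rule level_inj[OF i i _ e])
    show "e (Suc m) mod (d * P ^ m) < d * P ^ m" by (rule mod_less_divisor) (use e[of m] in linarith)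
    have "[c (Suc m) = c m] (mod modulus m)"
      unfolding modulus_def cong_M_iff
    proof
      fix p assume p: "p \<in> F"
      have "[int (c (Suc m)) = a p (K p + Suc m)] (mod int p ^ (K p + m))"
        using ca[OF p, of "Suc m"] by (rule cong_dvd_modulus) (simp add: le_imp_power_dvd)
      also have "[a p (K p + Suc m) = a p (K p + m)] (mod int p ^ (K p + m))"
        using a p by (intro coherent_cong) auto
      also have "[a p (K p + m) = int (c m)] (mod int p ^ (K p + m))"
        by (rule cong_sym[OF ca[OF p]])
      finally show "[c (Suc m) = c m] (mod p ^ (K p + m))"
        by (simp flip: cong_int_iff)
    qed
    moreover have "[r (i (Suc m)) * q ^ (e (Suc m) mod (d * P ^ m)) = c (Suc m)] (mod modulus m)"
      unfolding c by (intro cong_scalar_left power_cong_modulus) (simp add: cong_def)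
    ultimately show "[r (i (Suc m)) * q ^ (e (Suc m) mod (d * P ^ m)) = r (i m) * q ^ e m] (mod modulus m)"
      unfolding c using cong_trans by blast
  qed
  have i_const: "i m = i 0" for m
    by (induction m) (simp_all add: step)
  \<comment> \<open>The empty prefix has the value \<open>0\<close>, while the exponents at level \<open>0\<close> range over \<open>{..<d}\<close>.\<close>
  define s where "s k = (if k = 0 then 0 else e k)" for k
  have "\<exists>x\<in>topspace X. \<forall>k. dval x k = s k"
  proof (rule digit_value_surj)
    show "s k < weight base k" for k
      using e[of k] by (cases k) (simp_all add: s_def weight_base del: weight_simps(2))
    show "s (Suc k) mod weight base k = s k" for k
      using step[of k] by (cases k) (simp_all add: s_def weight_base del: weight_simps(2))
  qed
  then obtain x where x: "x \<in> topspace X" "\<And>k. dval x k = s k" by blast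
  have "y = H (i 0) x"
    unfolding ya H_def padic_tuple_eq_iff
  proof (intro ballI allI)
    fix p n assume p: "p \<in> F"
    have "rep (i 0) x p n = int (c (Suc n))"
      unfolding rep_def x(2) c i_const[of "Suc n"] by (simp add: s_def)
    also have "[int (c (Suc n)) = a p (K p + Suc n)] (mod int p ^ n)"
      using ca[OF p, of "Suc n"] by (rule cong_dvd_modulus) (simp add: le_imp_power_dvd)
    also have "[a p (K p + Suc n) = a p n] (mod int p ^ n)"
      using a p by (intro coherent_cong) auto
    finally show "[a p n = rep (i 0) x p n] (mod int p ^ n)" by (rule cong_sym)
  qed
  then show ?thesis using i x(1) by blast
qed

lemma H_generator:
  assumes x: "x \<in> topspace X"
  shows "H i (odometer base x) = unit_mult F q 1 (H i x)"
proof -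
  have "[rep i (odometer base x) p n = int q * rep i x p n] (mod int p ^ n)" if p: "p \<in> F" for p n
  proof -
    have "[q ^ dval (odometer base x) (Suc n) = q ^ (dval x (Suc n) + 1)] (mod modulus (Suc n))"
      using digit_value_odometer[OF x, of "Suc n"] unfolding weight_base by (rule power_cong_modulus)
    then have "[r i * q ^ dval (odometer base x) (Suc n) = r i * q ^ (dval x (Suc n) + 1)] (mod p ^ n)"
      by (intro cong_modulus_prime[OF cong_scalar_left p]) auto
    also have "r i * q ^ (dval x (Suc n) + 1) = q * (r i * q ^ dval x (Suc n))"
      by simp
    finally show ?thesis
      unfolding rep_def of_nat_power[symmetric] of_nat_mult[symmetric] cong_int_iff .
  qed
  moreover have "unit_mult F q 1 (H i x) = padic_tuple F (\<lambda>p n. int q * rep i x p n)"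
    unfolding H_def by (rule unit_mult_one[OF coprime_q])
  ultimately show ?thesis
    by (simp add: H_def padic_tuple_eq_iff)
qed

text \<open>Bijectivity of the odometer is inherited from multiplication by \<open>q\<close> on the unit group: \<open>H 0\<close> is injective
  and intertwines the two maps, and the inverse of multiplication by \<open>q\<close> stays in the image of \<open>H 0\<close> because
  distinct \<open>H j\<close> have disjoint images.\<close>

lemma odometer_homeomorphism: "homeomorphic_map X X (odometer base)"
proof (rule continuous_imp_homeomorphic_map[OF odometer_continuous compact_X Hausdorff_X])
  interpret Y: int_system "ZF_units_topology F" "unit_mult F q" by (rule int_system_unit_mult[OF coprime_q])
  have H_top: "H 0 x \<in> topspace (ZF_units_topology F)" for x
    using H_unit[OF N_pos] by (simp add: topspace_ZF_units)
  show "inj_on (odometer base) (topspace X)"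
  proof (rule inj_onI)
    fix x y assume xy: "x \<in> topspace X" "y \<in> topspace X" and "odometer base x = odometer base y"
    then have "unit_mult F q 1 (H 0 x) = unit_mult F q 1 (H 0 y)"
      using H_generator by metis
    then have "H 0 x = H 0 y"
      using Y.h_minus(2)[OF H_top, of 1] by metis
    then show "x = y" using H_inj[OF N_pos N_pos xy] by blast
  qed
  show "odometer base ` topspace X = topspace X"
  proof (intro subset_antisym subsetI)
    show "x \<in> topspace X" if "x \<in> odometer base ` topspace X" for x
      using that odometer_closed by blast
    fix x assume x: "x \<in> topspace X"
    have "unit_mult F q (- 1) (H 0 x) \<in> Units (ZF_ring F)"
      using Y.h_closed[OF H_top] by (simp add: topspace_ZF_units)
    then obtain j z where j: "j < N" and z: "z \<in> topspace X" and eq: "unit_mult F q (- 1) (H 0 x) = H j z"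
      using H_surj by blast
    have "H j (odometer base z) = H 0 x"
      using Y.h_minus(1)[OF H_top, of 1] by (simp add: H_generator[OF z] flip: eq)
    then have "odometer base z = x"
      using H_inj[OF j N_pos odometer_closed[OF z] x] by blast
    then show "x \<in> odometer base ` topspace X" using z by blast
  qed
qed

lemma system_decomposition_units:
  "system_decomposition X (homeo_power X (odometer base)) (ZF_units_topology F) (unit_mult F q) N H"
proof -
  interpret Y: int_system "ZF_units_topology F" "unit_mult F q" by (rule int_system_unit_mult[OF coprime_q])
  interpret X: int_system X "homeo_power X (odometer base)" by (rule int_system_homeo_power[OF odometer_homeomorphism])
  have H_top: "H i x \<in> topspace (ZF_units_topology F)" if "i < N" for i x
    using H_unit[OF that] by (simp add: topspace_ZF_units)
  show ?thesis
  proof unfold_locales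
    show "compact_space X" by (rule compact_X)
    show "Hausdorff_space (ZF_units_topology F)" by (rule Hausdorff_ZF_units)
    show "continuous_map X (ZF_units_topology F) (H i)" if "i < N" for i
      by (rule H_continuous[OF that])
    show "i = j \<and> x = x'" if "i < N" "j < N" "x \<in> topspace X" "x' \<in> topspace X" "H i x = H j x'" for i j x x'
      by (rule H_inj[OF that])
    show "\<exists>i<N. \<exists>x\<in>topspace X. y = H i x" if "y \<in> topspace (ZF_units_topology F)" for y
      using that H_surj by (simp add: topspace_ZF_units)
    show "H i (homeo_power X (odometer base) m x) = unit_mult F q m (H i x)" if "i < N" "x \<in> topspace X" for i m x
      using homeo_power_equivariant[where g = "H i", OF odometer_homeomorphism Y.int_system_axioms]
        H_top[OF that(1)] H_generator that(2) by simp
  qed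
qed

lemma crossed_product_iso:
  "cstar_isomorphic (crossed_product (cont_algebra (ZF_units_topology F)) (sigma_action F q))
     (direct_sum_copies N (odometer_algebra base))"
  using system_decomposition.crossed_product_decomposition[OF system_decomposition_units]
  by (simp add: sigma_action_unit_mult odometer_algebra_def)

text \<open>A prime in \<open>F\<close> divides every base and accumulates infinite exponent, which absorbs its multiplicity in \<open>d\<close>
  and the additional factor \<open>P\<close> of the first base. Other primes occur in the factor \<open>d\<close> of the first base alone.\<close>

lemma supernatural_base:
  "supernatural_prod base = supernatural_mult (supernatural_of_nat d) (primes_to_infinity F)"
proof
  fix p
  have d0: "d \<noteq> 0" using d_pos by simp
  have P0: "P \<noteq> 0" using P_gt_1 by simp
  define f where "f M = (\<Sum>k<M. supernatural_of_nat (base k) p)" for M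
  consider "\<not> Factorial_Ring.prime p" | "p \<in> F" | "Factorial_Ring.prime p" "p \<notin> F" by blast
  then have "(SUP M. f M) = supernatural_of_nat d p + primes_to_infinity F p"
  proof cases
    case 1
    then have "p \<notin> F" using primes by blast
    then show ?thesis using 1 by (simp add: f_def supernatural_of_nat_def primes_to_infinity_def)
  next
    case 2
    have pr: "Factorial_Ring.prime p" by (rule primes[OF 2])
    have "p dvd base k" for k
      using dvd_prodI[OF finite_F 2, of "\<lambda>x. x"] by (simp add: base_def)
    then have "multiplicity p (base k) \<ge> 1" for k
      using base_ge_2[of k] prime_power_dvd_iff[OF pr, of "base k" 1] by simp
    then have "enat M \<le> f M" for M
    proof (induction M)
      case (Suc M)
      have "enat (Suc M) = enat M + enat 1" by simp
      also have "\<dots> \<le> f M + enat (multiplicity p (base M))"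
        using Suc by (intro add_mono) simp_all
      finally show ?case using pr by (simp add: f_def supernatural_of_nat_def)
    qed (simp add: f_def zero_enat_def)
    then have le: "enat M \<le> (SUP M. f M)" for M
      using SUP_upper[of M UNIV f] order_trans by blast
    have "(SUP M. f M) = \<infinity>"
    proof (cases "SUP M. f M")
      case (enat k)
      then show ?thesis using le[of "Suc k"] by simp
    qed simp
    then show ?thesis using 2 by (simp add: primes_to_infinity_def)
  next
    case 3
    have "\<not> p dvd P"
    proof
      assume "p dvd P"
      then obtain p' where "p' \<in> F" "p dvd p'"
        using prime_dvd_prod_iff[OF finite_F 3(1), of "\<lambda>x. x"] by auto
      then show False using primes 3 primes_dvd_imp_eq by blast
    qed
    then have mP: "multiplicity p P = 0" by (rule not_dvd_imp_multiplicity_0)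
    have "multiplicity p (d * P) = multiplicity p d"
      using 3(1) d0 P0 by (subst prime_elem_multiplicity_mult_distrib) (auto simp: mP)
    then have f: "f M = (if M = 0 then 0 else enat (multiplicity p d))" for M
    proof (induction M)
      case (Suc M)
      then show ?case using 3(1) mP
        by (cases "M = 0") (simp_all add: f_def supernatural_of_nat_def base_def zero_enat_def[symmetric])
    qed (simp add: f_def)
    have "(SUP M. f M) = enat (multiplicity p d)"
    proof (rule antisym)
      show "(SUP M. f M) \<le> enat (multiplicity p d)" by (intro SUP_least) (simp add: f)
      show "enat (multiplicity p d) \<le> (SUP M. f M)" using SUP_upper[of 1 UNIV f] by (simp add: f)
    qed
    then show ?thesis using 3 by (simp add: supernatural_of_nat_def primes_to_infinity_def)
  qed
  then show "supernatural_prod base p = supernatural_mult (supernatural_of_nat d) (primes_to_infinity F) p"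
    by (simp add: supernatural_prod_def supernatural_mult_def f_def)
qed

lemma bunce_deddens: "bunce_deddens_algebra (supernatural_mult (supernatural_of_nat d) (primes_to_infinity F)) (odometer_algebra base)"
  unfolding bunce_deddens_algebra_def using base_ge_2 supernatural_base by blast

lemma unit_order_eq: "unit_order F (\<lambda>p. K p + l p) q = d * (\<Prod>p\<in>F. p ^ l p)"
proof -
  have iff: "unit_order F (\<lambda>p. K p + l p) q dvd m \<longleftrightarrow> ord (M (\<lambda>p. K p + l p)) q dvd m" for m
    using unit_order_iff[of F q "\<lambda>p. K p + l p" m] coprime_q unfolding ord_divides[symmetric] cong_M_iff by blast
  then have "unit_order F (\<lambda>p. K p + l p) q = ord (M (\<lambda>p. K p + l p)) q"
    by (meson dvd_antisym dvd_refl)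
  then show ?thesis unfolding stable by (simp add: prime_power_prod_def)
qed

lemma copies_eq: "real N = (\<Prod>p\<in>F. (real p - 1) * real p powi (int (K p) - 1)) / real d"
proof -
  have "real ((p - 1) * p ^ (K p - 1)) = (real p - 1) * real p powi (int (K p) - 1)" if "p \<in> F" for p
  proof -
    have "int (K p) - 1 = int (K p - 1)" using K_pos[of p] by simp
    then have "real p powi (int (K p) - 1) = real p ^ (K p - 1)" by (simp only: power_int_of_nat)
    then show ?thesis using prime_ge_1_nat[OF primes[OF that]] by (simp add: of_nat_diff)
  qed
  then have "real (totient (M K)) = (\<Prod>p\<in>F. (real p - 1) * real p powi (int (K p) - 1))"
    by (simp add: totient_M K_pos of_nat_prod)
  then show ?thesis using card_eq d_pos by (simp add: field_simps flip: of_nat_mult)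
qed

end

theorem theorem3p1:
  fixes F :: "nat set" and q :: nat
  assumes "finite F" and "F \<noteq> {}" and "\<forall>p\<in>F. Factorial_Ring.prime p"
    and "Factorial_Ring.prime q" and "q \<notin> F"
  shows "\<exists>(K :: nat \<Rightarrow> nat) (d :: nat).
    (\<forall>l :: nat \<Rightarrow> nat. unit_order F (\<lambda>p. K p + l p) q = d * (\<Prod>p\<in>F. p ^ l p)) \<and>
    (\<exists>(N :: nat) D.
      real N = (\<Prod>p\<in>F. (real p - 1) * real p powi (int (K p) - 1)) / real d \<and>
      bunce_deddens_algebra (supernatural_mult (supernatural_of_nat d) (primes_to_infinity F)) D \<and>
      cstar_isomorphic
        (crossed_product (cont_algebra (ZF_units_topology F)) (sigma_action F q))
        (direct_sum_copies N D))"
proof -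
  interpret prime_set F q using assms by unfold_locales auto
  obtain K d N r where "stable_level F q K d N r" using stable_level_exists .
  then interpret stable_level F q K d N r .
  show ?thesis
    using unit_order_eq copies_eq bunce_deddens crossed_product_iso by blast
qed

end
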